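(* Let $A$ be a finite dimensional algebra over a field $F$, and let $P_i$ and $P_j$ be the projective covers of simple $A$-modules $S_i$ and $S_j$ respectively. Then for every integer $n \geq 1$ there are $F$-linear isomorphisms $$\operatorname{Hom}_A(\operatorname{rad}_n P_i, S_j) \cong \operatorname{Hom}_{A^{\mathrm{op}}}\big(\operatorname{rad}_n(P_j^{\vee}), S_i^{*}\big)$$ and $$\operatorname{Hom}_A(\operatorname{rad}_n P_i, S_j) \cong \operatorname{Hom}_A(S_i, \operatorname{soc}_n \nu P_j).$$
   Context: The term module means finitely generated right module; $A^{\mathrm{op}}$ denotes the opposite algebra of $A$, so left $A$-modules are regarded as right $A^{\mathrm{op}}$-modules. Duals: $(-)^{*} = \operatorname{Hom}_F(-,F)$ is the $F$-dual functor (sending $A$-modules to $A^{\mathrm{op}}$-modules and vice versa, with the usual actions); $(-)^{\vee} = \operatorname{Hom}_A(-,A)$ is the $A$-dual functor (sending $A$-modules to $A^{\mathrm{op}}$-modules, using the left multiplication of $A$ on itself); $\nu(-) = \big((-)^{\vee}\big)^{*}$ is the Nakayama functor, sending $A$-modules to $A$-modules. Radical and socle layers: for a module $V$ over an algebra, $\operatorname{soc} V$ is the sum of the minimal submodules of $V$ and $\operatorname{rad} V$ is the intersection of the maximal submodules of $V$. Define inductively $\operatorname{soc}^0 V = 0$ and $\operatorname{soc}^n V = \{ v \in V \mid v + \operatorname{soc}^{n-1} V \in \operatorname{soc}(V/\operatorname{soc}^{n-1}V)\}$ for $n>0$; and $\operatorname{rad}^0 V = V$ and $\operatorname{rad}^n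 V = \operatorname{rad}(\operatorname{rad}^{n-1} V)$ for $n>0$. For $n \geq 1$ the $n$th socle layer is $\operatorname{soc}_n V = \operatorname{soc}^n V/\operatorname{soc}^{n-1} V$ and the $n$th radical layer is $\operatorname{rad}_n V = \operatorname{rad}^{n-1} V/\operatorname{rad}^n V$. *)

theory Defs
  imports "HOL-Algebra.Module" "HOL-Algebra.AbelCoset"
begin

text \<open>
  \<^locale>\<open>module\<close> requires a commutative ring of scalars, so right modules over an arbitrary
  ring are introduced here, on the same record type. The scalar is written on the left: the right
  action \<open>x a\<close> is \<open>a \<odot>\<^bsub>M\<^esub> x\<close>, whence the order of the factors in \<open>smult_mult\<close>. The fields
  \<open>mult\<close> and \<open>one\<close> of the record play no role for modules.
\<close>

locale right_module = A?: ring A + M?: abelian_group M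
  for A :: "('a, 'k) ring_scheme" and M :: "('a, 'm) module" (structure) +
  assumes smult_closed:
      "\<lbrakk>a \<in> carrier A; x \<in> carrier M\<rbrakk> \<Longrightarrow> a \<odot>\<^bsub>M\<^esub> x \<in> carrier M"
    and smult_l_distr:
      "\<lbrakk>a \<in> carrier A; b \<in> carrier A; x \<in> carrier M\<rbrakk>
        \<Longrightarrow> (a \<oplus>\<^bsub>A\<^esub> b) \<odot>\<^bsub>M\<^esub> x = a \<odot>\<^bsub>M\<^esub> x \<oplus>\<^bsub>M\<^esub> b \<odot>\<^bsub>M\<^esub> x"
    and smult_r_distr:
      "\<lbrakk>a \<in> carrier A; x \<in> carrier M; y \<in> carrier M\<rbrakk>
        \<Longrightarrow> a \<odot>\<^bsub>M\<^esub> (x \<oplus>\<^bsub>M\<^esub> y) = a \<odot>\<^bsub>M\<^esub> x \<oplus>\<^bsub>M\<^esub> a \<odot>\<^bsub>M\<^esub> y"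
    and smult_mult:
      "\<lbrakk>a \<in> carrier A; b \<in> carrier A; x \<in> carrier M\<rbrakk>
        \<Longrightarrow> (a \<otimes>\<^bsub>A\<^esub> b) \<odot>\<^bsub>M\<^esub> x = b \<odot>\<^bsub>M\<^esub> (a \<odot>\<^bsub>M\<^esub> x)"
    and smult_one: "x \<in> carrier M \<Longrightarrow> \<one>\<^bsub>A\<^esub> \<odot>\<^bsub>M\<^esub> x = x"

definition module_span ::
    "('a, 'k) ring_scheme \<Rightarrow> ('a, 'm) module \<Rightarrow> 'm set \<Rightarrow> 'm set" where
  "module_span A M S = \<Inter>{N. submodule N A M \<and> S \<subseteq> N}"

definition fin_gen :: "('a, 'k) ring_scheme \<Rightarrow> ('a, 'm) module \<Rightarrow> bool" where
  "fin_gen A M \<longleftrightarrow> (\<exists>S. finite S \<and> S \<subseteq> carrier M \<and> module_span A M S = carrier M)"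

definition fg_right_module :: "('a, 'k) ring_scheme \<Rightarrow> ('a, 'm) module \<Rightarrow> bool" where
  "fg_right_module A M \<longleftrightarrow> right_module A M \<and> fin_gen A M"

text \<open>
  The library locale \<^locale>\<open>algebra\<close> is restricted to commutative algebras. Here an algebra is a
  unital ring with a compatible vector space structure; finite dimension is finite generation as a
  vector space.
\<close>

locale fd_algebra = F?: field F + module F A + A?: ring A
  for F :: "('f, 'k) ring_scheme" and A :: "('f, 'a) module" +
  assumes smult_mult_left:
      "\<lbrakk>c \<in> carrier F; a \<in> carrier A; b \<in> carrier A\<rbrakk>
        \<Longrightarrow> (c \<odot>\<^bsub>A\<^esub> a) \<otimes>\<^bsub>A\<^esub> b = c \<odot>\<^bsub>A\<^esub> (a \<otimes>\<^bsub>A\<^esub> b)"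
    and smult_mult_right:
      "\<lbrakk>c \<in> carrier F; a \<in> carrier A; b \<in> carrier A\<rbrakk>
        \<Longrightarrow> a \<otimes>\<^bsub>A\<^esub> (c \<odot>\<^bsub>A\<^esub> b) = c \<odot>\<^bsub>A\<^esub> (a \<otimes>\<^bsub>A\<^esub> b)"
    and fin_dim: "fin_gen F A"

definition opposite :: "('f, 'a) module \<Rightarrow> ('f, 'a) module" where
  "opposite A = A\<lparr>mult := (\<lambda>x y. y \<otimes>\<^bsub>A\<^esub> x)\<rparr>"

definition regular :: "('a, 'k) ring_scheme \<Rightarrow> ('a, 'a) module" where
  "regular A = \<lparr>carrier = carrier A, mult = mult A, one = \<one>\<^bsub>A\<^esub>, zero = \<zero>\<^bsub>A\<^esub>, add = add A,
     smult = (\<lambda>a x. x \<otimes>\<^bsub>A\<^esub> a)\<rparr>"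

text \<open>The vector space underlying a module over an algebra: \<open>c\<close> acts as \<open>c 1\<^sub>A\<close>.\<close>

definition restrict_scalars :: "('f, 'a) module \<Rightarrow> ('a, 'm) module \<Rightarrow> ('f, 'm) module" where
  "restrict_scalars A M = \<lparr>carrier = carrier M, mult = mult M, one = \<one>\<^bsub>M\<^esub>, zero = \<zero>\<^bsub>M\<^esub>,
     add = add M, smult = (\<lambda>c x. (c \<odot>\<^bsub>A\<^esub> \<one>\<^bsub>A\<^esub>) \<odot>\<^bsub>M\<^esub> x)\<rparr>"


subsection \<open>Homomorphisms\<close>

text \<open>Homomorphisms are extensional, so that each one is represented by exactly one function.\<close>

definition mod_hom ::
    "('a, 'k) ring_scheme \<Rightarrow> ('a, 'm) module \<Rightarrow> ('a, 'n) module \<Rightarrow> ('m \<Rightarrow> 'n) set" where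
  "mod_hom A M N = {f \<in> carrier M \<rightarrow>\<^sub>E carrier N.
     (\<forall>x\<in>carrier M. \<forall>y\<in>carrier M. f (x \<oplus>\<^bsub>M\<^esub> y) = f x \<oplus>\<^bsub>N\<^esub> f y) \<and>
     (\<forall>a\<in>carrier A. \<forall>x\<in>carrier M. f (a \<odot>\<^bsub>M\<^esub> x) = a \<odot>\<^bsub>N\<^esub> f x)}"

definition mod_iso ::
    "('a, 'k) ring_scheme \<Rightarrow> ('a, 'm) module \<Rightarrow> ('a, 'n) module \<Rightarrow> bool" where
  "mod_iso A M N \<longleftrightarrow> (\<exists>f\<in>mod_hom A M N. bij_betw f (carrier M) (carrier N))"

text \<open>A set of homomorphisms with pointwise addition, and a scalar action yet to be chosen.\<close>

definition hom_module ::
    "('a, 'k) ring_scheme \<Rightarrow> ('a, 'm) module \<Rightarrow> ('a, 'n) module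
      \<Rightarrow> ('c \<Rightarrow> ('m \<Rightarrow> 'n) \<Rightarrow> 'm \<Rightarrow> 'n) \<Rightarrow> ('c, 'm \<Rightarrow> 'n) module" where
  "hom_module A M N act = \<lparr>carrier = mod_hom A M N, mult = undefined, one = undefined,
     zero = (\<lambda>x\<in>carrier M. \<zero>\<^bsub>N\<^esub>), add = (\<lambda>f g. \<lambda>x\<in>carrier M. f x \<oplus>\<^bsub>N\<^esub> g x), smult = act\<rparr>"

definition hom_space ::
    "('f, 'a) module \<Rightarrow> ('a, 'm) module \<Rightarrow> ('a, 'n) module \<Rightarrow> ('f, 'm \<Rightarrow> 'n) module" where
  "hom_space A M N =
     hom_module A M N (\<lambda>c f. \<lambda>x\<in>carrier M. c \<odot>\<^bsub>restrict_scalars A N\<^esub> f x)"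

text \<open>
  The duals of a right \<open>A\<close>-module are left \<open>A\<close>-modules via \<open>(a f) x = f (x a)\<close> and
  \<open>(a f) x = a (f x)\<close> respectively, i.e. right modules over \<^term>\<open>opposite A\<close>.
\<close>

definition F_dual ::
    "('f, 'k) ring_scheme \<Rightarrow> ('f, 'a) module \<Rightarrow> ('a, 'm) module \<Rightarrow> ('a, 'm \<Rightarrow> 'f) module" where
  "F_dual F A M = hom_module F (restrict_scalars A M) (regular F)
     (\<lambda>a f. \<lambda>x\<in>carrier M. f (a \<odot>\<^bsub>M\<^esub> x))"

definition A_dual :: "('f, 'a) module \<Rightarrow> ('a, 'm) module \<Rightarrow> ('a, 'm \<Rightarrow> 'a) module" where
  "A_dual A M = hom_module A M (regular A) (\<lambda>a f. \<lambda>x\<in>carrier M. a \<otimes>\<^bsub>A\<^esub> f x)"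

definition nakayama ::
    "('f, 'k) ring_scheme \<Rightarrow> ('f, 'a) module \<Rightarrow> ('a, 'm) module
      \<Rightarrow> ('a, ('m \<Rightarrow> 'a) \<Rightarrow> 'f) module" where
  "nakayama F A M = F_dual F (opposite A) (A_dual A M)"


subsection \<open>Radical and socle layers\<close>

definition quot_module :: "('a, 'm) module \<Rightarrow> 'm set \<Rightarrow> ('a, 'm set) module" where
  "quot_module M N = \<lparr>carrier = a_rcosets\<^bsub>M\<^esub> N, mult = undefined, one = undefined,
     zero = N, add = set_add M, smult = (\<lambda>a X. \<Union>x\<in>X. N +>\<^bsub>M\<^esub> (a \<odot>\<^bsub>M\<^esub> x))\<rparr>"

definition minimal_submodule ::
    "('a, 'k) ring_scheme \<Rightarrow> ('a, 'm) module \<Rightarrow> 'm set \<Rightarrow> bool" where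
  "minimal_submodule A M N \<longleftrightarrow> submodule N A M \<and> N \<noteq> {\<zero>\<^bsub>M\<^esub>} \<and>
     (\<forall>L. submodule L A M \<and> L \<subseteq> N \<longrightarrow> L = {\<zero>\<^bsub>M\<^esub>} \<or> L = N)"

definition maximal_submodule ::
    "('a, 'k) ring_scheme \<Rightarrow> ('a, 'm) module \<Rightarrow> 'm set \<Rightarrow> bool" where
  "maximal_submodule A M N \<longleftrightarrow> submodule N A M \<and> N \<noteq> carrier M \<and>
     (\<forall>L. submodule L A M \<and> N \<subseteq> L \<longrightarrow> L = N \<or> L = carrier M)"

definition soc :: "('a, 'k) ring_scheme \<Rightarrow> ('a, 'm) module \<Rightarrow> 'm set" where
  "soc A M = module_span A M (\<Union>{N. minimal_submodule A M N})"

text \<open>The radical of a module without maximal submodules is the whole module.\<close>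

definition rad :: "('a, 'k) ring_scheme \<Rightarrow> ('a, 'm) module \<Rightarrow> 'm set" where
  "rad A M = carrier M \<inter> \<Inter>{N. maximal_submodule A M N}"

primrec soc_pow :: "('a, 'k) ring_scheme \<Rightarrow> ('a, 'm) module \<Rightarrow> nat \<Rightarrow> 'm set" where
  "soc_pow A M 0 = {\<zero>\<^bsub>M\<^esub>}"
| "soc_pow A M (Suc n) =
     {x \<in> carrier M. soc_pow A M n +>\<^bsub>M\<^esub> x \<in> soc A (quot_module M (soc_pow A M n))}"

primrec rad_pow :: "('a, 'k) ring_scheme \<Rightarrow> ('a, 'm) module \<Rightarrow> nat \<Rightarrow> 'm set" where
  "rad_pow A M 0 = carrier M"
| "rad_pow A M (Suc n) = rad A (M\<lparr>carrier := rad_pow A M n\<rparr>)"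

text \<open>The layers are meant for \<open>n \<ge> 1\<close> only.\<close>

definition soc_layer ::
    "('a, 'k) ring_scheme \<Rightarrow> nat \<Rightarrow> ('a, 'm) module \<Rightarrow> ('a, 'm set) module" where
  "soc_layer A n M = quot_module (M\<lparr>carrier := soc_pow A M n\<rparr>) (soc_pow A M (n - 1))"

definition rad_layer ::
    "('a, 'k) ring_scheme \<Rightarrow> nat \<Rightarrow> ('a, 'm) module \<Rightarrow> ('a, 'm set) module" where
  "rad_layer A n M = quot_module (M\<lparr>carrier := rad_pow A M (n - 1)\<rparr>) (rad_pow A M n)"


subsection \<open>Simple modules and projective covers\<close>

definition simple_module :: "('a, 'k) ring_scheme \<Rightarrow> ('a, 'm) module \<Rightarrow> bool" where
  "simple_module A S \<longleftrightarrow> fg_right_module A S \<and> carrier S \<noteq> {\<zero>\<^bsub>S\<^esub>} \<and>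
     (\<forall>N. submodule N A S \<longrightarrow> N = {\<zero>\<^bsub>S\<^esub>} \<or> N = carrier S)"

text \<open>
  Projectivity is the lifting property with respect to all epimorphisms of finitely generated
  modules. A definition cannot quantify over types, so the modules range over those with elements
  of type \<^typ>\<open>nat \<Rightarrow> 'a\<close>. As a quotient of some \<open>A\<^sup>n\<close>, every finitely generated module is
  isomorphic to one of these; \<open>projective_lift\<close> below gives the lifting property for modules
  over arbitrary types.
\<close>

definition projective_module :: "('a, 'k) ring_scheme \<Rightarrow> ('a, 'm) module \<Rightarrow> bool" where
  "projective_module A P \<longleftrightarrow> fg_right_module A P \<and>
     (\<forall>(M :: ('a, nat \<Rightarrow> 'a) module) (N :: ('a, nat \<Rightarrow> 'a) module) g f.
        fg_right_module A M \<and> fg_right_module A N \<and>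
        g \<in> mod_hom A M N \<and> g ` carrier M = carrier N \<and> f \<in> mod_hom A P N
        \<longrightarrow> (\<exists>h\<in>mod_hom A P M. \<forall>x\<in>carrier P. g (h x) = f x))"

definition superfluous ::
    "('a, 'k) ring_scheme \<Rightarrow> ('a, 'm) module \<Rightarrow> 'm set \<Rightarrow> bool" where
  "superfluous A M K \<longleftrightarrow>
     (\<forall>N. submodule N A M \<and> N <+>\<^bsub>M\<^esub> K = carrier M \<longrightarrow> N = carrier M)"

definition projective_cover ::
    "('a, 'k) ring_scheme \<Rightarrow> ('a, 'p) module \<Rightarrow> ('a, 'm) module \<Rightarrow> ('p \<Rightarrow> 'm) \<Rightarrow> bool" where
  "projective_cover A P M p \<longleftrightarrow> projective_module A P \<and> p \<in> mod_hom A P M \<and>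
     p ` carrier P = carrier M \<and> superfluous A P {x \<in> carrier P. p x = \<zero>\<^bsub>M\<^esub>}"


subsection \<open>The lifting property over arbitrary types\<close>

lemma (in right_module) submodule_carrier: "submodule (carrier M) A M"
  using M.add.group_l_invI M.add.subgroup_self smult_closed
  by (auto simp: submodule_def submodule_axioms_def)

lemma (in right_module) submodule_span:
  assumes "S \<subseteq> carrier M" shows "submodule (module_span A M S) A M"
proof -
  have c: "carrier M \<in> {N. submodule N A M \<and> S \<subseteq> N}"
    using submodule_carrier assms by simp
  have "subgroup (module_span A M S) (add_monoid M)"
    unfolding module_span_def
    by (rule M.add.subgroups_Inter) (use c in \<open>auto simp: submodule_def\<close>)
  moreover have "a \<odot> x \<in> module_span A M S" if "a \<in> carrier A" "x \<in> module_span A M S" for a x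
    using that by (auto simp: module_span_def submodule_def submodule_axioms_def)
  ultimately show ?thesis
    by (simp add: submodule_def submodule_axioms_def)
qed

lemma module_span_least: "\<lbrakk>submodule N A M; S \<subseteq> N\<rbrakk> \<Longrightarrow> module_span A M S \<subseteq> N"
  by (auto simp: module_span_def)

lemma module_span_superset: "S \<subseteq> module_span A M S"
  by (auto simp: module_span_def)

lemma (in right_module) smult_zero_left:
  assumes "x \<in> carrier M" shows "\<zero>\<^bsub>A\<^esub> \<odot> x = \<zero>"
proof -
  have "\<zero>\<^bsub>A\<^esub> \<odot> x = \<zero>\<^bsub>A\<^esub> \<odot> x \<oplus> \<zero>\<^bsub>A\<^esub> \<odot> x"
    using smult_l_distr[of "\<zero>\<^bsub>A\<^esub>" "\<zero>\<^bsub>A\<^esub>" x] assms by simp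
  then show ?thesis
    using assms smult_closed[of "\<zero>\<^bsub>A\<^esub>" x] by (metis A.zero_closed M.add.r_cancel_one')
qed

lemma (in right_module) smult_minus_left:
  assumes "a \<in> carrier A" "x \<in> carrier M" shows "(\<ominus>\<^bsub>A\<^esub> a) \<odot> x = \<ominus> (a \<odot> x)"
proof -
  have "(\<ominus>\<^bsub>A\<^esub> a) \<odot> x \<oplus> a \<odot> x = \<zero>"
    using smult_l_distr[of "\<ominus>\<^bsub>A\<^esub> a" a x] assms smult_zero_left by (simp add: A.l_neg)
  then show ?thesis
    using assms smult_closed by (simp add: M.minus_equality)
qed

lemma (in right_module) submodule_add_cyclic:
  assumes N: "submodule N A M" and s: "s \<in> carrier M"
  shows "submodule {x \<oplus> a \<odot> s |x a. x \<in> N \<and> a \<in> carrier A} A M" (is "submodule ?L A M")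
proof -
  interpret N: subgroup N "add_monoid M" using N by (simp add: submodule_def)
  have sub: "x \<in> carrier M" if "x \<in> N" for x using N.subset that by auto
  have "subgroup ?L (add_monoid M)"
  proof (rule M.add.subgroupI)
    show "?L \<subseteq> carrier M" using sub s smult_closed by auto
    have "\<zero> \<oplus> \<zero>\<^bsub>A\<^esub> \<odot> s \<in> ?L" using N.one_closed by force
    then show "?L \<noteq> {}" by auto
  next
    fix y assume "y \<in> ?L"
    then obtain x a where xa: "y = x \<oplus> a \<odot> s" "x \<in> N" "a \<in> carrier A" by auto
    have "\<ominus> y = \<ominus> x \<oplus> (\<ominus>\<^bsub>A\<^esub> a) \<odot> s"
      using xa sub s smult_closed smult_minus_left by (simp add: M.minus_add)
    moreover have "\<ominus> x \<in> N" using N.m_inv_closed xa by (simp add: a_inv_def)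
    ultimately show "\<ominus> y \<in> ?L" using xa by auto
  next
    fix y z assume "y \<in> ?L" "z \<in> ?L"
    then obtain x a x' a' where xa: "y = x \<oplus> a \<odot> s" "x \<in> N" "a \<in> carrier A"
      "z = x' \<oplus> a' \<odot> s" "x' \<in> N" "a' \<in> carrier A" by auto
    have "y \<oplus> z = (x \<oplus> x') \<oplus> (a \<oplus>\<^bsub>A\<^esub> a') \<odot> s"
      using xa sub s smult_closed by (simp add: smult_l_distr M.a_ac)
    moreover have "x \<oplus> x' \<in> N" using N.m_closed xa by simp
    ultimately show "y \<oplus> z \<in> ?L" using xa by auto
  qed
  moreover have "b \<odot> y \<in> ?L" if b: "b \<in> carrier A" and "y \<in> ?L" for b y
  proof -
    obtain x a where xa: "y = x \<oplus> a \<odot> s" "x \<in> N" "a \<in> carrier A" using \<open>y \<in> ?L\<close> by auto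
    have "b \<odot> y = b \<odot> x \<oplus> (a \<otimes>\<^bsub>A\<^esub> b) \<odot> s"
      using xa b sub s smult_closed by (simp add: smult_r_distr smult_mult)
    moreover have "b \<odot> x \<in> N"
      using N b xa by (simp add: submodule_def submodule_axioms_def)
    ultimately show ?thesis using xa b by auto
  qed
  ultimately show ?thesis by (simp add: submodule_def submodule_axioms_def)
qed

lemma (in right_module) span_enumerated:
  assumes "finite S" "S \<subseteq> carrier M"
  shows "\<exists>e :: (nat \<Rightarrow> 'a) \<Rightarrow> 'm. module_span A M S \<subseteq> range e"
  using assms
proof (induction S rule: finite_induct)
  case empty
  have "submodule {\<zero>} A M"
  proof -
    have "\<zero> \<oplus> \<zero>\<^bsub>A\<^esub> \<odot> \<zero> = \<zero>" using smult_zero_left by simp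
    moreover have "a \<odot> \<zero> = \<zero>" if "a \<in> carrier A" for a
      using smult_mult[of "\<zero>\<^bsub>A\<^esub>" a "\<zero>"] that smult_zero_left by simp
    ultimately show ?thesis
      using M.add.triv_subgroup by (simp add: submodule_def submodule_axioms_def)
  qed
  then have "module_span A M {} \<subseteq> range (\<lambda>_. \<zero>)"
    using module_span_least by fastforce
  then show ?case by blast
next
  case (insert s S)
  then obtain e :: "(nat \<Rightarrow> 'a) \<Rightarrow> 'm" where e: "module_span A M S \<subseteq> range e" by auto
  let ?L = "{x \<oplus> a \<odot> s |x a. x \<in> module_span A M S \<and> a \<in> carrier A}"
  have span: "submodule (module_span A M S) A M" using submodule_span insert by auto
  have sub: "module_span A M S \<subseteq> carrier M"
    using span by (simp add: submodule_def subgroup_def)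
  have L: "submodule ?L A M" using submodule_add_cyclic span insert by auto
  have "insert s S \<subseteq> ?L"
  proof -
    have "\<zero> \<in> module_span A M S" using span by (simp add: submodule_def subgroup_def)
    moreover have "s = \<zero> \<oplus> \<one>\<^bsub>A\<^esub> \<odot> s" using insert smult_one by simp
    moreover have "x = x \<oplus> \<zero>\<^bsub>A\<^esub> \<odot> s" if "x \<in> S" for x
      using insert smult_zero_left that by auto
    ultimately show ?thesis using module_span_superset[of S A M] by blast
  qed
  then have *: "module_span A M (insert s S) \<subseteq> ?L" using L by (rule module_span_least[rotated])
  have "?L \<subseteq> range (\<lambda>c. e (\<lambda>n. c (Suc n)) \<oplus> c 0 \<odot> s)"
  proof
    fix y assume "y \<in> ?L"
    then obtain d a where "y = e d \<oplus> a \<odot> s" using e by blast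
    then have "y = (\<lambda>c. e (\<lambda>n. c (Suc n)) \<oplus> c 0 \<odot> s) (case_nat a d)" by simp
    then show "y \<in> range (\<lambda>c. e (\<lambda>n. c (Suc n)) \<oplus> c 0 \<odot> s)" by blast
  qed
  with * show ?case by (meson subset_trans)
qed

lemma fg_right_module_embedding:
  fixes M :: "('a, 'm) module"
  assumes "fg_right_module A M"
  shows "\<exists>e :: 'm \<Rightarrow> nat \<Rightarrow> 'a. inj_on e (carrier M)"
proof -
  interpret right_module A M using assms by (simp add: fg_right_module_def)
  obtain S where "finite S" "S \<subseteq> carrier M" "module_span A M S = carrier M"
    using assms by (auto simp: fg_right_module_def fin_gen_def)
  then obtain e :: "(nat \<Rightarrow> 'a) \<Rightarrow> 'm" where "carrier M \<subseteq> range e"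
    using span_enumerated by metis
  then have "inj_on (inv_into UNIV e) (carrier M)" by (rule inj_on_inv_into)
  then show ?thesis by blast
qed

definition transport :: "('m \<Rightarrow> 'n) \<Rightarrow> ('a, 'm) module \<Rightarrow> ('a, 'n) module" where
  "transport e M = \<lparr>carrier = e ` carrier M, mult = undefined, one = undefined, zero = e \<zero>\<^bsub>M\<^esub>,
     add = (\<lambda>x y. e (inv_into (carrier M) e x \<oplus>\<^bsub>M\<^esub> inv_into (carrier M) e y)),
     smult = (\<lambda>a x. e (a \<odot>\<^bsub>M\<^esub> inv_into (carrier M) e x))\<rparr>"

lemma fg_right_module_transport:
  assumes M: "fg_right_module A M" and e: "inj_on e (carrier M)"
  shows "fg_right_module A (transport e M)" (is "fg_right_module A ?T")
proof -
  interpret right_module A M using M by (simp add: fg_right_module_def)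
  note inv [simp] = inv_into_f_f[OF e]
  have grp: "abelian_group ?T"
  proof (rule abelian_groupI)
    fix x assume "x \<in> carrier ?T"
    then obtain u where u: "x = e u" "u \<in> carrier M" by (auto simp: transport_def)
    then have "e (\<ominus>\<^bsub>M\<^esub> u) \<in> carrier ?T" "e (\<ominus>\<^bsub>M\<^esub> u) \<oplus>\<^bsub>?T\<^esub> x = \<zero>\<^bsub>?T\<^esub>"
      by (auto simp: transport_def M.l_neg)
    then show "\<exists>y\<in>carrier ?T. y \<oplus>\<^bsub>?T\<^esub> x = \<zero>\<^bsub>?T\<^esub>" by blast
  qed (auto simp: transport_def M.a_ac)
  have T: "right_module A ?T"
    by (intro right_module.intro grp A.ring_axioms right_module_axioms.intro)
      (auto simp: transport_def smult_closed smult_l_distr smult_r_distr smult_mult smult_one)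
  obtain S where S: "finite S" "S \<subseteq> carrier M" "module_span A M S = carrier M"
    using M by (auto simp: fg_right_module_def fin_gen_def)
  interpret T: right_module A ?T by (rule T)
  have "e ` S \<subseteq> carrier ?T" using S by (auto simp: transport_def)
  then have span: "submodule (module_span A ?T (e ` S)) A ?T" by (rule T.submodule_span)
  define L where "L = {x \<in> carrier M. e x \<in> module_span A ?T (e ` S)}"
  interpret N: subgroup "module_span A ?T (e ` S)" "add_monoid ?T"
    using span by (simp add: submodule_def)
  have "subgroup L (add_monoid M)"
  proof (rule M.add.subgroupI)
    have "\<zero>\<^bsub>M\<^esub> \<in> L" using N.one_closed by (simp add: L_def transport_def)
    then show "L \<noteq> {}" by auto
  next
    fix x assume x: "x \<in> L"
    have "e (\<ominus>\<^bsub>M\<^esub> x) \<oplus>\<^bsub>?T\<^esub> e x = \<zero>\<^bsub>?T\<^esub>"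
      using x by (simp add: L_def transport_def M.l_neg)
    moreover have "e x \<in> carrier ?T" "e (\<ominus>\<^bsub>M\<^esub> x) \<in> carrier ?T"
      using x by (auto simp: L_def transport_def)
    ultimately have "e (\<ominus>\<^bsub>M\<^esub> x) = \<ominus>\<^bsub>?T\<^esub> e x" by (metis T.M.minus_equality)
    moreover have "\<ominus>\<^bsub>?T\<^esub> e x \<in> module_span A ?T (e ` S)"
      using x N.m_inv_closed by (simp add: L_def a_inv_def)
    ultimately show "\<ominus>\<^bsub>M\<^esub> x \<in> L"
      using x by (simp add: L_def)
  next
    fix x y assume xy: "x \<in> L" "y \<in> L"
    then have "e x \<oplus>\<^bsub>?T\<^esub> e y \<in> module_span A ?T (e ` S)"
      using N.m_closed by (simp add: L_def)
    then show "x \<oplus>\<^bsub>M\<^esub> y \<in> L" using xy by (simp add: L_def transport_def)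
  qed (simp add: L_def subset_eq)
  moreover have "a \<odot>\<^bsub>M\<^esub> x \<in> L" if "a \<in> carrier A" "x \<in> L" for a x
  proof -
    have "a \<odot>\<^bsub>?T\<^esub> e x \<in> module_span A ?T (e ` S)"
      using span that by (simp add: L_def submodule_def submodule_axioms_def)
    then show ?thesis using that smult_closed by (simp add: L_def transport_def)
  qed
  ultimately have "submodule L A M" by (simp add: submodule_def submodule_axioms_def)
  moreover have "S \<subseteq> L" using S module_span_superset[of "e ` S" A ?T] by (auto simp: L_def)
  ultimately have "carrier M \<subseteq> L" using S module_span_least by metis
  then have "carrier ?T \<subseteq> module_span A ?T (e ` S)" by (auto simp: L_def transport_def)
  then have "module_span A ?T (e ` S) = carrier ?T" using N.subset by auto
  with S \<open>e ` S \<subseteq> carrier ?T\<close> T show ?thesis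
    unfolding fg_right_module_def fin_gen_def by blast
qed

lemma transport_hom:
  assumes M: "right_module A M" and e: "inj_on e (carrier M)"
  shows "restrict e (carrier M) \<in> mod_hom A M (transport e M)"
    and "restrict (inv_into (carrier M) e) (e ` carrier M) \<in> mod_hom A (transport e M) M"
proof -
  interpret right_module A M by (rule M)
  show "restrict e (carrier M) \<in> mod_hom A M (transport e M)"
    "restrict (inv_into (carrier M) e) (e ` carrier M) \<in> mod_hom A (transport e M) M"
    by (auto simp: mod_hom_def transport_def inv_into_f_f[OF e] smult_closed)
qed

lemma mod_hom_compose:
  "\<lbrakk>f \<in> mod_hom A L M; g \<in> mod_hom A M N; right_module A L\<rbrakk>
    \<Longrightarrow> compose (carrier L) g f \<in> mod_hom A L N"
proof -
  assume f: "f \<in> mod_hom A L M" and g: "g \<in> mod_hom A M N" and "right_module A L"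
  then interpret L: right_module A L by simp
  have "f x \<in> carrier M" if "x \<in> carrier L" for x using f that by (auto simp: mod_hom_def)
  moreover have "g x \<in> carrier N" if "x \<in> carrier M" for x using g that by (auto simp: mod_hom_def)
  ultimately show ?thesis
    using f g L.smult_closed L.M.a_closed by (simp add: mod_hom_def compose_def)
qed

theorem projective_lift:
  fixes M :: "('a, 'm) module" and N :: "('a, 'n) module"
  assumes P: "projective_module A P" and M: "fg_right_module A M" and N: "fg_right_module A N"
    and g: "g \<in> mod_hom A M N" and surj: "g ` carrier M = carrier N" and f: "f \<in> mod_hom A P N"
  shows "\<exists>h\<in>mod_hom A P M. \<forall>x\<in>carrier P. g (h x) = f x"
proof -
  obtain u :: "'m \<Rightarrow> nat \<Rightarrow> 'a" where u: "inj_on u (carrier M)"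
    using fg_right_module_embedding[OF M] by blast
  obtain v :: "'n \<Rightarrow> nat \<Rightarrow> 'a" where v: "inj_on v (carrier N)"
    using fg_right_module_embedding[OF N] by blast
  let ?M = "transport u M" and ?N = "transport v N"
  let ?u' = "restrict (inv_into (carrier M) u) (u ` carrier M)"
  have rM: "right_module A M" and rN: "right_module A N" and rP: "right_module A P"
    using M N P by (auto simp: fg_right_module_def projective_module_def)
  have TM: "fg_right_module A ?M" and TN: "fg_right_module A ?N"
    using fg_right_module_transport M N u v by blast+
  then have rTM: "right_module A ?M" by (simp add: fg_right_module_def)
  have cM: "carrier ?M = u ` carrier M" and cN: "carrier ?N = v ` carrier N"
    by (simp_all add: transport_def)
  have gM: "g x \<in> carrier N" if "x \<in> carrier M" for x using surj that by auto
  have fP: "f x \<in> carrier N" if "x \<in> carrier P" for x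
    using f that by (auto simp: mod_hom_def)
  define g' where
    "g' = compose (carrier ?M) (restrict v (carrier N)) (compose (carrier ?M) g ?u')"
  define f' where "f' = compose (carrier P) (restrict v (carrier N)) f"
  have g': "g' \<in> mod_hom A ?M ?N"
    unfolding g'_def using transport_hom[OF rM u] transport_hom[OF rN v] g rTM
    by (blast intro: mod_hom_compose)
  have f': "f' \<in> mod_hom A P ?N"
    unfolding f'_def using transport_hom[OF rN v] f rP by (blast intro: mod_hom_compose)
  have g'_u: "g' (u x) = v (g x)" if "x \<in> carrier M" for x
    using that u gM by (simp add: g'_def compose_def cM)
  have "g' ` carrier ?M = carrier ?N"
    unfolding cM cN surj[symmetric] image_image using g'_u by (rule image_cong[OF refl])
  with P TM TN g' f' obtain h where h: "h \<in> mod_hom A P ?M"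
    and gh: "\<forall>x\<in>carrier P. g' (h x) = f' x"
    unfolding projective_module_def by blast
  define k where "k = compose (carrier P) ?u' h"
  have "k \<in> mod_hom A P M"
    unfolding k_def using h transport_hom[OF rM u] rP by (blast intro: mod_hom_compose)
  moreover have "g (k x) = f x" if x: "x \<in> carrier P" for x
  proof -
    obtain y where y: "h x = u y" "y \<in> carrier M"
      using h x cM by (force simp: mod_hom_def PiE_def Pi_def)
    then have "k x = y" using x u by (simp add: k_def compose_def)
    moreover have "v (g y) = v (f x)"
      using gh x y g'_u fP by (auto simp: f'_def compose_def)
    ultimately show ?thesis using v gM fP x y by (auto simp: inj_on_def)
  qed
  ultimately show ?thesis by blast
qed

end

theory Submission
  imports Defs
begin

text \<open>
  Let \<open>J\<close> be the radical of \<open>A\<close>. A projective cover of a simple module is generated by one element,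
  so \<open>P\<^sub>i = x A \<cong> e A\<close> and \<open>P\<^sub>j \<cong> f A\<close> for idempotents \<open>e\<close> and \<open>f\<close>, and then \<open>P\<^sub>j\<^sup>\<or> = A \<tau> \<cong> A f\<close>
  (\<open>projective_cover_generators\<close>). With \<open>m = n - 1\<close>, the \<open>n\<close>th radical layers of \<open>P\<^sub>i\<close> and of \<open>P\<^sub>j\<^sup>\<or>\<close>
  are the images of \<open>J\<^sup>m\<close> in \<open>e A / e J\<^sup>n\<close> and in \<open>A f / J\<^sup>n f\<close> (\<open>rad_layer_cyclic\<close>). They involve the
  same ideals, because the powers of the radical of \<open>A\<close> and of its opposite coincide
  (\<open>jacobson_power_opposite\<close>). All three spaces of homomorphisms turn out to be the space of linear
  functionals on the corner \<open>e J\<^sup>m f / e J\<^sup>n f\<close>, which is where the two layers meet.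

  Let \<open>s = s e\<close> be the image of \<open>x\<close> in \<open>S\<^sub>i\<close> and \<open>t = t f\<close> the corresponding generator of \<open>S\<^sub>j\<close>.

  A homomorphism \<open>g\<close> from the layer of \<open>P\<^sub>j\<^sup>\<or>\<close> to \<open>S\<^sub>i\<^sup>*\<close> is a balanced bilinear form on the product of
  \<open>S\<^sub>i\<close> and that layer. As \<open>s\<close> generates \<open>S\<^sub>i\<close>, it is determined by the functional \<open>w \<mapsto> g(w \<tau>)(s)\<close>,
  which factors through the corner, and conversely every functional \<open>\<psi>\<close> on the corner arises from
  the form \<open>(s a, w \<tau>) \<mapsto> \<psi>(a w)\<close>.

  Since \<open>\<nu> P\<^sub>j\<close> is the dual of \<open>A \<tau>\<close> and its socle series consists of the annihilators of the \<open>J\<^sup>n\<close>, the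
  socle layer consists of functionals on \<open>J\<^sup>m \<tau> / J\<^sup>n \<tau>\<close>, once functionals are extended from subspaces.
  Homomorphisms from \<open>S\<^sub>i\<close> into it are again such balanced forms, and are determined by the image of
  \<open>s\<close>.

  For a homomorphism \<open>h\<close> from the layer of \<open>P\<^sub>i\<close> to \<open>S\<^sub>j\<close>, choose a functional \<open>\<phi>\<close> on \<open>S\<^sub>j\<close> with
  \<open>\<phi>(t) = 1\<close> and \<open>\<phi>(u f) = \<phi>(u)\<close>, and send \<open>h\<close> to \<open>w \<mapsto> \<phi>(h(x w))\<close>. This is bijective because
  \<open>(u, a) \<mapsto> \<phi>(u a)\<close> is a perfect pairing of \<open>S\<^sub>j\<close> with the top \<open>A f / J f\<close> of \<open>P\<^sub>j\<^sup>\<or>\<close>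
  (\<open>top_pairing_kernel\<close>, \<open>functional_representation\<close>). The isomorphism depends on \<open>\<phi>\<close>; the endomorphism
  ring of \<open>S\<^sub>j\<close> may be any finite dimensional division algebra over \<open>F\<close>.

  The ring theory behind this is that \<open>rad V = V J\<close> and that \<open>soc V\<close> is the annihilator of \<open>J\<close> in \<open>V\<close>.
  Both follow from the semisimplicity of \<open>A / J\<close> (\<open>span_locally_simple\<close>).
\<close>

section \<open>Submodules and chain conditions\<close>

lemma (in abelian_group) diff_eq_zero_iff:
  assumes "x \<in> carrier G" "y \<in> carrier G" shows "x \<ominus> y = \<zero> \<longleftrightarrow> x = y"
proof
  assume "x \<ominus> y = \<zero>"
  then have "(x \<ominus> y) \<oplus> y = y" using assms by simp
  then show "x = y" using assms by (simp add: minus_eq a_assoc l_neg)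
qed (simp add: assms minus_eq r_neg)

lemma (in right_module) smult_zero_right:
  assumes "a \<in> carrier A" shows "a \<odot> \<zero> = \<zero>"
  using smult_mult[of "\<zero>\<^bsub>A\<^esub>" a \<zero>] assms smult_zero_left by simp

lemma (in right_module) smult_minus_right:
  assumes "a \<in> carrier A" "x \<in> carrier M" shows "a \<odot> (\<ominus> x) = \<ominus> (a \<odot> x)"
  using smult_r_distr[of a "\<ominus> x" x] assms smult_closed smult_zero_right
  by (simp add: M.l_neg M.minus_equality)

lemma (in right_module) smult_diff_left:
  assumes "a \<in> carrier A" "b \<in> carrier A" "x \<in> carrier M"
  shows "(a \<ominus>\<^bsub>A\<^esub> b) \<odot> x = a \<odot> x \<ominus> b \<odot> x"
  using assms by (simp add: A.minus_eq M.minus_eq smult_l_distr smult_minus_left)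

lemma (in right_module) smult_diff_right:
  assumes "a \<in> carrier A" "x \<in> carrier M" "y \<in> carrier M"
  shows "a \<odot> (x \<ominus> y) = a \<odot> x \<ominus> a \<odot> y"
  using assms by (simp add: M.minus_eq smult_r_distr smult_minus_right)

lemma (in right_module) submodule_iff:
  "submodule N A M \<longleftrightarrow> N \<subseteq> carrier M \<and> \<zero> \<in> N \<and> (\<forall>x\<in>N. \<forall>y\<in>N. x \<oplus> y \<in> N) \<and>
     (\<forall>a\<in>carrier A. \<forall>x\<in>N. a \<odot> x \<in> N)" (is "?L \<longleftrightarrow> ?R")
proof
  assume ?L
  then interpret N: subgroup N "add_monoid M" by (simp add: submodule_def)
  show ?R using \<open>?L\<close> N.subset N.one_closed N.m_closed
    by (auto simp: submodule_def submodule_axioms_def)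
next
  assume R: ?R
  have "\<ominus> x \<in> N" if "x \<in> N" for x
  proof -
    have "(\<ominus>\<^bsub>A\<^esub> \<one>\<^bsub>A\<^esub>) \<odot> x = \<ominus> x"
      using R that smult_one by (subst smult_minus_left) auto
    then show ?thesis using R that by (metis A.a_inv_closed A.one_closed)
  qed
  then have "subgroup N (add_monoid M)"
    using R by (intro M.add.subgroupI) auto
  with R show ?L by (simp add: submodule_def submodule_axioms_def)
qed

lemma (in right_module)
  assumes "submodule N A M"
  shows submodule_sub: "N \<subseteq> carrier M"
    and submodule_mem: "x \<in> N \<Longrightarrow> x \<in> carrier M"
    and submodule_zero: "\<zero> \<in> N"
    and submodule_add: "x \<in> N \<Longrightarrow> y \<in> N \<Longrightarrow> x \<oplus> y \<in> N"
    and submodule_smult: "a \<in> carrier A \<Longrightarrow> x \<in> N \<Longrightarrow> a \<odot> x \<in> N"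
    and submodule_minus: "x \<in> N \<Longrightarrow> \<ominus> x \<in> N"
    and submodule_diff: "x \<in> N \<Longrightarrow> y \<in> N \<Longrightarrow> x \<ominus> y \<in> N"
proof -
  note N = assms[unfolded submodule_iff]
  show minus: "x \<in> N \<Longrightarrow> \<ominus> x \<in> N" for x
    using assms by (auto simp: submodule_def a_inv_def dest: subgroup.m_inv_closed)
  show "N \<subseteq> carrier M" "x \<in> N \<Longrightarrow> x \<in> carrier M" "\<zero> \<in> N" "x \<in> N \<Longrightarrow> y \<in> N \<Longrightarrow> x \<oplus> y \<in> N"
    "a \<in> carrier A \<Longrightarrow> x \<in> N \<Longrightarrow> a \<odot> x \<in> N"
    using N by auto
  show "x \<in> N \<Longrightarrow> y \<in> N \<Longrightarrow> x \<ominus> y \<in> N" using N minus by (simp add: M.minus_eq)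
qed

lemma (in right_module) submodule_add_cancel:
  assumes "submodule N A M" "x \<in> N" "y \<in> carrier M" "x \<oplus> y \<in> N" shows "y \<in> N"
proof -
  have "y = (x \<oplus> y) \<ominus> x"
    using assms submodule_mem[OF assms(1)]
    by (simp add: M.minus_eq M.a_comm[of x y] M.a_assoc M.r_neg)
  then show ?thesis using assms submodule_diff by metis
qed

lemma (in right_module) submodule_diff_cancel:
  assumes "submodule N A M" "x \<in> N" "y \<in> carrier M" "x \<ominus> y \<in> N" shows "y \<in> N"
proof -
  have "\<ominus> y \<in> N" using submodule_add_cancel[of N x "\<ominus> y"] assms by (simp add: M.minus_eq)
  then have "\<ominus> (\<ominus> y) \<in> N" using submodule_minus assms(1) by blast
  then show ?thesis using assms by simp
qed

lemma (in right_module) submodule_triv: "submodule {\<zero>} A M"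
  by (simp add: submodule_iff smult_zero_right)

lemma (in right_module) submodule_Int:
  "submodule U A M \<Longrightarrow> submodule W A M \<Longrightarrow> submodule (U \<inter> W) A M"
  by (auto simp: submodule_iff)

lemma (in right_module) set_add_iff: "x \<in> U <+>\<^bsub>M\<^esub> W \<longleftrightarrow> (\<exists>u\<in>U. \<exists>w\<in>W. x = u \<oplus> w)"
  by (auto simp: set_add_def')

lemma (in right_module) submodule_set_add:
  assumes U: "submodule U A M" and W: "submodule W A M"
  shows "submodule (U <+>\<^bsub>M\<^esub> W) A M"
  unfolding submodule_iff
proof (intro conjI ballI subsetI)
  note mem = submodule_mem[OF U] submodule_mem[OF W]
  show "x \<in> carrier M" if "x \<in> U <+>\<^bsub>M\<^esub> W" for x using that mem by (auto simp: set_add_iff)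
  show "\<zero> \<in> U <+>\<^bsub>M\<^esub> W"
    unfolding set_add_iff using submodule_zero[OF U] submodule_zero[OF W]
    by (intro bexI[of _ \<zero>]) auto
  show "x \<oplus> y \<in> U <+>\<^bsub>M\<^esub> W" if xy: "x \<in> U <+>\<^bsub>M\<^esub> W" "y \<in> U <+>\<^bsub>M\<^esub> W" for x y
  proof -
    obtain u w u' w' where *: "u \<in> U" "w \<in> W" "x = u \<oplus> w" "u' \<in> U" "w' \<in> W" "y = u' \<oplus> w'"
      using xy unfolding set_add_iff by blast
    then have "x \<oplus> y = (u \<oplus> u') \<oplus> (w \<oplus> w')" using mem by (simp add: M.a_ac)
    with * show ?thesis
      unfolding set_add_iff using submodule_add[OF U] submodule_add[OF W] by blast
  qed
  show "a \<odot> x \<in> U <+>\<^bsub>M\<^esub> W" if a: "a \<in> carrier A" and x: "x \<in> U <+>\<^bsub>M\<^esub> W" for a x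
  proof -
    obtain u w where *: "u \<in> U" "w \<in> W" "x = u \<oplus> w" using x unfolding set_add_iff by blast
    then have "a \<odot> x = a \<odot> u \<oplus> a \<odot> w" using mem a by (simp add: smult_r_distr)
    with * a show ?thesis
      unfolding set_add_iff using submodule_smult[OF U] submodule_smult[OF W] by blast
  qed
qed

lemma (in right_module) set_add_upper:
  assumes "submodule U A M" "submodule W A M"
  shows "U \<subseteq> U <+>\<^bsub>M\<^esub> W" "W \<subseteq> U <+>\<^bsub>M\<^esub> W"
proof -
  have "u = u \<oplus> \<zero>" if "u \<in> U" for u using that submodule_mem[OF assms(1)] by simp
  moreover have "w = \<zero> \<oplus> w" if "w \<in> W" for w using that submodule_mem[OF assms(2)] by simp
  ultimately show "U \<subseteq> U <+>\<^bsub>M\<^esub> W" "W \<subseteq> U <+>\<^bsub>M\<^esub> W"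
    using submodule_zero[OF assms(1)] submodule_zero[OF assms(2)]
    by (blast intro: set_add_iff[THEN iffD2])+
qed

lemma (in right_module) submodule_cyclic:
  assumes "s \<in> carrier M" shows "submodule {a \<odot> s |a. a \<in> carrier A} A M"
proof -
  have "{a \<odot> s |a. a \<in> carrier A} = {x \<oplus> a \<odot> s |x a. x \<in> {\<zero>} \<and> a \<in> carrier A}"
    using assms smult_closed by force
  then show ?thesis using submodule_add_cyclic[OF submodule_triv assms] by simp
qed

lemma (in right_module) add_cyclic_upper:
  assumes "submodule N A M" "s \<in> carrier M"
  shows "N \<subseteq> {x \<oplus> a \<odot> s |x a. x \<in> N \<and> a \<in> carrier A}"
    and "s \<in> {x \<oplus> a \<odot> s |x a. x \<in> N \<and> a \<in> carrier A}"
proof -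
  have "x = x \<oplus> \<zero>\<^bsub>A\<^esub> \<odot> s" if "x \<in> N" for x
    using that assms submodule_mem smult_zero_left by simp
  moreover have "s = \<zero> \<oplus> \<one>\<^bsub>A\<^esub> \<odot> s" using assms smult_one by simp
  ultimately show "N \<subseteq> {x \<oplus> a \<odot> s |x a. x \<in> N \<and> a \<in> carrier A}"
    "s \<in> {x \<oplus> a \<odot> s |x a. x \<in> N \<and> a \<in> carrier A}"
    using submodule_zero[OF assms(1)] by blast+
qed

lemma (in right_module) submodule_restrict_iff:
  assumes V: "submodule V A M"
  shows "submodule U A (M\<lparr>carrier := V\<rparr>) \<longleftrightarrow> submodule U A M \<and> U \<subseteq> V"
    and "right_module A (M\<lparr>carrier := V\<rparr>)"
proof -
  note mem = submodule_mem[OF V]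
  show r: "right_module A (M\<lparr>carrier := V\<rparr>)"
  proof (intro right_module.intro right_module_axioms.intro abelian_groupI A.ring_axioms)
    fix x assume "x \<in> carrier (M\<lparr>carrier := V\<rparr>)"
    then show "\<exists>y\<in>carrier (M\<lparr>carrier := V\<rparr>). y \<oplus>\<^bsub>M\<lparr>carrier := V\<rparr>\<^esub> x = \<zero>\<^bsub>M\<lparr>carrier := V\<rparr>\<^esub>"
      using mem submodule_minus[OF V] by (auto intro!: bexI[of _ "\<ominus> x"] M.l_neg)
  qed (use mem submodule_zero[OF V] submodule_add[OF V] submodule_smult[OF V] in
    \<open>auto simp: M.a_ac smult_l_distr smult_r_distr smult_mult smult_one\<close>)
  interpret V: right_module A "M\<lparr>carrier := V\<rparr>" by (rule r)
  show "submodule U A (M\<lparr>carrier := V\<rparr>) \<longleftrightarrow> submodule U A M \<and> U \<subseteq> V"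
    using mem by (auto simp: submodule_iff V.submodule_iff)
qed

lemma (in ring) right_module_regular: "right_module R (regular R)"
  by (intro right_module.intro right_module_axioms.intro abelian_groupI ring_axioms)
    (auto simp: regular_def a_ac l_distr r_distr m_assoc dest: add.l_inv_ex)

lemma regular_simps [simp]:
  "carrier (regular A) = carrier A" "zero (regular A) = zero A" "add (regular A) = add A"
  "smult (regular A) = (\<lambda>a x. x \<otimes>\<^bsub>A\<^esub> a)"
  by (auto simp: regular_def)

lemma set_add_regular [simp]: "set_add (regular A) = set_add A"
  by (simp add: set_add_def set_mult_def fun_eq_iff)

lemma a_inv_regular [simp]: "a_inv (regular A) = a_inv A" "a_minus (regular A) = a_minus A"
  by (auto simp: a_inv_def a_minus_def m_inv_def fun_eq_iff)

lemma (in right_module) submodule_colon: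
  assumes "submodule U A M" "x \<in> carrier M"
  shows "submodule {a \<in> carrier A. a \<odot> x \<in> U} A (regular A)"
proof -
  interpret R: right_module A "regular A" by (rule A.right_module_regular)
  show ?thesis
    using submodule_zero[OF assms(1)] submodule_add[OF assms(1)] submodule_smult[OF assms(1)]
      assms(2)
    by (auto simp: R.submodule_iff smult_zero_left smult_l_distr smult_mult)
qed

text \<open>
  A strictly increasing function from the submodules to the natural numbers gives both chain
  conditions at once. For finite dimensional modules the dimension is one, but any other will do.
\<close>

definition finite_length :: "('a, 'k) ring_scheme \<Rightarrow> ('a, 'm) module \<Rightarrow> bool" where
  "finite_length A M \<longleftrightarrow> (\<exists>d :: 'm set \<Rightarrow> nat.
     \<forall>U W. submodule U A M \<and> submodule W A M \<and> U \<subset> W \<longrightarrow> d U < d W)"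

lemma finite_length_minimal:
  assumes "finite_length A M" "Q U" "\<And>U. Q U \<Longrightarrow> submodule U A M"
  obtains W where "Q W" "\<And>U. Q U \<Longrightarrow> U \<subseteq> W \<Longrightarrow> U = W"
proof -
  obtain d :: "_ \<Rightarrow> nat"
    where d: "\<And>U W. submodule U A M \<Longrightarrow> submodule W A M \<Longrightarrow> U \<subset> W \<Longrightarrow> d U < d W"
    using assms(1) unfolding finite_length_def by blast
  obtain W where "Q W" "\<And>U. Q U \<Longrightarrow> d W \<le> d U"
    using ex_has_least_nat[of Q U d] assms(2) by blast
  with d assms(3) that show thesis by (metis leD psubsetI)
qed

lemma (in right_module) finite_length_maximal:
  assumes "finite_length A M" "Q U" "\<And>U. Q U \<Longrightarrow> submodule U A M"
  obtains W where "Q W" "\<And>U. Q U \<Longrightarrow> W \<subseteq> U \<Longrightarrow> U = W"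
proof -
  obtain d :: "_ \<Rightarrow> nat"
    where d: "\<And>U W. submodule U A M \<Longrightarrow> submodule W A M \<Longrightarrow> U \<subset> W \<Longrightarrow> d U < d W"
    using assms(1) unfolding finite_length_def by blast
  have "d U \<le> d (carrier M)" if "Q U" for U
    using d[of U "carrier M"] assms(3)[OF that] submodule_carrier submodule_sub
    by (metis less_imp_le order_refl psubsetI)
  then obtain W where "Q W" "\<And>U. Q U \<Longrightarrow> d U \<le> d W"
    using ex_has_greatest_nat[of Q U d "d (carrier M)"] assms(2) by force
  with d assms(3) that show thesis by (metis leD psubsetI)
qed

lemma (in right_module) finite_length_restrict:
  assumes "finite_length A M" "submodule V A M"
  shows "finite_length A (M\<lparr>carrier := V\<rparr>)"
proof -
  obtain d :: "_ \<Rightarrow> nat"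
    where "\<And>U W. submodule U A M \<Longrightarrow> submodule W A M \<Longrightarrow> U \<subset> W \<Longrightarrow> d U < d W"
    using assms(1) unfolding finite_length_def by blast
  then show ?thesis
    unfolding finite_length_def submodule_restrict_iff(1)[OF assms(2)]
    by (intro exI[of _ d]) simp
qed

text \<open>
  A submodule of \<open>x A\<close> is determined by the right ideal of those \<open>a\<close> with \<open>x a\<close> in it.
\<close>

lemma (in right_module) finite_length_cyclic:
  assumes len: "finite_length A (regular A)" and x: "x \<in> carrier M"
    and gen: "carrier M = {a \<odot> x |a. a \<in> carrier A}"
  shows "finite_length A M"
proof -
  let ?c = "\<lambda>U. {a \<in> carrier A. a \<odot> x \<in> U}"
  have sub: "submodule (?c U) A (regular A)" if "submodule U A M" for U
    using that x by (rule submodule_colon)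
  have "?c U \<subset> ?c W" if "submodule U A M" "submodule W A M" "U \<subset> W" for U W
    using that submodule_mem[of W] gen by fastforce
  moreover obtain d :: "'a set \<Rightarrow> nat"
    where "\<And>U W. submodule U A (regular A) \<Longrightarrow> submodule W A (regular A) \<Longrightarrow> U \<subset> W \<Longrightarrow> d U < d W"
    using len unfolding finite_length_def by blast
  ultimately show ?thesis
    unfolding finite_length_def using sub by (intro exI[of _ "d \<circ> ?c"]) auto
qed

text \<open>
  Adjoining one vector \<open>s\<close> to a subspace \<open>N\<close> raises the length by at most one: a subspace of
  \<open>N + F s\<close> is determined, within any chain, by its intersection with \<open>N\<close> and by whether it
  lies in \<open>N\<close>.
\<close>

lemma (in right_module) finite_length_vector_space:
  assumes F: "field A" and fg: "fin_gen A M"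
  shows "finite_length A M"
proof -
  interpret F: field A by (rule F)
  have "\<exists>d :: _ \<Rightarrow> nat. \<forall>U W. submodule U A M \<and> submodule W A M \<and> U \<subset> W \<and> W \<subseteq> module_span A M S
      \<longrightarrow> d U < d W" if "finite S" "S \<subseteq> carrier M" for S
    using that
  proof (induction S rule: finite_induct)
    case empty
    have "module_span A M {} \<subseteq> {\<zero>}" using module_span_least[OF submodule_triv] by blast
    then have "\<not> (submodule U A M \<and> U \<subset> W \<and> W \<subseteq> module_span A M {})" for U W
      using submodule_zero[of U] by blast
    then show ?case by blast
  next
    case (insert s S)
    then obtain d :: "_ \<Rightarrow> nat" where d: "\<And>U W. submodule U A M \<Longrightarrow> submodule W A M \<Longrightarrow> U \<subset> W
      \<Longrightarrow> W \<subseteq> module_span A M S \<Longrightarrow> d U < d W" by (metis insert_subset)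
    let ?N = "module_span A M S"
    have N: "submodule ?N A M" using submodule_span insert by auto
    have s: "s \<in> carrier M" using insert by auto
    let ?L = "{x \<oplus> a \<odot> s |x a. x \<in> ?N \<and> a \<in> carrier A}"
    have span: "module_span A M (insert s S) \<subseteq> ?L"
      using submodule_add_cyclic[OF N s] add_cyclic_upper[OF N s] module_span_superset[of S A M]
      by (intro module_span_least) auto
    let ?d = "\<lambda>U. d (U \<inter> ?N) + (if U \<subseteq> ?N then 0 else 1)"
    have "?d U < ?d W" if U: "submodule U A M" and W: "submodule W A M" and UW: "U \<subset> W"
      and WL: "W \<subseteq> module_span A M (insert s S)" for U W
    proof (cases "U \<inter> ?N = W \<inter> ?N")
      case False
      then have "U \<inter> ?N \<subset> W \<inter> ?N" using UW by blast
      then have "d (U \<inter> ?N) < d (W \<inter> ?N)" using U W N by (intro d submodule_Int) auto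
      then show ?thesis using UW by auto
    next
      case True
      have "U \<subseteq> ?N"
      proof (rule ccontr)
        assume "\<not> U \<subseteq> ?N"
        then obtain u where u: "u \<in> U" "u \<notin> ?N" by blast
        then obtain x a where xa: "u = x \<oplus> a \<odot> s" "x \<in> ?N" "a \<in> carrier A"
          using UW WL span by blast
        have a0: "a \<noteq> \<zero>\<^bsub>A\<^esub>"
          using u xa s submodule_mem[OF N] smult_zero_left by auto
        have "w \<in> U" if w: "w \<in> W" for w
        proof -
          obtain y b where yb: "w = y \<oplus> b \<odot> s" "y \<in> ?N" "b \<in> carrier A"
            using w WL span by blast
          define c where "c = inv\<^bsub>A\<^esub> a \<otimes>\<^bsub>A\<^esub> b"
          have c: "c \<in> carrier A" "a \<otimes>\<^bsub>A\<^esub> c = b"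
            using xa yb a0 F.field_Units by (auto simp: c_def A.m_assoc[symmetric])
          have "c \<odot> u \<oplus> y = c \<odot> x \<oplus> w"
            using xa yb c s submodule_mem[OF N] smult_closed
            by (simp add: smult_r_distr smult_mult[symmetric] M.a_ac)
          then have "w \<ominus> c \<odot> u = y \<ominus> c \<odot> x"
            using xa yb c s submodule_mem[OF N] smult_closed
            by (simp add: smult_r_distr smult_mult[symmetric] M.minus_eq M.minus_add M.a_ac M.r_neg1 M.r_neg2)
          moreover have "y \<ominus> c \<odot> x \<in> ?N"
            using xa yb c submodule_diff[OF N] submodule_smult[OF N] by blast
          moreover have cu: "c \<odot> u \<in> U" using c u submodule_smult[OF U] by blast
          moreover have "w \<ominus> c \<odot> u \<in> W"
            using w cu UW submodule_diff[OF W] by blast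
          ultimately have "w \<ominus> c \<odot> u \<in> U" using True by auto
          then have "(w \<ominus> c \<odot> u) \<oplus> c \<odot> u \<in> U" using cu submodule_add[OF U] by blast
          moreover have "(w \<ominus> c \<odot> u) \<oplus> c \<odot> u = w"
            using submodule_mem[OF W w] submodule_mem[OF U cu]
            by (simp add: M.minus_eq M.a_assoc M.l_neg)
          ultimately show ?thesis by simp
        qed
        with UW show False by blast
      qed
      moreover from this have "\<not> W \<subseteq> ?N" using UW True by blast
      ultimately show ?thesis using True by simp
    qed
    then show ?case by (intro exI[of _ ?d]) blast
  qed
  moreover obtain S where "finite S" "S \<subseteq> carrier M" "module_span A M S = carrier M"
    using fg by (auto simp: fin_gen_def)
  ultimately obtain d :: "_ \<Rightarrow> nat" where "\<forall>U W. submodule U A M \<and> submodule W A M \<and> U \<subset> W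
      \<and> W \<subseteq> carrier M \<longrightarrow> d U < d W" by metis
  then show ?thesis unfolding finite_length_def using submodule_sub by blast
qed

section \<open>The Jacobson radical\<close>

abbreviation jacobson :: "('a, 'k) ring_scheme \<Rightarrow> 'a set" where
  "jacobson A \<equiv> rad A (regular A)"

lemma (in right_module) submodule_rad: "submodule (rad A M) A M"
proof -
  have "submodule K A M" if "maximal_submodule A M K" for K
    using that by (simp add: maximal_submodule_def)
  then have "\<zero> \<in> K" "x \<in> K \<Longrightarrow> y \<in> K \<Longrightarrow> x \<oplus> y \<in> K" "a \<in> carrier A \<Longrightarrow> x \<in> K \<Longrightarrow> a \<odot> x \<in> K"
    if "maximal_submodule A M K" for K x y a
    using that submodule_zero submodule_add submodule_smult by blast+
  then show ?thesis
    using smult_closed unfolding submodule_iff rad_def by auto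
qed

lemma (in right_module) maximal_submodule_add_cyclic:
  assumes K: "maximal_submodule A M K" and s: "s \<in> carrier M" "s \<notin> K"
  shows "{k \<oplus> a \<odot> s |k a. k \<in> K \<and> a \<in> carrier A} = carrier M" (is "?L = _")
proof -
  have sK: "submodule K A M" using K by (simp add: maximal_submodule_def)
  have "?L = K \<or> ?L = carrier M"
    using K submodule_add_cyclic[OF sK s(1)] add_cyclic_upper(1)[OF sK s(1)]
    unfolding maximal_submodule_def by blast
  moreover have "?L \<noteq> K"
  proof
    assume eq: "?L = K"
    show False using add_cyclic_upper(2)[OF sK s(1)] s(2) unfolding eq by simp
  qed
  ultimately show ?thesis by fast
qed

text \<open>
  The quotient \<open>M / K\<close> is simple, so it is generated by the image of \<open>x\<close>, and the annihilator of this
  generator is a maximal right ideal.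
\<close>

lemma (in right_module) colon_maximal:
  assumes K: "maximal_submodule A M K" and x: "x \<in> carrier M" "x \<notin> K"
  shows "maximal_submodule A (regular A) {a \<in> carrier A. a \<odot> x \<in> K}" (is "maximal_submodule _ _ ?c")
proof -
  interpret R: right_module A "regular A" by (rule A.right_module_regular)
  have sK: "submodule K A M" using K by (simp add: maximal_submodule_def)
  have "L = ?c \<or> L = carrier A" if L: "submodule L A (regular A)" "?c \<subseteq> L" for L
  proof (cases "L = ?c")
    case False
    then obtain c where c: "c \<in> L" "c \<odot> x \<notin> K" "c \<in> carrier A"
      using L R.submodule_mem[OF L(1)] by auto
    have cx: "c \<odot> x \<in> carrier M" using c x smult_closed by simp
    have "x \<in> {k \<oplus> a \<odot> (c \<odot> x) |k a. k \<in> K \<and> a \<in> carrier A}"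
      unfolding maximal_submodule_add_cyclic[OF K cx c(2)] by (rule x(1))
    then obtain k a where ka: "x = k \<oplus> a \<odot> (c \<odot> x)" "k \<in> K" "a \<in> carrier A" by blast
    have "k = (k \<oplus> a \<odot> (c \<odot> x)) \<ominus> a \<odot> (c \<odot> x)"
      using ka(2,3) c x submodule_mem[OF sK] smult_closed
      by (simp add: M.minus_eq M.a_assoc M.r_neg)
    then have "k = x \<ominus> (c \<otimes>\<^bsub>A\<^esub> a) \<odot> x"
      unfolding ka(1)[symmetric] using ka(3) c x by (simp add: smult_mult)
    also have "\<dots> = (\<one>\<^bsub>A\<^esub> \<ominus>\<^bsub>A\<^esub> c \<otimes>\<^bsub>A\<^esub> a) \<odot> x"
      using ka c x by (simp add: smult_diff_left smult_one)
    finally have "\<one>\<^bsub>A\<^esub> \<ominus>\<^bsub>A\<^esub> c \<otimes>\<^bsub>A\<^esub> a \<in> L" using ka c L(2) by auto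
    moreover have "c \<otimes>\<^bsub>A\<^esub> a \<in> L" using R.submodule_smult[OF L(1)] c ka by auto
    ultimately have "(\<one>\<^bsub>A\<^esub> \<ominus>\<^bsub>A\<^esub> c \<otimes>\<^bsub>A\<^esub> a) \<oplus>\<^bsub>A\<^esub> c \<otimes>\<^bsub>A\<^esub> a \<in> L"
      using R.submodule_add[OF L(1)] by simp
    then have "\<one>\<^bsub>A\<^esub> \<in> L" using c ka by (simp add: A.minus_eq A.a_assoc A.l_neg)
    then have "a \<in> L" if "a \<in> carrier A" for a using R.submodule_smult[OF L(1) that] that by fastforce
    then show ?thesis using R.submodule_mem[OF L(1)] by auto
  qed simp
  moreover have "\<one>\<^bsub>A\<^esub> \<in> carrier A - ?c" using x smult_one by simp
  ultimately show ?thesis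
    using submodule_colon[OF sK x(1)] unfolding maximal_submodule_def by auto
qed

lemma (in right_module) jacobson_smult_maximal:
  assumes K: "maximal_submodule A M K" and x: "x \<in> carrier M" and a: "a \<in> jacobson A"
  shows "a \<odot> x \<in> K"
proof (cases "x \<in> K")
  case True
  then show ?thesis using submodule_smult[of K a x] K a by (auto simp: maximal_submodule_def rad_def)
next
  case False
  then show ?thesis using colon_maximal[OF K x] a by (auto simp: rad_def)
qed

lemma (in right_module) jacobson_smult_rad:
  assumes "x \<in> carrier M" "a \<in> jacobson A" shows "a \<odot> x \<in> rad A M"
  using assms jacobson_smult_maximal smult_closed by (auto simp: rad_def)

lemma (in ring) jacobson_sub: "jacobson R \<subseteq> carrier R"
  by (auto simp: rad_def)

lemma (in ring)
  assumes "a \<in> jacobson R" "b \<in> carrier R"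
  shows jacobson_mult_left: "b \<otimes> a \<in> jacobson R" and jacobson_mult_right: "a \<otimes> b \<in> jacobson R"
proof -
  interpret R: right_module R "regular R" by (rule right_module_regular)
  show "b \<otimes> a \<in> jacobson R" using R.jacobson_smult_rad[of b a] assms by simp
  show "a \<otimes> b \<in> jacobson R" using R.submodule_smult[OF R.submodule_rad, of b a] assms by simp
qed

lemma (in right_module) jacobson_smult_minimal:
  assumes N: "minimal_submodule A M N" and x: "x \<in> N" and a: "a \<in> jacobson A"
  shows "a \<odot> x = \<zero>"
proof -
  have sN: "submodule N A M" using N by (simp add: minimal_submodule_def)
  interpret N: right_module A "M\<lparr>carrier := N\<rparr>" using sN by (rule submodule_restrict_iff(2))
  have "maximal_submodule A (M\<lparr>carrier := N\<rparr>) {\<zero>}"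
    using N N.submodule_triv unfolding maximal_submodule_def minimal_submodule_def
    by (auto simp: submodule_restrict_iff(1)[OF sN])
  from N.jacobson_smult_maximal[OF this, of x a] show ?thesis using x a by simp
qed

text \<open>
  The elements generating a right ideal that is zero or simple modulo the radical.
\<close>

definition locally_simple :: "('a, 'k) ring_scheme \<Rightarrow> 'a set" where
  "locally_simple A = {r \<in> carrier A. \<forall>b\<in>carrier A. r \<otimes>\<^bsub>A\<^esub> b \<notin> jacobson A \<longrightarrow>
     (\<exists>c\<in>carrier A. r \<otimes>\<^bsub>A\<^esub> b \<otimes>\<^bsub>A\<^esub> c \<ominus>\<^bsub>A\<^esub> r \<in> jacobson A)}"

text \<open>
  This is the semisimplicity of \<open>A / J\<close>. A right ideal \<open>W\<close> that is minimal among those with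
  \<open>S + W = A\<close> and \<open>J \<subseteq> W\<close> satisfies \<open>S \<inter> W \<subseteq> J\<close>: otherwise some maximal right ideal \<open>K\<close> does
  not contain \<open>S \<inter> W\<close>, and \<open>W \<inter> K\<close> would be smaller. Taking for \<open>S\<close> the span of the locally simple
  elements, a right ideal minimal over \<open>J\<close> inside \<open>W\<close> would lie in \<open>S\<close>, so \<open>W = J \<subseteq> S\<close>.
\<close>

lemma (in ring) span_locally_simple:
  assumes len: "finite_length R (regular R)"
  shows "module_span R (regular R) (locally_simple R) = carrier R"
proof -
  interpret R: right_module R "regular R" by (rule right_module_regular)
  let ?J = "jacobson R" and ?S = "module_span R (regular R) (locally_simple R)"
  have J: "submodule ?J R (regular R)" by (rule R.submodule_rad)
  have LS: "locally_simple R \<subseteq> carrier R" by (auto simp: locally_simple_def)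
  then have S: "submodule ?S R (regular R)" using R.submodule_span by simp
  have "?J \<subseteq> locally_simple R"
    unfolding locally_simple_def using jacobson_sub jacobson_mult_right by blast
  then have JS: "?J \<subseteq> ?S" using module_span_superset by (rule subset_trans)
  define Q where "Q W \<longleftrightarrow> submodule W R (regular R) \<and> ?J \<subseteq> W \<and> ?S <+>\<^bsub>R\<^esub> W = carrier R" for W
  have "?S <+>\<^bsub>R\<^esub> carrier R = carrier R"
    using R.set_add_upper(2)[OF S R.submodule_carrier]
      R.submodule_sub[OF R.submodule_set_add[OF S R.submodule_carrier]] by simp
  then have "Q (carrier R)" using R.submodule_carrier jacobson_sub by (simp add: Q_def)
  then obtain W where W: "Q W" and min: "\<And>U. Q U \<Longrightarrow> U \<subseteq> W \<Longrightarrow> U = W"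
    using finite_length_minimal[OF len, of Q "carrier R"] Q_def by metis
  have sW: "submodule W R (regular R)" and JW: "?J \<subseteq> W" and SW: "?S <+>\<^bsub>R\<^esub> W = carrier R"
    using W by (auto simp: Q_def)
  have SWJ: "?S \<inter> W \<subseteq> ?J"
  proof
    fix v assume v: "v \<in> ?S \<inter> W"
    show "v \<in> ?J"
    proof (rule ccontr)
      assume "v \<notin> ?J"
      then obtain K where K: "maximal_submodule R (regular R) K" "v \<notin> K"
        using v R.submodule_mem[OF S] by (auto simp: rad_def)
      have sK: "submodule K R (regular R)" using K by (simp add: maximal_submodule_def)
      have JK: "?J \<subseteq> K" using K by (auto simp: rad_def)
      have sI: "submodule (?S \<inter> W) R (regular R)" using R.submodule_Int S sW by blast
      have "K <+>\<^bsub>R\<^esub> (?S \<inter> W) = carrier R"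
      proof -
        have "K <+>\<^bsub>R\<^esub> (?S \<inter> W) = K \<or> K <+>\<^bsub>R\<^esub> (?S \<inter> W) = carrier R"
          using K R.submodule_set_add[OF sK sI] R.set_add_upper(1)[OF sK sI]
          by (simp add: maximal_submodule_def)
        moreover have "v \<in> K <+>\<^bsub>R\<^esub> (?S \<inter> W)"
          using R.set_add_upper(2)[OF sK sI] v by auto
        ultimately show ?thesis using K by auto
      qed
      have "carrier R \<subseteq> ?S <+>\<^bsub>R\<^esub> (W \<inter> K)"
      proof
        fix a assume "a \<in> carrier R"
        then obtain s w where sw: "s \<in> ?S" "w \<in> W" "a = s \<oplus> w"
          using R.set_add_iff[of a ?S W] unfolding set_add_regular SW by auto
        moreover have "w \<in> carrier R" using sw R.submodule_mem[OF sW] by simp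
        ultimately obtain k u where ku: "k \<in> K" "u \<in> ?S" "u \<in> W" "w = k \<oplus> u"
          using R.set_add_iff[of w K "?S \<inter> W"]
          unfolding set_add_regular \<open>K <+>\<^bsub>R\<^esub> (?S \<inter> W) = carrier R\<close> by auto
        have mem: "s \<in> carrier R" "k \<in> carrier R" "u \<in> carrier R"
          using sw ku R.submodule_mem[OF S] R.submodule_mem[OF sK] by auto
        have "k \<in> W"
          using R.submodule_add_cancel[OF sW ku(3), of k] mem ku sw by (simp add: a_comm)
        moreover have "s \<oplus> u \<in> ?S" using sw ku R.submodule_add[OF S] by simp
        moreover have "a = (s \<oplus> u) \<oplus> k" using sw ku mem by (simp add: a_ac)
        ultimately show "a \<in> ?S <+>\<^bsub>R\<^esub> (W \<inter> K)" using ku by (auto simp: set_add_def')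
      qed
      moreover have sWK: "submodule (W \<inter> K) R (regular R)" using R.submodule_Int sW sK by blast
      ultimately have "Q (W \<inter> K)"
        using JW JK R.submodule_sub[OF R.submodule_set_add[OF S sWK]] by (auto simp: Q_def)
      then have "W \<inter> K = W" using min by blast
      with v K show False by blast
    qed
  qed
  have "W \<subseteq> ?J"
  proof (rule ccontr)
    assume "\<not> W \<subseteq> ?J"
    define Q' where "Q' U \<longleftrightarrow> submodule U R (regular R) \<and> ?J \<subset> U \<and> U \<subseteq> W" for U
    have "Q' W" using \<open>\<not> W \<subseteq> ?J\<close> sW JW by (auto simp: Q'_def)
    then obtain U where U: "Q' U" and min': "\<And>V. Q' V \<Longrightarrow> V \<subseteq> U \<Longrightarrow> V = U"
      using finite_length_minimal[OF len, of Q' W] Q'_def by metis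
    have sU: "submodule U R (regular R)" using U by (simp add: Q'_def)
    obtain r where r: "r \<in> U" "r \<notin> ?J" using U by (auto simp: Q'_def)
    have rc: "r \<in> carrier R" using R.submodule_mem[OF sU] r by simp
    have "r \<in> locally_simple R"
      unfolding locally_simple_def
    proof (intro CollectI conjI ballI impI)
      show "r \<in> carrier R" by (rule rc)
      fix b assume b: "b \<in> carrier R" "r \<otimes> b \<notin> ?J"
      let ?L = "{x \<oplus> (r \<otimes> b) \<otimes> c |x c. x \<in> ?J \<and> c \<in> carrier R}"
      have rb: "r \<otimes> b \<in> carrier R" using rc b by simp
      have L: "submodule ?L R (regular R)"
        using R.submodule_add_cyclic[OF J, of "r \<otimes> b"] rb by simp
      have JL: "?J \<subseteq> ?L" and rbL: "r \<otimes> b \<in> ?L"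
        using R.add_cyclic_upper[OF J, of "r \<otimes> b"] rb by simp_all
      have LU: "?L \<subseteq> U"
      proof
        fix y assume "y \<in> ?L"
        then obtain x c where xc: "y = x \<oplus> r \<otimes> b \<otimes> c" "x \<in> ?J" "c \<in> carrier R" by blast
        have "r \<otimes> b \<in> U" using R.submodule_smult[OF sU, of b r] b r by simp
        then have "r \<otimes> b \<otimes> c \<in> U" using R.submodule_smult[OF sU, of c "r \<otimes> b"] xc by simp
        moreover have "x \<in> U" using U xc by (auto simp: Q'_def)
        ultimately show "y \<in> U" using R.submodule_add[OF sU] xc by simp
      qed
      have "?J \<noteq> ?L" using rbL b(2) by (metis (no_types, lifting))
      with JL have "?J \<subset> ?L" by (rule psubsetI)
      with U L LU have "Q' ?L" unfolding Q'_def by fast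
      then have eq: "?L = U" using LU by (rule min')
      have "r \<in> ?L" unfolding eq by (rule r)
      then obtain x c where xc: "r = x \<oplus> r \<otimes> b \<otimes> c" "x \<in> ?J" "c \<in> carrier R" by blast
      have xR: "x \<in> carrier R" using xc jacobson_sub by auto
      have "r \<otimes> b \<otimes> c \<ominus> r = r \<otimes> b \<otimes> c \<ominus> (x \<oplus> r \<otimes> b \<otimes> c)" using xc(1) by simp
      also have "\<dots> = \<ominus> x"
        using xR xc(3) rb by (simp add: minus_eq minus_add a_ac r_neg1 r_neg2 r_neg)
      finally have "r \<otimes> b \<otimes> c \<ominus> r \<in> ?J" using xc(2) R.submodule_minus[OF J] by simp
      then show "\<exists>c\<in>carrier R. r \<otimes> b \<otimes> c \<ominus> r \<in> ?J" using xc(3) by blast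
    qed
    then have "r \<in> ?S" by (rule subsetD[OF module_span_superset])
    with r U SWJ show False by (auto simp: Q'_def)
  qed
  then have "W \<subseteq> ?S" using JS by simp
  have "carrier R \<subseteq> ?S"
  proof
    fix a assume "a \<in> carrier R"
    then obtain s w where "s \<in> ?S" "w \<in> W" "a = s \<oplus> w"
      using R.set_add_iff[of a ?S W] unfolding set_add_regular SW by auto
    with \<open>W \<subseteq> ?S\<close> show "a \<in> ?S" using R.submodule_add[OF S, of s w] by auto
  qed
  then show ?thesis using R.submodule_sub[OF S] by auto
qed

text \<open>
  Membership of \<open>x\<close> in a submodule may be tested on the elements \<open>x r\<close>, which generate submodules that
  are simple or zero as soon as \<open>J\<close> acts trivially.
\<close>

lemma (in right_module) locally_simple_induct:
  assumes len: "finite_length A (regular A)" and N: "submodule N A M" and x: "x \<in> carrier M"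
    and r: "\<And>r. r \<in> locally_simple A \<Longrightarrow> r \<odot> x \<in> N"
  shows "x \<in> N"
proof -
  have "module_span A (regular A) (locally_simple A) \<subseteq> {a \<in> carrier A. a \<odot> x \<in> N}"
    using r by (intro module_span_least submodule_colon N x) (auto simp: locally_simple_def)
  then have "\<one>\<^bsub>A\<^esub> \<odot> x \<in> N" using A.span_locally_simple[OF len] by auto
  then show ?thesis using x smult_one by simp
qed

text \<open>
  An element \<open>x\<close> killed by \<open>J\<close> generates an \<open>A / J\<close>-module, which is a sum of simple modules because
  \<open>A / J\<close> is semisimple.
\<close>

lemma (in right_module) soc_eq:
  assumes len: "finite_length A (regular A)"
  shows "soc A M = {x \<in> carrier M. \<forall>a\<in>jacobson A. a \<odot> x = \<zero>}"
proof -
  let ?N = "{x \<in> carrier M. \<forall>a\<in>jacobson A. a \<odot> x = \<zero>}"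
  have J: "a \<in> carrier A" if "a \<in> jacobson A" for a using that A.jacobson_sub by auto
  have "submodule ?N A M"
    using J A.jacobson_mult_left
    by (auto simp: submodule_iff smult_zero_right smult_r_distr smult_closed smult_mult[symmetric])
  moreover have "N \<subseteq> ?N" if "minimal_submodule A M N" for N
    using that jacobson_smult_minimal submodule_mem by (auto simp: minimal_submodule_def)
  ultimately have "soc A M \<subseteq> ?N" unfolding soc_def by (intro module_span_least) auto
  moreover have "x \<in> soc A M" if x: "x \<in> ?N" for x
  proof -
    have xM: "x \<in> carrier M" and Jx: "\<And>a. a \<in> jacobson A \<Longrightarrow> a \<odot> x = \<zero>" using x by auto
    have min: "N \<subseteq> carrier M" if "minimal_submodule A M N" for N
      using that submodule_sub by (simp add: minimal_submodule_def)
    then have soc: "submodule (soc A M) A M" unfolding soc_def by (intro submodule_span) auto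
    show ?thesis
    proof (rule locally_simple_induct[OF len soc xM])
      fix r assume r: "r \<in> locally_simple A"
      then have rA: "r \<in> carrier A" by (simp add: locally_simple_def)
      let ?N = "{b \<odot> (r \<odot> x) |b. b \<in> carrier A}"
      have rx: "r \<odot> x \<in> carrier M" using rA xM smult_closed by simp
      have N: "submodule ?N A M" using rx by (rule submodule_cyclic)
      show "r \<odot> x \<in> soc A M"
      proof (cases "r \<odot> x = \<zero>")
        case True
        then show ?thesis using submodule_zero[OF soc] by simp
      next
        case False
        have mem: "r \<odot> x \<in> ?N" using rx smult_one by force
        have "L = {\<zero>} \<or> L = ?N" if L: "submodule L A M" "L \<subseteq> ?N" for L
        proof (cases "L = {\<zero>}")
          case False
          then obtain z where z: "z \<in> L" "z \<noteq> \<zero>" using submodule_zero[OF L(1)] by blast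
          then obtain b where b: "z = b \<odot> (r \<odot> x)" "b \<in> carrier A" using L by blast
          have "r \<otimes>\<^bsub>A\<^esub> b \<notin> jacobson A" using Jx[of "r \<otimes>\<^bsub>A\<^esub> b"] z(2) b rA xM by (auto simp: smult_mult)
          then obtain c where c: "c \<in> carrier A" "r \<otimes>\<^bsub>A\<^esub> b \<otimes>\<^bsub>A\<^esub> c \<ominus>\<^bsub>A\<^esub> r \<in> jacobson A"
            using r b by (auto simp: locally_simple_def)
          have "c \<odot> z \<ominus> r \<odot> x = (r \<otimes>\<^bsub>A\<^esub> b \<otimes>\<^bsub>A\<^esub> c \<ominus>\<^bsub>A\<^esub> r) \<odot> x"
            using b c rA xM smult_closed by (simp add: smult_diff_left smult_mult)
          then have "c \<odot> z \<ominus> r \<odot> x = \<zero>" using c Jx by simp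
          then have "c \<odot> z = r \<odot> x" using c rx submodule_mem[OF L(1) z(1)] smult_closed M.diff_eq_zero_iff by blast
          then have "r \<odot> x \<in> L" using submodule_smult[OF L(1) c(1) z(1)] by simp
          then have "?N \<subseteq> L" using submodule_smult[OF L(1)] by blast
          then show ?thesis using L by blast
        qed simp
        then have "minimal_submodule A M ?N"
          using N mem False unfolding minimal_submodule_def by blast
        then show ?thesis
          using mem module_span_superset[of "\<Union> {N. minimal_submodule A M N}" A M]
          unfolding soc_def by blast
      qed
    qed
  qed
  ultimately show ?thesis by blast
qed

text \<open>
  For \<open>v\<close> outside the span \<open>M J\<close>, a submodule \<open>K \<supseteq> M J\<close> maximal with \<open>v \<notin> K\<close> is a maximal
  submodule: since \<open>M / K\<close> is semisimple, every simple submodule of it contains the image of \<open>v\<close>.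
\<close>

lemma (in right_module) rad_eq:
  assumes lenA: "finite_length A (regular A)" and len: "finite_length A M"
  shows "rad A M = module_span A M {a \<odot> x |a x. a \<in> jacobson A \<and> x \<in> carrier M}" (is "_ = ?R")
proof
  let ?G = "{a \<odot> x |a x. a \<in> jacobson A \<and> x \<in> carrier M}"
  have J: "a \<in> carrier A" if "a \<in> jacobson A" for a using that A.jacobson_sub by auto
  show "?R \<subseteq> rad A M"
    using jacobson_smult_rad by (intro module_span_least submodule_rad) auto
  have R: "submodule ?R A M" using J smult_closed by (intro submodule_span) auto
  show "rad A M \<subseteq> ?R"
  proof
    fix v assume v: "v \<in> rad A M"
    show "v \<in> ?R"
    proof (rule ccontr)
      assume "v \<notin> ?R"
      define Q where "Q K \<longleftrightarrow> submodule K A M \<and> ?R \<subseteq> K \<and> v \<notin> K" for K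
      have "Q ?R" using R \<open>v \<notin> ?R\<close> by (simp add: Q_def)
      then obtain K where K: "Q K" and max: "\<And>U. Q U \<Longrightarrow> K \<subseteq> U \<Longrightarrow> U = K"
        using finite_length_maximal[OF len, of Q ?R] Q_def by metis
      have sK: "submodule K A M" and RK: "?R \<subseteq> K" and vK: "v \<notin> K" using K by (auto simp: Q_def)
      have JK: "a \<odot> x \<in> K" if "a \<in> jacobson A" "x \<in> carrier M" for a x
        using that RK module_span_superset[of ?G A M] by blast
      have "L = K \<or> L = carrier M" if L: "submodule L A M" "K \<subseteq> L" for L
      proof (cases "L = K")
        case False
        then have vL: "v \<in> L" using max[of L] L RK by (auto simp: Q_def)
        have "x \<in> L" if x: "x \<in> carrier M" for x
        proof (rule locally_simple_induct[OF lenA L(1) x])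
          fix r assume r: "r \<in> locally_simple A"
          then have rA: "r \<in> carrier A" by (simp add: locally_simple_def)
          have rx: "r \<odot> x \<in> carrier M" using rA x smult_closed by simp
          show "r \<odot> x \<in> L"
          proof (cases "r \<odot> x \<in> K")
            case False
            let ?K = "{k \<oplus> b \<odot> (r \<odot> x) |k b. k \<in> K \<and> b \<in> carrier A}"
            have "?K \<noteq> K"
            proof
              assume eq: "?K = K"
              show False using add_cyclic_upper(2)[OF sK rx] False unfolding eq by simp
            qed
            moreover have "?R \<subseteq> ?K" by (rule subset_trans[OF RK add_cyclic_upper(1)[OF sK rx]])
            ultimately have "v \<in> ?K"
              using max[OF _ add_cyclic_upper(1)[OF sK rx]] submodule_add_cyclic[OF sK rx]
              unfolding Q_def by fast
            then obtain k b where kb: "v = k \<oplus> b \<odot> (r \<odot> x)" "k \<in> K" "b \<in> carrier A" by blast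
            have kM: "k \<in> carrier M" using kb submodule_mem[OF sK] by blast
            have "b \<odot> (r \<odot> x) \<notin> K" using kb vK submodule_add[OF sK] by blast
            then have "r \<otimes>\<^bsub>A\<^esub> b \<notin> jacobson A" using JK[of "r \<otimes>\<^bsub>A\<^esub> b" x] x rA kb by (auto simp: smult_mult)
            then obtain c where c: "c \<in> carrier A" "r \<otimes>\<^bsub>A\<^esub> b \<otimes>\<^bsub>A\<^esub> c \<ominus>\<^bsub>A\<^esub> r \<in> jacobson A"
              using r kb by (auto simp: locally_simple_def)
            have "(r \<otimes>\<^bsub>A\<^esub> b \<otimes>\<^bsub>A\<^esub> c \<ominus>\<^bsub>A\<^esub> r) \<odot> x = c \<odot> (b \<odot> (r \<odot> x)) \<ominus> r \<odot> x"
              using kb c rA x smult_closed by (simp add: smult_diff_left smult_mult)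
            moreover have "(r \<otimes>\<^bsub>A\<^esub> b \<otimes>\<^bsub>A\<^esub> c \<ominus>\<^bsub>A\<^esub> r) \<odot> x \<in> L" using JK c x L by blast
            moreover have "b \<odot> (r \<odot> x) \<in> L"
              using submodule_add_cancel[OF L(1), of k "b \<odot> (r \<odot> x)"] kb L vL rx smult_closed
              by blast
            ultimately show ?thesis
              using submodule_diff_cancel[OF L(1), of "c \<odot> (b \<odot> (r \<odot> x))" "r \<odot> x"]
                submodule_smult[OF L(1) c(1)] rx by metis
          qed (use L in blast)
        qed
        then show ?thesis using submodule_sub[OF L(1)] by blast
      qed simp
      then have "maximal_submodule A M K"
        using sK vK v by (auto simp: maximal_submodule_def rad_def)
      then show False using v vK by (auto simp: rad_def)
    qed
  qed
qed

section \<open>Powers of the radical\<close>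

text \<open>
  The iterated radicals of the regular module are the powers \<open>J\<^sup>n\<close>, and this choice makes the radical
  series of a cyclic module \<open>x A\<close> equal to \<open>x J\<^sup>n\<close> step by step.
\<close>

abbreviation jacobson_power :: "('a, 'k) ring_scheme \<Rightarrow> nat \<Rightarrow> 'a set" where
  "jacobson_power A \<equiv> rad_pow A (regular A)"

lemma (in right_module) module_span_restrict:
  assumes V: "submodule V A M" and "G \<subseteq> V"
  shows "module_span A (M\<lparr>carrier := V\<rparr>) G = module_span A M G"
proof
  interpret V: right_module A "M\<lparr>carrier := V\<rparr>" using V by (rule submodule_restrict_iff(2))
  have "G \<subseteq> carrier M" using assms submodule_sub by blast
  then have "submodule (module_span A M G) A M" by (rule submodule_span)
  moreover have "module_span A M G \<subseteq> V" using assms by (rule module_span_least)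
  ultimately show "module_span A (M\<lparr>carrier := V\<rparr>) G \<subseteq> module_span A M G"
    by (intro module_span_least module_span_superset) (simp add: submodule_restrict_iff(1)[OF V])
  have "submodule (module_span A (M\<lparr>carrier := V\<rparr>) G) A (M\<lparr>carrier := V\<rparr>)"
    using assms(2) by (intro V.submodule_span) simp
  then show "module_span A M G \<subseteq> module_span A (M\<lparr>carrier := V\<rparr>) G"
    by (intro module_span_least module_span_superset) (simp add: submodule_restrict_iff(1)[OF V])
qed

lemma (in right_module) submodule_rad_pow: "submodule (rad_pow A M n) A M"
proof (induction n)
  case 0
  show ?case using submodule_carrier by simp
next
  case (Suc n)
  interpret V: right_module A "M\<lparr>carrier := rad_pow A M n\<rparr>"
    using Suc by (rule submodule_restrict_iff(2))
  show ?case using V.submodule_rad by (simp add: submodule_restrict_iff(1)[OF Suc])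
qed

lemma rad_pow_Suc_subset: "rad_pow A M (Suc n) \<subseteq> rad_pow A M n"
  by (auto simp: rad_def)

lemma (in right_module) rad_pow_Suc_eq:
  assumes lenA: "finite_length A (regular A)" and len: "finite_length A M"
  shows "rad_pow A M (Suc n) = module_span A M {a \<odot> x |a x. a \<in> jacobson A \<and> x \<in> rad_pow A M n}"
proof -
  note V = submodule_rad_pow[of n]
  interpret V: right_module A "M\<lparr>carrier := rad_pow A M n\<rparr>"
    using V by (rule submodule_restrict_iff(2))
  have "{a \<odot> x |a x. a \<in> jacobson A \<and> x \<in> rad_pow A M n} \<subseteq> rad_pow A M n"
    using submodule_smult[OF V] A.jacobson_sub by auto
  then show ?thesis
    using V.rad_eq[OF lenA finite_length_restrict[OF len V]] by (simp add: module_span_restrict[OF V])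
qed

lemma (in right_module) rad_proper:
  assumes len: "finite_length A M" and "carrier M \<noteq> {\<zero>}"
  shows "rad A M \<noteq> carrier M"
proof -
  define Q where "Q U \<longleftrightarrow> submodule U A M \<and> U \<noteq> carrier M" for U
  have "Q {\<zero>}" using assms submodule_triv by (auto simp: Q_def)
  then obtain K where K: "Q K" and max: "\<And>U. Q U \<Longrightarrow> K \<subseteq> U \<Longrightarrow> U = K"
    using finite_length_maximal[OF len, of Q "{\<zero>}"] Q_def by metis
  then have "maximal_submodule A M K" unfolding maximal_submodule_def Q_def by blast
  then have "rad A M \<subseteq> K" by (auto simp: rad_def)
  then show ?thesis using K submodule_sub by (fastforce simp: Q_def)
qed

text \<open>
  Both chain conditions are assumed, so that everything proved for right ideals can be applied to the
  opposite ring.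
\<close>

locale artinian_ring = ring A for A :: "('f, 'a) module" (structure) +
  assumes right_length: "finite_length A (regular A)"
    and left_length: "finite_length (opposite A) (regular (opposite A))"
begin

sublocale R: right_module A "regular A" by (rule right_module_regular)

lemma jacobson_power_mult_left:
  assumes "b \<in> carrier A" "a \<in> jacobson_power A n" shows "b \<otimes> a \<in> jacobson_power A n"
  using assms
proof (induction n arbitrary: a b)
  case (Suc n)
  note b = Suc.prems(1)
  have "jacobson_power A (Suc n) \<subseteq> {a \<in> carrier A. a \<odot>\<^bsub>regular A\<^esub> b \<in> jacobson_power A (Suc n)}"
  proof (subst (1) R.rad_pow_Suc_eq[OF right_length right_length], intro module_span_least subsetI)
    show "submodule {a \<in> carrier A. a \<odot>\<^bsub>regular A\<^esub> b \<in> jacobson_power A (Suc n)} A (regular A)"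
      using b by (intro R.submodule_colon R.submodule_rad_pow) simp
    fix z assume "z \<in> {c \<odot>\<^bsub>regular A\<^esub> y |c y. c \<in> jacobson A \<and> y \<in> jacobson_power A n}"
    then obtain c y where z: "z = y \<otimes> c" "c \<in> jacobson A" "y \<in> jacobson_power A n" by auto
    have c: "c \<in> carrier A" using z jacobson_sub by auto
    have y: "y \<in> carrier A" using R.submodule_mem[OF R.submodule_rad_pow z(3)] by simp
    have "c \<odot>\<^bsub>regular A\<^esub> (b \<otimes> y) \<in> jacobson_power A (Suc n)"
      unfolding R.rad_pow_Suc_eq[OF right_length right_length]
      using z(2) Suc.IH[OF b z(3)] by (intro subsetD[OF module_span_superset]) blast
    then show "z \<in> {a \<in> carrier A. a \<odot>\<^bsub>regular A\<^esub> b \<in> jacobson_power A (Suc n)}"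
      using z(1) b c y by (simp add: m_assoc)
  qed
  then show ?case using Suc.prems by auto
qed simp

lemma jacobson_power_sub: "jacobson_power A n \<subseteq> carrier A"
  using R.submodule_sub[OF R.submodule_rad_pow] by simp

lemma jacobson_power_mem: "a \<in> jacobson_power A n \<Longrightarrow> a \<in> carrier A"
  using jacobson_power_sub by auto

lemma jacobson_power_add:
  "a \<in> jacobson_power A n \<Longrightarrow> b \<in> jacobson_power A n \<Longrightarrow> a \<oplus> b \<in> jacobson_power A n"
  using R.submodule_add[OF R.submodule_rad_pow] by simp

lemma jacobson_power_mult_right:
  assumes "a \<in> jacobson_power A n" "b \<in> carrier A" shows "a \<otimes> b \<in> jacobson_power A n"
  using R.submodule_smult[OF R.submodule_rad_pow assms(2,1)] by simp

lemma jacobson_power_mult_jacobson: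
  assumes "a \<in> jacobson_power A n" "c \<in> jacobson A" shows "a \<otimes> c \<in> jacobson_power A (Suc n)"
  unfolding R.rad_pow_Suc_eq[OF right_length right_length]
  using assms by (intro subsetD[OF module_span_superset]) auto

lemma jacobson_power_Suc_least:
  assumes "submodule T A (regular A)"
    and "\<And>a c. a \<in> jacobson_power A n \<Longrightarrow> c \<in> jacobson A \<Longrightarrow> a \<otimes> c \<in> T"
  shows "jacobson_power A (Suc n) \<subseteq> T"
  unfolding R.rad_pow_Suc_eq[OF right_length right_length]
  using assms by (intro module_span_least) auto

lemma jacobson_power_1: "jacobson_power A (Suc 0) = jacobson A"
  by (simp add: regular_def)

text \<open>
  The powers are built up by multiplication with \<open>J\<close> from the right. That they also absorb \<open>J\<close> from
  the left is what makes them agree with the powers formed in the opposite ring.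
\<close>

lemma jacobson_mult_jacobson_power:
  assumes c: "c \<in> jacobson A" and a: "a \<in> jacobson_power A n"
  shows "c \<otimes> a \<in> jacobson_power A (Suc n)"
  using a
proof (induction n arbitrary: a)
  case 0
  then show ?case unfolding jacobson_power_1 using jacobson_mult_right c by simp
next
  case (Suc n)
  have cA: "c \<in> carrier A" using c jacobson_sub by auto
  have "jacobson_power A (Suc n)
    \<subseteq> {a \<in> carrier A. a \<odot>\<^bsub>regular A\<^esub> c \<in> jacobson_power A (Suc (Suc n))}"
  proof (rule jacobson_power_Suc_least)
    show "submodule {a \<in> carrier A. a \<odot>\<^bsub>regular A\<^esub> c \<in> jacobson_power A (Suc (Suc n))} A (regular A)"
      using cA by (intro R.submodule_colon R.submodule_rad_pow) simp
    fix y d assume y: "y \<in> jacobson_power A n" and d: "d \<in> jacobson A"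
    have "c \<otimes> y \<otimes> d \<in> jacobson_power A (Suc (Suc n))"
      using jacobson_power_mult_jacobson[OF Suc.IH[OF y] d] .
    moreover have "y \<in> carrier A" "d \<in> carrier A" using y d jacobson_power_sub jacobson_sub by auto
    ultimately show "y \<otimes> d \<in> {a \<in> carrier A. a \<odot>\<^bsub>regular A\<^esub> c \<in> jacobson_power A (Suc (Suc n))}"
      using cA by (simp del: rad_pow.simps add: m_assoc)
  qed
  then show ?case using Suc.prems by auto
qed

text \<open>
  The powers of the radical form a decreasing chain, which becomes stationary. As a non-zero module
  of finite length differs from its radical, the stationary value is zero.
\<close>

lemma jacobson_nilpotent: "\<exists>n. jacobson_power A n = {\<zero>}"
proof -
  define Q where "Q U \<longleftrightarrow> (\<exists>n. U = jacobson_power A n)" for U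
  have "submodule U A (regular A)" if "Q U" for U
    using that R.submodule_rad_pow by (auto simp: Q_def)
  moreover have "Q (jacobson_power A 0)" unfolding Q_def by blast
  ultimately obtain W where "Q W" and min: "\<And>U. Q U \<Longrightarrow> U \<subseteq> W \<Longrightarrow> U = W"
    using finite_length_minimal[OF right_length, of Q] by metis
  then obtain n where n: "W = jacobson_power A n" by (auto simp: Q_def)
  have sW: "submodule W A (regular A)" unfolding n by (rule R.submodule_rad_pow)
  interpret W: right_module A "regular A\<lparr>carrier := W\<rparr>"
    using sW by (rule R.submodule_restrict_iff(2))
  have "jacobson_power A (Suc n) = W"
    using rad_pow_Suc_subset unfolding n Q_def by (intro min[unfolded n Q_def]) blast+
  then have "rad A (regular A\<lparr>carrier := W\<rparr>) = carrier (regular A\<lparr>carrier := W\<rparr>)"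
    by (simp add: n)
  then have "W = {\<zero>}"
    using W.rad_proper[OF R.finite_length_restrict[OF right_length sW]] by auto
  then show ?thesis using n by blast
qed

end

lemma opposite_simps [simp]:
  "carrier (opposite A) = carrier A" "zero (opposite A) = zero A" "add (opposite A) = add A"
  "one (opposite A) = one A" "smult (opposite A) = smult A"
  "mult (opposite A) = (\<lambda>x y. y \<otimes>\<^bsub>A\<^esub> x)" "opposite (opposite A) = A"
  by (simp_all add: opposite_def)

lemma a_inv_opposite [simp]: "a_inv (opposite A) = a_inv A" "a_minus (opposite A) = a_minus A"
  by (auto simp: a_inv_def a_minus_def m_inv_def fun_eq_iff)

lemma ring_opposite:
  fixes A :: "('f, 'b) module" assumes "ring A" shows "ring (opposite A)"
proof -
  interpret A: ring A by (rule assms)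
  show ?thesis
    by (intro ringI abelian_groupI monoidI)
      (auto simp: A.a_ac A.m_assoc A.l_distr A.r_distr dest: A.add.l_inv_ex)
qed

context artinian_ring
begin

lemma artinian_opposite: "artinian_ring (opposite A)"
  using right_length left_length ring_opposite ring_axioms
  by (simp add: artinian_ring_def artinian_ring_axioms_def)

text \<open>
  If \<open>J\<close> were not contained in a maximal left ideal \<open>L\<close>, then \<open>1 = j + l\<close>, hence
  \<open>A = J\<^sup>n + L\<close> for all \<open>n\<close>, against nilpotency.
\<close>

lemma jacobson_subset_opposite: "jacobson A \<subseteq> jacobson (opposite A)"
proof -
  interpret O: artinian_ring "opposite A" by (rule artinian_opposite)
  have "jacobson A \<subseteq> L" if L: "maximal_submodule (opposite A) (regular (opposite A)) L" for L
  proof (rule ccontr)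
    assume *: "\<not> jacobson A \<subseteq> L"
    have sL: "submodule L (opposite A) (regular (opposite A))"
      using L by (simp add: maximal_submodule_def)
    have J: "submodule (jacobson A) (opposite A) (regular (opposite A))"
      using R.submodule_zero[OF R.submodule_rad] R.submodule_add[OF R.submodule_rad]
        jacobson_mult_left jacobson_sub
      by (auto simp: O.R.submodule_iff)
    let ?L = "jacobson A <+>\<^bsub>regular (opposite A)\<^esub> L"
    note upper = O.R.set_add_upper[OF J sL]
    have "?L \<noteq> L" using * upper(1) by auto
    then have eq: "?L = carrier A"
      using L upper(2) O.R.submodule_set_add[OF J sL] by (auto simp: maximal_submodule_def)
    have "\<one> \<in> ?L" unfolding eq by simp
    then obtain j l where jl: "j \<in> jacobson A" "l \<in> L" "\<one> = j \<oplus> l"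
      unfolding O.R.set_add_iff by auto
    have mem: "j \<in> carrier A" "l \<in> carrier A"
      using jl jacobson_sub O.R.submodule_mem[OF sL] by auto
    have "\<exists>k\<in>jacobson_power A n. \<exists>m\<in>L. \<one> = k \<oplus> m" for n
    proof (induction n)
      case 0
      then show ?case using O.R.submodule_zero[OF sL] by (intro bexI[of _ \<one>] bexI[of _ \<zero>]) auto
    next
      case (Suc n)
      then obtain k m where km: "k \<in> jacobson_power A n" "m \<in> L" "\<one> = k \<oplus> m" by blast
      have mem': "k \<in> carrier A" "m \<in> carrier A"
        using km jacobson_power_sub O.R.submodule_mem[OF sL] by auto
      have "k = k \<otimes> (j \<oplus> l)" unfolding jl(3)[symmetric] using mem' by simp
      then have k: "k = k \<otimes> j \<oplus> k \<otimes> l" using mem mem' by (simp add: r_distr)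
      have "\<one> = (k \<otimes> j \<oplus> k \<otimes> l) \<oplus> m" unfolding k[symmetric] by (rule km(3))
      then have "\<one> = k \<otimes> j \<oplus> (k \<otimes> l \<oplus> m)" using mem mem' by (simp add: a_assoc)
      moreover have "k \<otimes> l \<oplus> m \<in> L"
        using O.R.submodule_smult[OF sL, of k l] O.R.submodule_add[OF sL, of "k \<otimes> l" m] jl km mem'
        by simp
      moreover have "k \<otimes> j \<in> jacobson_power A (Suc n)"
        using km jl jacobson_power_mult_jacobson by blast
      ultimately show ?case by blast
    qed
    moreover obtain n where "jacobson_power A n = {\<zero>}" using jacobson_nilpotent by blast
    ultimately obtain m where "m \<in> L" "\<one> = \<zero> \<oplus> m" by (metis singletonD)
    then have "\<one> \<in> L" using O.R.submodule_mem[OF sL] by auto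
    then have "a \<in> L" if "a \<in> carrier A" for a
      using O.R.submodule_smult[OF sL, of a \<one>] that by simp
    then show False using L O.R.submodule_mem[OF sL] by (auto simp: maximal_submodule_def)
  qed
  then show ?thesis using jacobson_sub unfolding rad_def by auto
qed

lemma jacobson_opposite: "jacobson (opposite A) = jacobson A"
  using artinian_ring.jacobson_subset_opposite[OF artinian_opposite] jacobson_subset_opposite by auto

lemma jacobson_power_opposite_subset: "jacobson_power (opposite A) n \<subseteq> jacobson_power A n"
proof (induction n)
  case (Suc n)
  interpret O: artinian_ring "opposite A" by (rule artinian_opposite)
  show ?case
  proof (rule O.jacobson_power_Suc_least)
    show "submodule (jacobson_power A (Suc n)) (opposite A) (regular (opposite A))"
      using R.submodule_zero[OF R.submodule_rad_pow] R.submodule_add[OF R.submodule_rad_pow]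
        jacobson_power_mult_left jacobson_power_sub
      by (auto simp: O.R.submodule_iff simp del: rad_pow.simps)
    show "a \<otimes>\<^bsub>opposite A\<^esub> c \<in> jacobson_power A (Suc n)"
      if "a \<in> jacobson_power (opposite A) n" "c \<in> jacobson (opposite A)" for a c
      using that Suc.IH jacobson_mult_jacobson_power by (auto simp: jacobson_opposite simp del: rad_pow.simps)
  qed
qed simp

lemma jacobson_power_opposite: "jacobson_power (opposite A) n = jacobson_power A n"
  using artinian_ring.jacobson_power_opposite_subset[OF artinian_opposite, of n]
    jacobson_power_opposite_subset[of n] by auto

end

lemma (in right_module) rad_pow_cyclic:
  assumes len: "finite_length A (regular A)" and x: "x \<in> carrier M"
    and gen: "carrier M = {a \<odot> x |a. a \<in> carrier A}"
  shows "rad_pow A M n = {a \<odot> x |a. a \<in> jacobson_power A n}"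
proof (induction n)
  case 0
  then show ?case using gen by simp
next
  case (Suc n)
  interpret R: right_module A "regular A" by (rule A.right_module_regular)
  let ?I = "jacobson_power A (Suc n)"
  note I = R.submodule_rad_pow[of "Suc n"]
  have lenM: "finite_length A M" using len x gen by (rule finite_length_cyclic)
  have mem: "a \<in> carrier A" if "a \<in> jacobson_power A k" for a k
    using R.submodule_mem[OF R.submodule_rad_pow that] by simp
  have *: "submodule {a \<odot> x |a. a \<in> ?I} A M"
    unfolding submodule_iff
  proof (intro conjI ballI subsetI)
    show "y \<in> carrier M" if "y \<in> {a \<odot> x |a. a \<in> ?I}" for y
      using that mem smult_closed x by blast
    show "\<zero> \<in> {a \<odot> x |a. a \<in> ?I}"
      using smult_zero_left[OF x] R.submodule_zero[OF I] by force
    show "y \<oplus> z \<in> {a \<odot> x |a. a \<in> ?I}"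
      if yz: "y \<in> {a \<odot> x |a. a \<in> ?I}" "z \<in> {a \<odot> x |a. a \<in> ?I}" for y z
    proof -
      obtain a b where ab: "y = a \<odot> x" "z = b \<odot> x" "a \<in> ?I" "b \<in> ?I" using yz by blast
      then have "y \<oplus> z = (a \<oplus>\<^bsub>A\<^esub> b) \<odot> x" using mem x smult_l_distr by metis
      then show ?thesis using R.submodule_add[OF I ab(3,4)] by auto
    qed
    show "b \<odot> y \<in> {a \<odot> x |a. a \<in> ?I}" if b: "b \<in> carrier A" and y: "y \<in> {a \<odot> x |a. a \<in> ?I}" for b y
    proof -
      obtain a where a: "y = a \<odot> x" "a \<in> ?I" using y by blast
      then have "b \<odot> y = (a \<otimes>\<^bsub>A\<^esub> b) \<odot> x" using mem[OF a(2)] x b by (simp add: smult_mult)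
      then show ?thesis using R.submodule_smult[OF I b a(2)] by auto
    qed
  qed
  show ?case
  proof
    show "rad_pow A M (Suc n) \<subseteq> {a \<odot> x |a. a \<in> ?I}"
      unfolding rad_pow_Suc_eq[OF len lenM]
    proof (rule module_span_least[OF *], rule subsetI)
      fix y assume "y \<in> {c \<odot> z |c z. c \<in> jacobson A \<and> z \<in> rad_pow A M n}"
      then obtain c b where cb: "y = c \<odot> (b \<odot> x)" "c \<in> jacobson A" "b \<in> jacobson_power A n"
        unfolding Suc by blast
      have "b \<otimes>\<^bsub>A\<^esub> c \<in> ?I"
        unfolding R.rad_pow_Suc_eq[OF len len]
        using cb by (intro subsetD[OF module_span_superset]) auto
      moreover have "y = (b \<otimes>\<^bsub>A\<^esub> c) \<odot> x"
        using cb mem A.jacobson_sub x by (auto simp: smult_mult)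
      ultimately show "y \<in> {a \<odot> x |a. a \<in> ?I}" by blast
    qed
    have "?I \<subseteq> {a \<in> carrier A. a \<odot> x \<in> rad_pow A M (Suc n)}"
    proof (subst (1) R.rad_pow_Suc_eq[OF len len], intro module_span_least subsetI)
      show "submodule {a \<in> carrier A. a \<odot> x \<in> rad_pow A M (Suc n)} A (regular A)"
        by (intro submodule_colon submodule_rad_pow x)
      fix a assume "a \<in> {c \<odot>\<^bsub>regular A\<^esub> b |c b. c \<in> jacobson A \<and> b \<in> jacobson_power A n}"
      then obtain b c where bc: "a = b \<otimes>\<^bsub>A\<^esub> c" "c \<in> jacobson A" "b \<in> jacobson_power A n" by auto
      have bc': "b \<in> carrier A" "c \<in> carrier A" using bc mem A.jacobson_sub by auto
      have "b \<odot> x \<in> rad_pow A M n" unfolding Suc using bc by blast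
      then have "c \<odot> (b \<odot> x) \<in> rad_pow A M (Suc n)"
        unfolding rad_pow_Suc_eq[OF len lenM]
        using bc by (intro subsetD[OF module_span_superset]) blast
      then show "a \<in> {a \<in> carrier A. a \<odot> x \<in> rad_pow A M (Suc n)}"
        using bc bc' x by (simp add: smult_mult del: rad_pow.simps)
    qed
    then show "{a \<odot> x |a. a \<in> ?I} \<subseteq> rad_pow A M (Suc n)" by blast
  qed
qed

section \<open>Quotients and socle powers\<close>

lemma a_r_coset_restrict [simp]: "a_r_coset (M\<lparr>carrier := V\<rparr>) = a_r_coset M"
  by (auto simp: a_r_coset_def' fun_eq_iff)

lemma (in right_module) a_r_coset_iff: "y \<in> N +> x \<longleftrightarrow> (\<exists>k\<in>N. y = k \<oplus> x)"
  by (auto simp: a_r_coset_def')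

lemma (in right_module) coset_eq_iff:
  assumes N: "submodule N A M" and x: "x \<in> carrier M" and y: "y \<in> carrier M"
  shows "N +> x = N +> y \<longleftrightarrow> (\<exists>k\<in>N. x = k \<oplus> y)"
proof
  assume "N +> x = N +> y"
  moreover have "x \<in> N +> x"
    using submodule_zero[OF N] x by (auto simp: a_r_coset_iff intro!: bexI[of _ \<zero>])
  ultimately show "\<exists>k\<in>N. x = k \<oplus> y" by (simp add: a_r_coset_iff)
next
  assume "\<exists>k\<in>N. x = k \<oplus> y"
  then show "N +> x = N +> y"
    using N y by (intro M.a_repr_independence[symmetric]) (auto simp: a_r_coset_iff submodule_def)
qed

lemma (in right_module) coset_eq_self_iff:
  assumes N: "submodule N A M" and x: "x \<in> carrier M"
  shows "N +> x = N \<longleftrightarrow> x \<in> N"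
proof -
  have "N +> \<zero> = N" using submodule_mem[OF N] by (auto simp: a_r_coset_def')
  then have "N +> x = N \<longleftrightarrow> (\<exists>k\<in>N. x = k \<oplus> \<zero>)" using coset_eq_iff[OF N x M.zero_closed] by simp
  then show ?thesis using submodule_mem[OF N] by auto
qed

lemma quot_module_simps:
  "carrier (quot_module M N) = {N +>\<^bsub>M\<^esub> x |x. x \<in> carrier M}"
  "zero (quot_module M N) = N" "add (quot_module M N) = set_add M"
  by (auto simp: quot_module_def A_RCOSETS_def')

lemma (in right_module)
  assumes N: "submodule N A M"
  shows quot_module_add: "x \<in> carrier M \<Longrightarrow> y \<in> carrier M \<Longrightarrow>
      (N +> x) \<oplus>\<^bsub>quot_module M N\<^esub> (N +> y) = N +> (x \<oplus> y)"
    and quot_module_smult: "a \<in> carrier A \<Longrightarrow> x \<in> carrier M \<Longrightarrow>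
      a \<odot>\<^bsub>quot_module M N\<^esub> (N +> x) = N +> (a \<odot> x)"
    and right_module_quot: "right_module A (quot_module M N)"
proof -
  interpret N: abelian_subgroup N M
    using N M.abelian_group_axioms
    by (intro abelian_subgroupI3 additive_subgroup.intro) (simp_all add: submodule_def)
  show add: "(N +> x) \<oplus>\<^bsub>quot_module M N\<^esub> (N +> y) = N +> (x \<oplus> y)"
    if "x \<in> carrier M" "y \<in> carrier M" for x y
    using that N.a_rcos_sum by (simp add: quot_module_simps)
  show smult: "a \<odot>\<^bsub>quot_module M N\<^esub> (N +> x) = N +> (a \<odot> x)"
    if a: "a \<in> carrier A" and x: "x \<in> carrier M" for a x
  proof -
    have "N +> (a \<odot> y) = N +> (a \<odot> x)" if "y \<in> N +> x" for y
    proof -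
      obtain k where k: "k \<in> N" "y = k \<oplus> x" using \<open>y \<in> N +> x\<close> by (auto simp: a_r_coset_iff)
      have kM: "k \<in> carrier M" using submodule_mem[OF N k(1)] .
      have "a \<odot> y = a \<odot> k \<oplus> a \<odot> x" unfolding k(2) using kM a x by (simp add: smult_r_distr)
      moreover have "a \<odot> k \<in> N" using submodule_smult[OF N a k(1)] .
      moreover have "a \<odot> y \<in> carrier M" unfolding k(2) using kM a x smult_closed by simp
      ultimately show ?thesis using smult_closed a x by (subst coset_eq_iff[OF N]) auto
    qed
    then have *: "(\<Union>y\<in>N +> x. N +> (a \<odot> y)) = (\<Union>y\<in>N +> x. N +> (a \<odot> x))"
      by (rule SUP_cong[OF refl])
    have "x \<in> N +> x" using x by (rule N.a_rcos_self)
    then have "(\<Union>y\<in>N +> x. N +> (a \<odot> x)) = N +> (a \<odot> x)" by (intro SUP_const) blast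
    with * show ?thesis by (simp add: quot_module_def)
  qed
  have zero: "zero (quot_module M N) = N +> \<zero>"
    using coset_eq_self_iff[OF N M.zero_closed] submodule_zero[OF N] by (simp add: quot_module_simps)
  have memI: "N +> x \<in> carrier (quot_module M N)" if "x \<in> carrier M" for x
    using that by (auto simp: quot_module_simps(1))
  have memE: "\<exists>x\<in>carrier M. X = N +> x" if "X \<in> carrier (quot_module M N)" for X
    using that by (auto simp: quot_module_simps(1))
  show "right_module A (quot_module M N)"
  proof (intro right_module.intro right_module_axioms.intro abelian_groupI A.ring_axioms)
    fix X assume "X \<in> carrier (quot_module M N)"
    then obtain x where x: "X = N +> x" "x \<in> carrier M" by (auto simp: quot_module_simps)
    then have "N +> \<ominus> x \<in> carrier (quot_module M N)"
      "(N +> \<ominus> x) \<oplus>\<^bsub>quot_module M N\<^esub> X = \<zero>\<^bsub>quot_module M N\<^esub>"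
      using add by (auto simp: zero M.l_neg quot_module_simps(1))
    then show "\<exists>Y\<in>carrier (quot_module M N). Y \<oplus>\<^bsub>quot_module M N\<^esub> X = \<zero>\<^bsub>quot_module M N\<^esub>"
      by blast
  qed (auto dest!: memE simp: add smult zero memI smult_closed smult_one smult_l_distr
      smult_r_distr smult_mult M.a_ac)
qed

text \<open>
  Both layers are quotients \<open>V / N\<close> for submodules \<open>N \<subseteq> V\<close> of one module, and their elements are
  cosets in that module.
\<close>

lemma (in right_module)
  assumes V: "submodule V A M" and N: "submodule N A M" and NV: "N \<subseteq> V"
  shows section_right_module: "right_module A (quot_module (M\<lparr>carrier := V\<rparr>) N)"
    and section_carrier: "carrier (quot_module (M\<lparr>carrier := V\<rparr>) N) = {N +> x |x. x \<in> V}"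
    and section_zero: "zero (quot_module (M\<lparr>carrier := V\<rparr>) N) = N"
    and section_add: "x \<in> V \<Longrightarrow> y \<in> V \<Longrightarrow>
      (N +> x) \<oplus>\<^bsub>quot_module (M\<lparr>carrier := V\<rparr>) N\<^esub> (N +> y) = N +> (x \<oplus> y)"
    and section_smult: "a \<in> carrier A \<Longrightarrow> x \<in> V \<Longrightarrow>
      a \<odot>\<^bsub>quot_module (M\<lparr>carrier := V\<rparr>) N\<^esub> (N +> x) = N +> (a \<odot> x)"
proof -
  interpret V: right_module A "M\<lparr>carrier := V\<rparr>" using V by (rule submodule_restrict_iff(2))
  have N': "submodule N A (M\<lparr>carrier := V\<rparr>)" using N NV submodule_restrict_iff(1)[OF V] by simp
  show "right_module A (quot_module (M\<lparr>carrier := V\<rparr>) N)" using N' by (rule V.right_module_quot)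
  show "carrier (quot_module (M\<lparr>carrier := V\<rparr>) N) = {N +> x |x. x \<in> V}"
    "zero (quot_module (M\<lparr>carrier := V\<rparr>) N) = N"
    by (simp_all add: quot_module_simps)
  show "x \<in> V \<Longrightarrow> y \<in> V \<Longrightarrow>
      (N +> x) \<oplus>\<^bsub>quot_module (M\<lparr>carrier := V\<rparr>) N\<^esub> (N +> y) = N +> (x \<oplus> y)"
    using V.quot_module_add[OF N'] by simp
  show "a \<in> carrier A \<Longrightarrow> x \<in> V \<Longrightarrow>
      a \<odot>\<^bsub>quot_module (M\<lparr>carrier := V\<rparr>) N\<^esub> (N +> x) = N +> (a \<odot> x)"
    using V.quot_module_smult[OF N'] by simp
qed

text \<open>
  By induction, \<open>x\<close> lies in the next socle power iff \<open>x (J J\<^sup>n) = 0\<close>. The products of \<open>J\<close> with \<open>J\<^sup>n\<close>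
  in this order span \<open>J\<^sup>n\<^sup>+\<^sup>1\<close> as a left ideal, hence the detour through the opposite ring and the
  two-sided annihilator \<open>{c. x A c = 0}\<close>.
\<close>

lemma soc_pow_eq:
  fixes A :: "('f, 'a) module" and M :: "('a, 'm) module"
  assumes "artinian_ring A" and "right_module A M"
  shows "soc_pow A M n = {x \<in> carrier M. \<forall>a\<in>jacobson_power A n. a \<odot>\<^bsub>M\<^esub> x = \<zero>\<^bsub>M\<^esub>}"
    and "submodule (soc_pow A M n) A M"
proof -
  interpret artinian_ring A by (rule assms(1))
  interpret M: right_module A M by (rule assms(2))
  interpret O: artinian_ring "opposite A" by (rule artinian_opposite)
  have sub: "submodule {x \<in> carrier M. \<forall>a\<in>jacobson_power A n. a \<odot>\<^bsub>M\<^esub> x = \<zero>\<^bsub>M\<^esub>} A M" for n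
  proof -
    have mem: "a \<in> carrier A" if "a \<in> jacobson_power A n" for a
      using that jacobson_power_sub by auto
    have "a \<odot>\<^bsub>M\<^esub> (b \<odot>\<^bsub>M\<^esub> x) = \<zero>\<^bsub>M\<^esub>" if "a \<in> jacobson_power A n" "b \<in> carrier A" "x \<in> carrier M"
      "\<forall>a\<in>jacobson_power A n. a \<odot>\<^bsub>M\<^esub> x = \<zero>\<^bsub>M\<^esub>" for a b x
      using that M.smult_mult[of b a x] jacobson_power_mult_left[of b a n] mem by simp
    then show ?thesis
      using mem by (auto simp: M.submodule_iff M.smult_zero_right M.smult_r_distr M.smult_closed)
  qed
  show eq: "soc_pow A M n = {x \<in> carrier M. \<forall>a\<in>jacobson_power A n. a \<odot>\<^bsub>M\<^esub> x = \<zero>\<^bsub>M\<^esub>}"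
  proof (induction n)
    case 0
    have "x = \<zero>\<^bsub>M\<^esub>" if "x \<in> carrier M" "\<forall>a\<in>carrier A. a \<odot>\<^bsub>M\<^esub> x = \<zero>\<^bsub>M\<^esub>" for x
      using that(2)[rule_format, of "\<one>\<^bsub>A\<^esub>"] that(1) M.smult_one by simp
    then show ?case using M.smult_zero_right by auto
  next
    case (Suc n)
    let ?N = "soc_pow A M n"
    have N: "submodule ?N A M" unfolding Suc by (rule sub)
    interpret Q: right_module A "quot_module M ?N" using N by (rule M.right_module_quot)
    have "?N +>\<^bsub>M\<^esub> x \<in> soc A (quot_module M ?N) \<longleftrightarrow>
        (\<forall>a\<in>jacobson_power A (Suc n). a \<odot>\<^bsub>M\<^esub> x = \<zero>\<^bsub>M\<^esub>)" if x: "x \<in> carrier M" for x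
    proof -
      have "?N +>\<^bsub>M\<^esub> x \<in> carrier (quot_module M ?N)" using x by (auto simp: quot_module_simps)
      then have "?N +>\<^bsub>M\<^esub> x \<in> soc A (quot_module M ?N) \<longleftrightarrow>
          (\<forall>a\<in>jacobson A. a \<odot>\<^bsub>quot_module M ?N\<^esub> (?N +>\<^bsub>M\<^esub> x) = ?N)"
        unfolding Q.soc_eq[OF right_length] by (simp add: quot_module_simps(2))
      also have "\<dots> \<longleftrightarrow> (\<forall>a\<in>jacobson A. a \<odot>\<^bsub>M\<^esub> x \<in> ?N)"
        using jacobson_sub x M.quot_module_smult[OF N] M.coset_eq_self_iff[OF N] M.smult_closed
        by (auto simp: subset_iff)
      also have "\<dots> \<longleftrightarrow> (\<forall>a\<in>jacobson A. \<forall>b\<in>jacobson_power A n. (a \<otimes>\<^bsub>A\<^esub> b) \<odot>\<^bsub>M\<^esub> x = \<zero>\<^bsub>M\<^esub>)"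
        unfolding Suc using jacobson_sub jacobson_power_sub x M.smult_closed
        by (auto simp: subset_iff M.smult_mult)
      also have "\<dots> \<longleftrightarrow> (\<forall>c\<in>jacobson_power A (Suc n). c \<odot>\<^bsub>M\<^esub> x = \<zero>\<^bsub>M\<^esub>)"
      proof
        assume L: "\<forall>a\<in>jacobson A. \<forall>b\<in>jacobson_power A n. (a \<otimes>\<^bsub>A\<^esub> b) \<odot>\<^bsub>M\<^esub> x = \<zero>\<^bsub>M\<^esub>"
        let ?T = "{c \<in> carrier A. \<forall>b\<in>carrier A. (b \<otimes>\<^bsub>A\<^esub> c) \<odot>\<^bsub>M\<^esub> x = \<zero>\<^bsub>M\<^esub>}"
        have "jacobson_power (opposite A) (Suc n) \<subseteq> ?T"
        proof (rule O.jacobson_power_Suc_least)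
          show "submodule ?T (opposite A) (regular (opposite A))"
            using x by (auto simp: O.R.submodule_iff M.smult_zero_left r_distr M.smult_l_distr
                m_assoc[symmetric])
          show "a \<otimes>\<^bsub>opposite A\<^esub> c \<in> ?T"
            if "a \<in> jacobson_power (opposite A) n" "c \<in> jacobson (opposite A)" for a c
          proof -
            have ac: "a \<in> jacobson_power A n" "c \<in> jacobson A"
              using that by (simp_all add: jacobson_power_opposite jacobson_opposite)
            then have mem: "a \<in> carrier A" "c \<in> carrier A"
              using jacobson_power_sub jacobson_sub by auto
            have "(b \<otimes>\<^bsub>A\<^esub> (c \<otimes>\<^bsub>A\<^esub> a)) \<odot>\<^bsub>M\<^esub> x = \<zero>\<^bsub>M\<^esub>" if "b \<in> carrier A" for b
              using L ac jacobson_mult_left[OF ac(2) that] that mem by (simp add: m_assoc[symmetric])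
            then show ?thesis using mem by simp
          qed
        qed
        then have "jacobson_power A (Suc n) \<subseteq> ?T" unfolding jacobson_power_opposite .
        then have "(\<one>\<^bsub>A\<^esub> \<otimes>\<^bsub>A\<^esub> c) \<odot>\<^bsub>M\<^esub> x = \<zero>\<^bsub>M\<^esub> \<and> c \<in> carrier A" if "c \<in> jacobson_power A (Suc n)" for c
          using that by blast
        then show "\<forall>c\<in>jacobson_power A (Suc n). c \<odot>\<^bsub>M\<^esub> x = \<zero>\<^bsub>M\<^esub>" by (metis l_one)
      qed (use jacobson_mult_jacobson_power in blast)
      finally show ?thesis .
    qed
    then show ?case by (auto simp del: rad_pow.simps)
  qed
  show "submodule (soc_pow A M n) A M" unfolding eq by (rule sub)
qed

section \<open>Spaces of homomorphisms\<close>

lemma mod_homD: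
  assumes "f \<in> mod_hom A M N"
  shows "x \<in> carrier M \<Longrightarrow> f x \<in> carrier N"
    and "x \<in> carrier M \<Longrightarrow> y \<in> carrier M \<Longrightarrow> f (x \<oplus>\<^bsub>M\<^esub> y) = f x \<oplus>\<^bsub>N\<^esub> f y"
    and "a \<in> carrier A \<Longrightarrow> x \<in> carrier M \<Longrightarrow> f (a \<odot>\<^bsub>M\<^esub> x) = a \<odot>\<^bsub>N\<^esub> f x"
    and "f \<in> extensional (carrier M)"
  using assms by (auto simp: mod_hom_def PiE_def)

lemma mod_hom_zero:
  assumes "f \<in> mod_hom A M N" "right_module A M" "right_module A N"
  shows "f \<zero>\<^bsub>M\<^esub> = \<zero>\<^bsub>N\<^esub>"
proof -
  interpret M: right_module A M by (rule assms(2))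
  interpret N: right_module A N by (rule assms(3))
  have "f (\<zero>\<^bsub>A\<^esub> \<odot>\<^bsub>M\<^esub> \<zero>\<^bsub>M\<^esub>) = \<zero>\<^bsub>A\<^esub> \<odot>\<^bsub>N\<^esub> f \<zero>\<^bsub>M\<^esub>"
    using mod_homD(3)[OF assms(1)] by simp
  then show ?thesis using mod_homD(1)[OF assms(1)] by (simp add: M.smult_zero_left N.smult_zero_left)
qed

lemma mod_hom_eqI:
  assumes "f \<in> mod_hom A M N" "g \<in> mod_hom A M N" "\<And>x. x \<in> carrier M \<Longrightarrow> f x = g x"
  shows "f = g"
  using mod_homD(4)[OF assms(1)] mod_homD(4)[OF assms(2)] assms(3) by (rule extensionalityI)

lemma mod_iso_inverse:
  assumes f: "f \<in> mod_hom K U V" and bij: "bij_betw f (carrier U) (carrier V)"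
    and add: "\<And>x y. x \<in> carrier U \<Longrightarrow> y \<in> carrier U \<Longrightarrow> x \<oplus>\<^bsub>U\<^esub> y \<in> carrier U"
    and smult: "\<And>c x. c \<in> carrier K \<Longrightarrow> x \<in> carrier U \<Longrightarrow> c \<odot>\<^bsub>U\<^esub> x \<in> carrier U"
  shows "mod_iso K V U"
proof -
  let ?g = "restrict (inv_into (carrier U) f) (carrier V)"
  have g: "bij_betw ?g (carrier V) (carrier U)"
    using bij_betw_inv_into[OF bij] by (simp add: bij_betw_restrict_eq)
  have gf: "inv_into (carrier U) f (f x) = x" if "x \<in> carrier U" for x
    using bij that by (simp add: bij_betw_def)
  have surj: "\<exists>x\<in>carrier U. y = f x" if "y \<in> carrier V" for y
    using bij that unfolding bij_betw_def by blast
  note fD = mod_homD[OF f]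
  have "?g \<in> mod_hom K V U"
    unfolding mod_hom_def
  proof (intro CollectI conjI ballI)
    show "?g \<in> carrier V \<rightarrow>\<^sub>E carrier U" using g by (auto simp: bij_betw_def)
    show "?g (y \<oplus>\<^bsub>V\<^esub> y') = ?g y \<oplus>\<^bsub>U\<^esub> ?g y'" if "y \<in> carrier V" "y' \<in> carrier V" for y y'
    proof -
      obtain x x' where x: "x \<in> carrier U" "x' \<in> carrier U" "y = f x" "y' = f x'"
        using surj \<open>y \<in> carrier V\<close> \<open>y' \<in> carrier V\<close> by blast
      then have "y \<oplus>\<^bsub>V\<^esub> y' = f (x \<oplus>\<^bsub>U\<^esub> x')" using fD(2) by simp
      then show ?thesis using x add[of x x'] fD(1) that by (simp add: gf)
    qed
    show "?g (c \<odot>\<^bsub>V\<^esub> y) = c \<odot>\<^bsub>U\<^esub> ?g y" if "c \<in> carrier K" "y \<in> carrier V" for c y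
    proof -
      obtain x where x: "x \<in> carrier U" "y = f x" using surj \<open>y \<in> carrier V\<close> by blast
      then have "c \<odot>\<^bsub>V\<^esub> y = f (c \<odot>\<^bsub>U\<^esub> x)" using fD(3) that by simp
      then show ?thesis using x smult[of c x] fD(1) that by (simp add: gf)
    qed
  qed
  with g show ?thesis unfolding mod_iso_def by blast
qed

lemma mod_iso_trans:
  assumes f: "mod_iso K U V" and g: "mod_iso K V W"
    and add: "\<And>x y. x \<in> carrier U \<Longrightarrow> y \<in> carrier U \<Longrightarrow> x \<oplus>\<^bsub>U\<^esub> y \<in> carrier U"
    and smult: "\<And>c x. c \<in> carrier K \<Longrightarrow> x \<in> carrier U \<Longrightarrow> c \<odot>\<^bsub>U\<^esub> x \<in> carrier U"
  shows "mod_iso K U W"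
proof -
  obtain f g where f: "f \<in> mod_hom K U V" "bij_betw f (carrier U) (carrier V)"
    and g: "g \<in> mod_hom K V W" "bij_betw g (carrier V) (carrier W)"
    using assms unfolding mod_iso_def by blast
  have "compose (carrier U) g f \<in> mod_hom K U W"
    using f(1) g(1) add smult mod_homD(1)[OF f(1)] mod_homD(1)[OF g(1)]
    by (auto simp: mod_hom_def compose_def)
  moreover have "bij_betw (compose (carrier U) g f) (carrier U) (carrier W)"
    using bij_betw_trans[OF f(2) g(2)]
    by (simp add: bij_betw_cong[of _ "compose (carrier U) g f" "g \<circ> f"] compose_eq)
  ultimately show ?thesis unfolding mod_iso_def by blast
qed

section \<open>Linear functionals\<close>

text \<open>
  In contrast to the elements of \<^const>\<open>mod_hom\<close>, functionals may take any value outside the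
  carrier. They can therefore be restricted to a subspace without being changed.
\<close>

definition functional :: "('f, 'k) ring_scheme \<Rightarrow> ('f, 'v) module \<Rightarrow> ('v \<Rightarrow> 'f) \<Rightarrow> bool" where
  "functional F V \<phi> \<longleftrightarrow> \<phi> \<in> carrier V \<rightarrow> carrier F \<and>
     (\<forall>x\<in>carrier V. \<forall>y\<in>carrier V. \<phi> (x \<oplus>\<^bsub>V\<^esub> y) = \<phi> x \<oplus>\<^bsub>F\<^esub> \<phi> y) \<and>
     (\<forall>c\<in>carrier F. \<forall>x\<in>carrier V. \<phi> (c \<odot>\<^bsub>V\<^esub> x) = c \<otimes>\<^bsub>F\<^esub> \<phi> x)"

lemma functionalD:
  assumes "functional F V \<phi>"
  shows "x \<in> carrier V \<Longrightarrow> \<phi> x \<in> carrier F"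
    and "x \<in> carrier V \<Longrightarrow> y \<in> carrier V \<Longrightarrow> \<phi> (x \<oplus>\<^bsub>V\<^esub> y) = \<phi> x \<oplus>\<^bsub>F\<^esub> \<phi> y"
    and "c \<in> carrier F \<Longrightarrow> x \<in> carrier V \<Longrightarrow> \<phi> (c \<odot>\<^bsub>V\<^esub> x) = c \<otimes>\<^bsub>F\<^esub> \<phi> x"
  using assms by (auto simp: functional_def)

lemma (in right_module) functional_zero:
  assumes "functional A M \<phi>" shows "\<phi> \<zero> = \<zero>\<^bsub>A\<^esub>"
  using functionalD(3)[OF assms, of "\<zero>\<^bsub>A\<^esub>" \<zero>] functionalD(1)[OF assms, of \<zero>]
  by (simp add: smult_zero_left)

lemma (in right_module) functional_diff:
  assumes "functional A M \<phi>" "x \<in> carrier M" "y \<in> carrier M"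
  shows "\<phi> (x \<ominus> y) = \<phi> x \<ominus>\<^bsub>A\<^esub> \<phi> y"
proof -
  note \<phi> = functionalD[OF assms(1)]
  have "\<phi> (x \<ominus> y) \<oplus>\<^bsub>A\<^esub> \<phi> y = \<phi> ((x \<ominus> y) \<oplus> y)" using \<phi>(2) assms by simp
  also have "(x \<ominus> y) \<oplus> y = x" using assms by (simp add: M.minus_eq M.a_assoc M.l_neg)
  finally have "\<phi> x = \<phi> (x \<ominus> y) \<oplus>\<^bsub>A\<^esub> \<phi> y" ..
  then show ?thesis using \<phi>(1) assms by (simp add: A.minus_eq A.a_assoc A.r_neg)
qed

text \<open>
  The sum of \<open>W\<close> and the line spanned by \<open>s\<close> is direct, so the value at \<open>s\<close> can be prescribed.
\<close>

lemma (in right_module) functional_extend_step: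
  assumes F: "field A" and W: "submodule W A M" and \<phi>: "functional A (M\<lparr>carrier := W\<rparr>) \<phi>"
    and s: "s \<in> carrier M" "s \<notin> W" and r: "r \<in> carrier A"
  shows "\<exists>\<phi>'. functional A (M\<lparr>carrier := {x \<oplus> a \<odot> s |x a. x \<in> W \<and> a \<in> carrier A}\<rparr>) \<phi>' \<and>
    (\<forall>x\<in>W. \<phi>' x = \<phi> x) \<and> \<phi>' s = r"
proof -
  interpret F: field A by (rule F)
  let ?L = "{x \<oplus> a \<odot> s |x a. x \<in> W \<and> a \<in> carrier A}"
  note Wm = submodule_mem[OF W] and \<phi>D = functionalD[OF \<phi>, simplified]
  have uniq: "x = x' \<and> a = a'" if eq: "x \<oplus> a \<odot> s = x' \<oplus> a' \<odot> s"
    and mem: "x \<in> W" "x' \<in> W" "a \<in> carrier A" "a' \<in> carrier A" for x x' a a'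
  proof -
    have as: "a \<odot> s \<in> carrier M" "a' \<odot> s \<in> carrier M" using mem s smult_closed by auto
    have "x' \<ominus> x = ((x' \<oplus> a' \<odot> s) \<ominus> a' \<odot> s) \<ominus> x"
      using mem Wm as by (simp add: M.minus_eq M.a_assoc M.r_neg)
    also have "\<dots> = ((x \<oplus> a \<odot> s) \<ominus> a' \<odot> s) \<ominus> x" unfolding eq ..
    also have "\<dots> = (x \<ominus> x) \<oplus> (a \<odot> s \<ominus> a' \<odot> s)"
      using mem Wm as by (simp add: M.minus_eq M.a_ac)
    also have "\<dots> = (a \<ominus>\<^bsub>A\<^esub> a') \<odot> s"
      using mem Wm as s by (simp add: smult_diff_left M.minus_eq M.r_neg)
    finally have d: "x' \<ominus> x = (a \<ominus>\<^bsub>A\<^esub> a') \<odot> s" .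
    have "a = a'"
    proof (rule ccontr)
      assume "a \<noteq> a'"
      then have u: "a \<ominus>\<^bsub>A\<^esub> a' \<in> Units A"
        using mem A.diff_eq_zero_iff F.field_Units by auto
      have "(a \<ominus>\<^bsub>A\<^esub> a') \<odot> s \<in> W" unfolding d[symmetric] using mem submodule_diff[OF W] by blast
      then have "inv\<^bsub>A\<^esub> (a \<ominus>\<^bsub>A\<^esub> a') \<odot> ((a \<ominus>\<^bsub>A\<^esub> a') \<odot> s) \<in> W"
        using u submodule_smult[OF W] by auto
      moreover have "inv\<^bsub>A\<^esub> (a \<ominus>\<^bsub>A\<^esub> a') \<odot> ((a \<ominus>\<^bsub>A\<^esub> a') \<odot> s) = s"
        using u s mem by (simp add: smult_mult[symmetric] smult_one A.Units_closed)
      ultimately show False using s by simp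
    qed
    moreover have "x = x'"
      using d \<open>a = a'\<close> mem Wm s M.diff_eq_zero_iff by (simp add: A.minus_eq A.r_neg smult_zero_left)
    ultimately show ?thesis by simp
  qed
  define \<phi>' where "\<phi>' z = (THE v. \<exists>x\<in>W. \<exists>a\<in>carrier A. z = x \<oplus> a \<odot> s \<and> v = \<phi> x \<oplus>\<^bsub>A\<^esub> a \<otimes>\<^bsub>A\<^esub> r)" for z
  have \<phi>': "\<phi>' (x \<oplus> a \<odot> s) = \<phi> x \<oplus>\<^bsub>A\<^esub> a \<otimes>\<^bsub>A\<^esub> r" if "x \<in> W" "a \<in> carrier A" for x a
    unfolding \<phi>'_def using that uniq by (intro the_equality) blast+
  have "functional A (M\<lparr>carrier := ?L\<rparr>) \<phi>'"
    unfolding functional_def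
  proof (intro conjI ballI)
    show "\<phi>' \<in> carrier (M\<lparr>carrier := ?L\<rparr>) \<rightarrow> carrier A"
      using \<phi>' \<phi>D(1) r by auto
    fix y assume "y \<in> carrier (M\<lparr>carrier := ?L\<rparr>)"
    then obtain x a where xa: "y = x \<oplus> a \<odot> s" "x \<in> W" "a \<in> carrier A" by auto
    have as: "a \<odot> s \<in> carrier M" using xa s smult_closed by auto
    { fix y' assume "y' \<in> carrier (M\<lparr>carrier := ?L\<rparr>)"
      then obtain x' a' where xa': "y' = x' \<oplus> a' \<odot> s" "x' \<in> W" "a' \<in> carrier A" by auto
      have as': "a' \<odot> s \<in> carrier M" using xa' s smult_closed by auto
      have "y \<oplus> y' = (x \<oplus> x') \<oplus> (a \<oplus>\<^bsub>A\<^esub> a') \<odot> s"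
        using xa xa' as as' s Wm by (simp add: smult_l_distr M.a_ac)
      then have "\<phi>' (y \<oplus> y') = \<phi> (x \<oplus> x') \<oplus>\<^bsub>A\<^esub> (a \<oplus>\<^bsub>A\<^esub> a') \<otimes>\<^bsub>A\<^esub> r"
        using \<phi>' xa xa' submodule_add[OF W] by simp
      also have "\<dots> = \<phi>' y \<oplus>\<^bsub>A\<^esub> \<phi>' y'"
        using xa xa' \<phi>' \<phi>D(1,2) r by (simp add: A.l_distr A.a_ac)
      finally show "\<phi>' (y \<oplus>\<^bsub>M\<lparr>carrier := ?L\<rparr>\<^esub> y') = \<phi>' y \<oplus>\<^bsub>A\<^esub> \<phi>' y'" by simp }
    fix c assume c: "c \<in> carrier A"
    have "c \<odot> y = c \<odot> x \<oplus> (a \<otimes>\<^bsub>A\<^esub> c) \<odot> s"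
      using xa s c as Wm by (simp add: smult_r_distr smult_mult)
    then have "\<phi>' (c \<odot> y) = \<phi> (c \<odot> x) \<oplus>\<^bsub>A\<^esub> (a \<otimes>\<^bsub>A\<^esub> c) \<otimes>\<^bsub>A\<^esub> r"
      using \<phi>' xa c submodule_smult[OF W] by simp
    also have "\<dots> = c \<otimes>\<^bsub>A\<^esub> \<phi>' y"
      using xa \<phi>' \<phi>D(1,3) r c by (simp add: A.r_distr A.m_assoc F.m_lcomm F.m_comm[of a c])
    finally show "\<phi>' (c \<odot>\<^bsub>M\<lparr>carrier := ?L\<rparr>\<^esub> y) = c \<otimes>\<^bsub>A\<^esub> \<phi>' y" by simp
  qed
  moreover have "\<phi>' x = \<phi> x" if "x \<in> W" for x
    using \<phi>'[OF that A.zero_closed] that Wm s \<phi>D(1) r by (simp add: smult_zero_left)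
  moreover have "\<phi> \<zero> = \<zero>\<^bsub>A\<^esub>"
    using \<phi>D(3)[of "\<zero>\<^bsub>A\<^esub>" \<zero>] \<phi>D(1)[of \<zero>] submodule_zero[OF W] by (simp add: smult_zero_left)
  then have "\<phi>' s = r"
    using \<phi>'[OF submodule_zero[OF W] A.one_closed] s r by (simp add: smult_one)
  ultimately show ?thesis by blast
qed

lemma (in right_module) functional_extend:
  assumes F: "field A" and len: "finite_length A M" and W: "submodule W A M"
    and \<phi>: "functional A (M\<lparr>carrier := W\<rparr>) \<phi>"
  shows "\<exists>\<phi>'. functional A M \<phi>' \<and> (\<forall>x\<in>W. \<phi>' x = \<phi> x)"
proof -
  define Q where "Q U \<longleftrightarrow> submodule U A M \<and> W \<subseteq> U \<and>
    (\<exists>\<phi>'. functional A (M\<lparr>carrier := U\<rparr>) \<phi>' \<and> (\<forall>x\<in>W. \<phi>' x = \<phi> x))" for U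
  have "Q W" using W \<phi> by (auto simp: Q_def)
  then obtain U where U: "Q U" and max: "\<And>U'. Q U' \<Longrightarrow> U \<subseteq> U' \<Longrightarrow> U' = U"
    using finite_length_maximal[OF len, of Q W] Q_def by metis
  obtain \<phi>' where \<phi>': "functional A (M\<lparr>carrier := U\<rparr>) \<phi>'" "\<forall>x\<in>W. \<phi>' x = \<phi> x"
    and sU: "submodule U A M" and WU: "W \<subseteq> U" using U by (auto simp: Q_def)
  have "U = carrier M"
  proof (rule ccontr)
    assume "U \<noteq> carrier M"
    then obtain s where s: "s \<in> carrier M" "s \<notin> U" using submodule_sub[OF sU] by auto
    let ?L = "{x \<oplus> a \<odot> s |x a. x \<in> U \<and> a \<in> carrier A}"
    obtain \<phi>'' where \<phi>'': "functional A (M\<lparr>carrier := ?L\<rparr>) \<phi>''" "\<forall>x\<in>U. \<phi>'' x = \<phi>' x"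
      using functional_extend_step[OF F sU \<phi>'(1) s A.zero_closed] by blast
    note upper = add_cyclic_upper[OF sU s(1)]
    have "Q ?L"
      unfolding Q_def
    proof (intro conjI exI)
      show "submodule ?L A M" using sU s(1) by (rule submodule_add_cyclic)
      show "W \<subseteq> ?L" using WU upper(1) by (rule subset_trans)
      show "functional A (M\<lparr>carrier := ?L\<rparr>) \<phi>''" by (rule \<phi>''(1))
      show "\<forall>x\<in>W. \<phi>'' x = \<phi> x" using \<phi>'' \<phi>' WU by auto
    qed
    then have eq: "?L = U" using upper(1) by (rule max)
    show False using upper(2) s(2) unfolding eq by simp
  qed
  then show ?thesis using \<phi>' by auto
qed

lemma (in right_module) functional_separate:
  assumes F: "field A" and len: "finite_length A M" and W: "submodule W A M"
    and s: "s \<in> carrier M" "s \<notin> W"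
  shows "\<exists>\<phi>. functional A M \<phi> \<and> (\<forall>x\<in>W. \<phi> x = \<zero>\<^bsub>A\<^esub>) \<and> \<phi> s = \<one>\<^bsub>A\<^esub>"
proof -
  let ?L = "{x \<oplus> a \<odot> s |x a. x \<in> W \<and> a \<in> carrier A}"
  have "functional A (M\<lparr>carrier := W\<rparr>) (\<lambda>_. \<zero>\<^bsub>A\<^esub>)" by (simp add: functional_def)
  then obtain \<phi>' where \<phi>': "functional A (M\<lparr>carrier := ?L\<rparr>) \<phi>'" "\<forall>x\<in>W. \<phi>' x = \<zero>\<^bsub>A\<^esub>" "\<phi>' s = \<one>\<^bsub>A\<^esub>"
    using functional_extend_step[OF F W _ s A.one_closed] by blast
  obtain \<phi> where "functional A M \<phi>" "\<forall>x\<in>?L. \<phi> x = \<phi>' x"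
    using functional_extend[OF F len submodule_add_cyclic[OF W s(1)] \<phi>'(1)] by blast
  then show ?thesis using \<phi>' add_cyclic_upper[OF W s(1)] by (metis (no_types, lifting) subsetD)
qed

text \<open>
  The finite dimensional half of duality: a functional vanishing wherever all \<open>B v\<close> vanish is one
  of the \<open>B v\<close>. Generators of \<open>V\<close> are removed one at a time: if \<open>B s u\<^sub>0 = 1\<close> at a common zero
  \<open>u\<^sub>0\<close> of the other generators, then \<open>\<phi> - \<phi>(u\<^sub>0) B s\<close> vanishes at all such common zeros.
\<close>

lemma functional_representation:
  assumes F: "field F" and V: "right_module F V" and fg: "fin_gen F V" and U: "right_module F U"
    and B: "\<And>v. v \<in> carrier V \<Longrightarrow> functional F U (B v)"
    and B_left: "\<And>u. u \<in> carrier U \<Longrightarrow> functional F V (\<lambda>v. B v u)"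
    and \<phi>: "functional F U \<phi>"
    and zero: "\<And>u. u \<in> carrier U \<Longrightarrow> (\<And>v. v \<in> carrier V \<Longrightarrow> B v u = \<zero>\<^bsub>F\<^esub>) \<Longrightarrow> \<phi> u = \<zero>\<^bsub>F\<^esub>"
  shows "\<exists>v\<in>carrier V. \<forall>u\<in>carrier U. \<phi> u = B v u"
proof -
  interpret F: field F by (rule F)
  interpret V: right_module F V by (rule V)
  interpret U: right_module F U by (rule U)
  have "\<exists>v\<in>carrier V. \<forall>u\<in>carrier U. \<phi> u = B v u"
    if "finite S" "S \<subseteq> carrier V" "functional F U \<phi>"
      "\<forall>u\<in>carrier U. (\<forall>s\<in>S. B s u = \<zero>\<^bsub>F\<^esub>) \<longrightarrow> \<phi> u = \<zero>\<^bsub>F\<^esub>" for S \<phi>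
    using that
  proof (induction S arbitrary: \<phi> rule: finite_induct)
    case empty
    then have "\<forall>u\<in>carrier U. \<phi> u = B \<zero>\<^bsub>V\<^esub> u" using V.functional_zero[OF B_left] by simp
    then show ?case by blast
  next
    case (insert s S)
    note \<phi> = \<open>functional F U \<phi>\<close> and s = insert.prems(1)
    have sV: "s \<in> carrier V" using s by simp
    note Bs = functionalD[OF B[OF sV]] and \<phi>D = functionalD[OF \<phi>]
    show ?case
    proof (cases "\<forall>u\<in>carrier U. (\<forall>s'\<in>S. B s' u = \<zero>\<^bsub>F\<^esub>) \<longrightarrow> B s u = \<zero>\<^bsub>F\<^esub>")
      case True
      then show ?thesis using insert.IH[of \<phi>] insert.prems by simp
    next
      case False
      then obtain u1 where u1: "u1 \<in> carrier U" "\<forall>s'\<in>S. B s' u1 = \<zero>\<^bsub>F\<^esub>" "B s u1 \<noteq> \<zero>\<^bsub>F\<^esub>" by blast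
      define c where "c = inv\<^bsub>F\<^esub> (B s u1)"
      have unit: "B s u1 \<in> Units F" using u1 Bs(1) F.field_Units by auto
      then have c: "c \<in> carrier F" "c \<otimes>\<^bsub>F\<^esub> B s u1 = \<one>\<^bsub>F\<^esub>" by (auto simp: c_def)
      define u0 where "u0 = c \<odot>\<^bsub>U\<^esub> u1"
      have u0: "u0 \<in> carrier U" "B s u0 = \<one>\<^bsub>F\<^esub>"
        using u1 c Bs(3) by (auto simp: u0_def U.smult_closed)
      have u0S: "B s' u0 = \<zero>\<^bsub>F\<^esub>" if "s' \<in> S" for s'
        using functionalD(3)[OF B, of s' c u1] that s u1 c by (auto simp: u0_def)
      let ?\<phi> = "\<lambda>u. \<phi> u \<ominus>\<^bsub>F\<^esub> \<phi> u0 \<otimes>\<^bsub>F\<^esub> B s u"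
      have "functional F U ?\<phi>"
        unfolding functional_def
      proof (intro conjI ballI)
        note 0 = \<phi>D(1)[OF u0(1)]
        show "?\<phi> \<in> carrier U \<rightarrow> carrier F" using \<phi>D(1) Bs(1) 0 by simp
        show "?\<phi> (u \<oplus>\<^bsub>U\<^esub> u') = ?\<phi> u \<oplus>\<^bsub>F\<^esub> ?\<phi> u'" if "u \<in> carrier U" "u' \<in> carrier U" for u u'
          using \<phi>D(1)[of u] \<phi>D(2)[of u] \<phi>D(1)[of u'] Bs(1)[of u] Bs(2)[of u] Bs(1)[of u'] 0 that
          by (simp add: F.minus_eq F.r_distr F.minus_add F.a_ac)
        show "?\<phi> (c \<odot>\<^bsub>U\<^esub> u) = c \<otimes>\<^bsub>F\<^esub> ?\<phi> u" if "c \<in> carrier F" "u \<in> carrier U" for c u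
          using \<phi>D(3)[of c u] Bs(3)[of c u] \<phi>D(1)[of u] Bs(1)[of u] 0 that
          by (simp add: F.minus_eq F.r_distr F.r_minus F.m_lcomm)
      qed
      moreover have "?\<phi> u = \<zero>\<^bsub>F\<^esub>" if u: "u \<in> carrier U" "\<forall>s'\<in>S. B s' u = \<zero>\<^bsub>F\<^esub>" for u
      proof -
        let ?v = "u \<ominus>\<^bsub>U\<^esub> B s u \<odot>\<^bsub>U\<^esub> u0"
        have Bu: "B s u \<in> carrier F" using Bs(1) u by simp
        have v: "?v \<in> carrier U" using u u0 Bu U.smult_closed by simp
        have "B s ?v = \<zero>\<^bsub>F\<^esub>"
          using u u0 Bu U.smult_closed U.functional_diff[OF B[OF sV]] Bs(3) F.diff_eq_zero_iff by simp
        moreover have "B s' ?v = \<zero>\<^bsub>F\<^esub>" if "s' \<in> S" for s'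
        proof -
          have s': "s' \<in> carrier V" using that s by auto
          show ?thesis
            using u u0 u0S[OF that] Bu U.smult_closed U.functional_diff[OF B[OF s']]
              functionalD(3)[OF B[OF s']] that by (simp add: F.diff_eq_zero_iff)
        qed
        ultimately have "\<phi> ?v = \<zero>\<^bsub>F\<^esub>" using insert.prems(3) v by simp
        moreover have "\<phi> ?v = \<phi> u \<ominus>\<^bsub>F\<^esub> B s u \<otimes>\<^bsub>F\<^esub> \<phi> u0"
          using u u0 Bu U.smult_closed U.functional_diff[OF \<phi>] \<phi>D(3) by simp
        ultimately show ?thesis using Bu \<phi>D(1) u0 by (simp add: F.m_comm)
      qed
      ultimately obtain v where v: "v \<in> carrier V" "\<forall>u\<in>carrier U. ?\<phi> u = B v u"
        using insert.IH[of ?\<phi>] s by auto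
      have "\<phi> u = B (v \<oplus>\<^bsub>V\<^esub> \<phi> u0 \<odot>\<^bsub>V\<^esub> s) u" if u: "u \<in> carrier U" for u
      proof -
        note Bu = functionalD[OF B_left[OF u]]
        have \<phi>0: "\<phi> u0 \<in> carrier F" using \<phi>D(1) u0 by simp
        have "B (v \<oplus>\<^bsub>V\<^esub> \<phi> u0 \<odot>\<^bsub>V\<^esub> s) u = ?\<phi> u \<oplus>\<^bsub>F\<^esub> \<phi> u0 \<otimes>\<^bsub>F\<^esub> B s u"
          using v u sV \<phi>0 V.smult_closed Bu by simp
        then show ?thesis
          using \<phi>0 \<phi>D(1) Bs(1) u by (simp add: F.minus_eq F.a_assoc F.l_neg)
      qed
      then show ?thesis using v sV u0 \<phi>D(1) V.smult_closed by blast
    qed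
  qed
  moreover obtain S where S: "finite S" "S \<subseteq> carrier V" "module_span F V S = carrier V"
    using fg by (auto simp: fin_gen_def)
  moreover have "\<phi> u = \<zero>\<^bsub>F\<^esub>" if u: "u \<in> carrier U" "\<forall>s\<in>S. B s u = \<zero>\<^bsub>F\<^esub>" for u
  proof -
    note Bu = functionalD[OF B_left[OF u(1)]]
    have "submodule {v \<in> carrier V. B v u = \<zero>\<^bsub>F\<^esub>} F V"
      using V.functional_zero[OF B_left[OF u(1)]] Bu V.smult_closed by (auto simp: V.submodule_iff)
    then have "module_span F V S \<subseteq> {v \<in> carrier V. B v u = \<zero>\<^bsub>F\<^esub>}"
      using S(2) u(2) by (intro module_span_least) auto
    then have "carrier V \<subseteq> {v \<in> carrier V. B v u = \<zero>\<^bsub>F\<^esub>}" unfolding S(3) .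
    then show ?thesis using zero[OF u(1)] by blast
  qed
  ultimately show ?thesis using \<phi> by blast
qed

section \<open>Modules over a finite dimensional algebra\<close>

text \<open>
  The same algebras, with the operations of \<open>A\<close> written without index.
\<close>

locale fin_dim_algebra = fd_algebra F A
  for F :: "('f, 'k) ring_scheme" and A :: "('f, 'a) module" (structure)

lemma (in fin_dim_algebra) right_module_scalars: "right_module F A"
proof -
  have "(a \<otimes>\<^bsub>F\<^esub> b) \<odot> x = b \<odot> (a \<odot> x)"
    if "a \<in> carrier F" "b \<in> carrier F" "x \<in> carrier A" for a b x
    using that smult_assoc1[of b a x] F.m_comm[of a b] by simp
  then show ?thesis
    using F.ring_axioms A.is_abelian_group
    by (intro right_module.intro right_module_axioms.intro) (auto simp: smult_l_distr smult_r_distr)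
qed

lemma (in fin_dim_algebra) fin_dim_algebra_opposite: "fin_dim_algebra F (opposite A)"
proof -
  have O: "ring (opposite A)" using ring_opposite A.ring_axioms by blast
  have "abelian_group (opposite A)" using O by (rule ring.is_abelian_group)
  moreover have "fin_gen F (opposite A)"
  proof -
    have "submodule N F (opposite A) \<longleftrightarrow> submodule N F A" for N
      by (simp add: submodule_def submodule_axioms_def subgroup_def m_inv_def)
    then show ?thesis using fin_dim by (simp add: fin_gen_def module_span_def)
  qed
  ultimately show ?thesis
    using O F.field_axioms module_axioms smult_mult_left smult_mult_right
    by (intro fin_dim_algebra.intro fd_algebra.intro fd_algebra_axioms.intro)
      (auto simp: module_def module_axioms_def)
qed

context fin_dim_algebra
begin

sublocale V: right_module F A by (rule right_module_scalars)

lemma scalar_one: "c \<in> carrier F \<Longrightarrow> c \<odot> \<one> \<in> carrier A"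
  by (rule V.smult_closed) simp_all

lemma scalar_one_mult:
  assumes "c \<in> carrier F" "a \<in> carrier A"
  shows "(c \<odot> \<one>) \<otimes> a = c \<odot> a" "a \<otimes> (c \<odot> \<one>) = c \<odot> a"
  using assms smult_mult_left[of c "\<one>" a] smult_mult_right[of c a "\<one>"] by simp_all

lemma finite_length_scalars: "finite_length F A"
  by (rule V.finite_length_vector_space[OF F.field_axioms fin_dim])

lemma right_ideal_subspace:
  assumes "submodule U A (regular A)" shows "submodule U F A"
proof -
  interpret R: right_module A "regular A" by (rule A.right_module_regular)
  have "c \<odot> u \<in> U" if "c \<in> carrier F" "u \<in> U" for c u
    using R.submodule_smult[OF assms, of "c \<odot> \<one>" u] R.submodule_mem[OF assms, of u] that
    by (simp add: scalar_one scalar_one_mult)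
  then show ?thesis
    using R.submodule_sub[OF assms] R.submodule_zero[OF assms] R.submodule_add[OF assms]
    by (auto simp: V.submodule_iff)
qed

lemma finite_length_regular: "finite_length A (regular A)"
proof -
  obtain d :: "_ \<Rightarrow> nat"
    where "\<And>U W. submodule U F A \<Longrightarrow> submodule W F A \<Longrightarrow> U \<subset> W \<Longrightarrow> d U < d W"
    using finite_length_scalars unfolding finite_length_def by blast
  then show ?thesis
    unfolding finite_length_def using right_ideal_subspace by (intro exI[of _ d]) simp
qed

lemma artinian: "artinian_ring A"
  using finite_length_regular fin_dim_algebra.finite_length_regular[OF fin_dim_algebra_opposite]
  by (intro artinian_ring.intro artinian_ring_axioms.intro A.ring_axioms)

end

sublocale fin_dim_algebra \<subseteq> J: artinian_ring A by (rule artinian)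

lemma restrict_scalars_simps [simp]:
  "carrier (restrict_scalars A M) = carrier M" "zero (restrict_scalars A M) = zero M"
  "add (restrict_scalars A M) = add M"
  "smult (restrict_scalars A M) = (\<lambda>c x. (c \<odot>\<^bsub>A\<^esub> \<one>\<^bsub>A\<^esub>) \<odot>\<^bsub>M\<^esub> x)"
  by (simp_all add: restrict_scalars_def)

lemma (in fin_dim_algebra) right_module_restrict_scalars:
  assumes "right_module A M" shows "right_module F (restrict_scalars A M)"
proof -
  interpret M: right_module A M by (rule assms)
  have "(c \<otimes>\<^bsub>F\<^esub> d) \<odot> \<one> = (c \<odot> \<one>) \<otimes> (d \<odot> \<one>)"
    if "c \<in> carrier F" "d \<in> carrier F" for c d
    using that scalar_one by (simp add: scalar_one_mult(1) smult_assoc1)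
  moreover have "abelian_group (restrict_scalars A M)"
    by (rule abelian_groupI) (auto simp: M.M.a_ac dest: M.M.add.l_inv_ex)
  ultimately show ?thesis
    using F.ring_axioms
    by (intro right_module.intro right_module_axioms.intro)
      (auto simp: scalar_one M.smult_closed M.smult_l_distr M.smult_r_distr M.smult_mult M.smult_one
        V.smult_l_distr V.smult_one)
qed

lemma hom_module_simps [simp]:
  "carrier (hom_module A M N act) = mod_hom A M N"
  "zero (hom_module A M N act) = (\<lambda>x\<in>carrier M. \<zero>\<^bsub>N\<^esub>)"
  "add (hom_module A M N act) = (\<lambda>f g. \<lambda>x\<in>carrier M. f x \<oplus>\<^bsub>N\<^esub> g x)"
  "smult (hom_module A M N act) = act"
  by (simp_all add: hom_module_def)

lemma abelian_group_hom_module: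
  assumes "right_module A M" and "right_module A N"
  shows "abelian_group (hom_module A M N act)"
proof -
  interpret M: right_module A M by (rule assms(1))
  interpret N: right_module A N by (rule assms(2))
  show ?thesis
  proof (rule abelian_groupI)
    fix f g h
    assume f: "f \<in> carrier (hom_module A M N act)" and g: "g \<in> carrier (hom_module A M N act)"
      and h: "h \<in> carrier (hom_module A M N act)"
    note fD = mod_homD[OF f[simplified]] and gD = mod_homD[OF g[simplified]]
      and hD = mod_homD[OF h[simplified]]
    show "f \<oplus>\<^bsub>hom_module A M N act\<^esub> g \<in> carrier (hom_module A M N act)"
      using fD(1,2,3) gD(1,2,3)
      by (auto simp: mod_hom_def M.smult_closed N.smult_r_distr N.M.a_ac)
    show "f \<oplus>\<^bsub>hom_module A M N act\<^esub> g = g \<oplus>\<^bsub>hom_module A M N act\<^esub> f"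
      using fD(1) gD(1) by (auto simp: fun_eq_iff N.M.a_comm)
    show "f \<oplus>\<^bsub>hom_module A M N act\<^esub> g \<oplus>\<^bsub>hom_module A M N act\<^esub> h
        = f \<oplus>\<^bsub>hom_module A M N act\<^esub> (g \<oplus>\<^bsub>hom_module A M N act\<^esub> h)"
      using fD(1) gD(1) hD(1) by (auto simp: fun_eq_iff N.M.a_assoc)
    show "\<zero>\<^bsub>hom_module A M N act\<^esub> \<oplus>\<^bsub>hom_module A M N act\<^esub> f = f"
      using fD(1,4) by (auto simp: fun_eq_iff extensional_def)
    have "(\<lambda>x\<in>carrier M. \<ominus>\<^bsub>N\<^esub> f x) \<in> mod_hom A M N"
      using fD(1,2,3) by (auto simp: mod_hom_def M.smult_closed N.smult_minus_right N.M.minus_add N.M.a_comm)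
    moreover have "(\<lambda>x\<in>carrier M. \<ominus>\<^bsub>N\<^esub> f x) \<oplus>\<^bsub>hom_module A M N act\<^esub> f = \<zero>\<^bsub>hom_module A M N act\<^esub>"
      using fD(1) by (auto simp: fun_eq_iff N.M.l_neg)
    ultimately show "\<exists>g\<in>carrier (hom_module A M N act).
        g \<oplus>\<^bsub>hom_module A M N act\<^esub> f = \<zero>\<^bsub>hom_module A M N act\<^esub>"
      unfolding hom_module_simps(1) by blast
  next
    show "\<zero>\<^bsub>hom_module A M N act\<^esub> \<in> carrier (hom_module A M N act)"
      by (auto simp: mod_hom_def M.smult_closed N.smult_zero_right)
  qed
qed

context fin_dim_algebra
begin

lemma hom_space_closed:
  assumes "right_module A M" and "right_module A N"
  shows "f \<in> carrier (hom_space A M N) \<Longrightarrow> g \<in> carrier (hom_space A M N) \<Longrightarrow>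
      f \<oplus>\<^bsub>hom_space A M N\<^esub> g \<in> carrier (hom_space A M N)"
    and "c \<in> carrier F \<Longrightarrow> f \<in> carrier (hom_space A M N) \<Longrightarrow>
      c \<odot>\<^bsub>hom_space A M N\<^esub> f \<in> carrier (hom_space A M N)"
proof -
  interpret M: right_module A M by (rule assms(1))
  interpret N: right_module A N by (rule assms(2))
  show "f \<oplus>\<^bsub>hom_space A M N\<^esub> g \<in> carrier (hom_space A M N)"
    if "f \<in> carrier (hom_space A M N)" "g \<in> carrier (hom_space A M N)"
    using that unfolding hom_space_def
    by (rule abelian_monoid.a_closed[OF abelian_group.axioms(1)[OF abelian_group_hom_module[OF assms]]])
  show "c \<odot>\<^bsub>hom_space A M N\<^esub> f \<in> carrier (hom_space A M N)"
    if c: "c \<in> carrier F" and f: "f \<in> carrier (hom_space A M N)"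
  proof -
    have "f \<in> mod_hom A M N" using f by (simp add: hom_space_def)
    note fD = mod_homD[OF this]
    have "(c \<odot> \<one>) \<odot>\<^bsub>N\<^esub> (a \<odot>\<^bsub>N\<^esub> y) = a \<odot>\<^bsub>N\<^esub> ((c \<odot> \<one>) \<odot>\<^bsub>N\<^esub> y)"
      if "a \<in> carrier A" "y \<in> carrier N" for a y
      using that c by (simp add: N.smult_mult[symmetric] scalar_one scalar_one_mult)
    then show ?thesis
      using fD(1,2,3) c scalar_one[OF c]
      by (auto simp: hom_space_def mod_hom_def M.smult_closed N.smult_closed N.smult_r_distr)
  qed
qed

lemma right_module_A_dual:
  assumes "right_module A M" shows "right_module (opposite A) (A_dual A M)"
proof -
  interpret M: right_module A M by (rule assms)
  have "ring (opposite A)" using ring_opposite A.ring_axioms by blast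
  moreover have "abelian_group (A_dual A M)"
    unfolding A_dual_def using assms A.right_module_regular by (rule abelian_group_hom_module)
  ultimately show ?thesis
  proof (intro right_module.intro right_module_axioms.intro)
    fix a b f g
    assume a: "a \<in> carrier (opposite A)" and b: "b \<in> carrier (opposite A)"
      and f: "f \<in> carrier (A_dual A M)" and g: "g \<in> carrier (A_dual A M)"
    have "f \<in> mod_hom A M (regular A)" "g \<in> mod_hom A M (regular A)"
      using f g by (simp_all add: A_dual_def)
    note fD = mod_homD[OF this(1), simplified] and gD = mod_homD[OF this(2), simplified]
    show "a \<odot>\<^bsub>A_dual A M\<^esub> f \<in> carrier (A_dual A M)"
      using fD a by (auto simp: A_dual_def mod_hom_def M.smult_closed A.r_distr A.m_assoc)
    show "(a \<oplus>\<^bsub>opposite A\<^esub> b) \<odot>\<^bsub>A_dual A M\<^esub> f = a \<odot>\<^bsub>A_dual A M\<^esub> f \<oplus>\<^bsub>A_dual A M\<^esub> b \<odot>\<^bsub>A_dual A M\<^esub> f"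
      using fD(1) a b by (auto simp: A_dual_def fun_eq_iff A.l_distr)
    show "a \<odot>\<^bsub>A_dual A M\<^esub> (f \<oplus>\<^bsub>A_dual A M\<^esub> g) = a \<odot>\<^bsub>A_dual A M\<^esub> f \<oplus>\<^bsub>A_dual A M\<^esub> a \<odot>\<^bsub>A_dual A M\<^esub> g"
      using fD(1) gD(1) a by (auto simp: A_dual_def fun_eq_iff A.r_distr)
    show "(a \<otimes>\<^bsub>opposite A\<^esub> b) \<odot>\<^bsub>A_dual A M\<^esub> f = b \<odot>\<^bsub>A_dual A M\<^esub> (a \<odot>\<^bsub>A_dual A M\<^esub> f)"
      using fD(1) a b by (auto simp: A_dual_def fun_eq_iff A.m_assoc)
  next
    fix f assume "f \<in> carrier (A_dual A M)"
    then have "f \<in> mod_hom A M (regular A)" by (simp add: A_dual_def)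
    note fD = mod_homD[OF this, simplified]
    show "\<one>\<^bsub>opposite A\<^esub> \<odot>\<^bsub>A_dual A M\<^esub> f = f"
      using fD(1,4) by (auto simp: A_dual_def fun_eq_iff extensional_def)
  qed
qed

lemma right_module_F_dual:
  assumes "right_module A M" shows "right_module (opposite A) (F_dual F A M)"
proof -
  interpret M: right_module A M by (rule assms)
  have "ring (opposite A)" using ring_opposite A.ring_axioms by blast
  moreover have "abelian_group (F_dual F A M)"
    unfolding F_dual_def using right_module_restrict_scalars[OF assms] F.right_module_regular
    by (rule abelian_group_hom_module)
  ultimately show ?thesis
  proof (intro right_module.intro right_module_axioms.intro)
    fix a b f g
    assume a: "a \<in> carrier (opposite A)" and b: "b \<in> carrier (opposite A)"
      and f: "f \<in> carrier (F_dual F A M)" and g: "g \<in> carrier (F_dual F A M)"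
    have "f \<in> mod_hom F (restrict_scalars A M) (regular F)"
      "g \<in> mod_hom F (restrict_scalars A M) (regular F)"
      using f g by (simp_all add: F_dual_def)
    note fD = mod_homD[OF this(1), simplified] and gD = mod_homD[OF this(2), simplified]
    have "a \<odot>\<^bsub>M\<^esub> ((c \<odot> \<one>) \<odot>\<^bsub>M\<^esub> y) = (c \<odot> \<one>) \<odot>\<^bsub>M\<^esub> (a \<odot>\<^bsub>M\<^esub> y)"
      if "c \<in> carrier F" "y \<in> carrier M" for c y
      using that a by (simp add: M.smult_mult[symmetric] scalar_one scalar_one_mult)
    then show "a \<odot>\<^bsub>F_dual F A M\<^esub> f \<in> carrier (F_dual F A M)"
      using fD a by (auto simp: F_dual_def mod_hom_def M.smult_closed M.smult_r_distr scalar_one)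
    show "(a \<oplus>\<^bsub>opposite A\<^esub> b) \<odot>\<^bsub>F_dual F A M\<^esub> f = a \<odot>\<^bsub>F_dual F A M\<^esub> f \<oplus>\<^bsub>F_dual F A M\<^esub> b \<odot>\<^bsub>F_dual F A M\<^esub> f"
      using fD(1,2) a b by (auto simp: F_dual_def fun_eq_iff M.smult_l_distr M.smult_closed)
    show "a \<odot>\<^bsub>F_dual F A M\<^esub> (f \<oplus>\<^bsub>F_dual F A M\<^esub> g) = a \<odot>\<^bsub>F_dual F A M\<^esub> f \<oplus>\<^bsub>F_dual F A M\<^esub> a \<odot>\<^bsub>F_dual F A M\<^esub> g"
      using fD(1) gD(1) a by (auto simp: F_dual_def fun_eq_iff M.smult_closed)
    show "(a \<otimes>\<^bsub>opposite A\<^esub> b) \<odot>\<^bsub>F_dual F A M\<^esub> f = b \<odot>\<^bsub>F_dual F A M\<^esub> (a \<odot>\<^bsub>F_dual F A M\<^esub> f)"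
      using fD(1) a b by (auto simp: F_dual_def fun_eq_iff M.smult_mult M.smult_closed)
  next
    fix f assume "f \<in> carrier (F_dual F A M)"
    then have "f \<in> mod_hom F (restrict_scalars A M) (regular F)" by (simp add: F_dual_def)
    note fD = mod_homD[OF this, simplified]
    show "\<one>\<^bsub>opposite A\<^esub> \<odot>\<^bsub>F_dual F A M\<^esub> f = f"
      using fD(1,4) by (auto simp: F_dual_def fun_eq_iff extensional_def M.smult_one)
  qed
qed

end

text \<open>
  A map on \<open>I\<close> that is compatible with the fibres of a surjection \<open>\<kappa> : I \<rightarrow> L\<close> induces a map on \<open>L\<close>. The
  operations \<open>sm\<close> and \<open>act\<close> of \<open>I\<close> are parameters because \<open>I\<close> will be an ideal of \<open>A\<close>, on which scalars
  act from the left, from the right, or through the field.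
\<close>

lemma mod_hom_descend:
  assumes L: "carrier L = \<kappa> ` I"
    and add: "\<And>w w'. w \<in> I \<Longrightarrow> w' \<in> I \<Longrightarrow> sm w w' \<in> I \<and> \<kappa> (sm w w') = \<kappa> w \<oplus>\<^bsub>L\<^esub> \<kappa> w'"
    and act: "\<And>a w. a \<in> carrier A \<Longrightarrow> w \<in> I \<Longrightarrow> act a w \<in> I \<and> \<kappa> (act a w) = a \<odot>\<^bsub>L\<^esub> \<kappa> w"
    and g: "\<And>w. w \<in> I \<Longrightarrow> g w \<in> carrier N"
    and g_add: "\<And>w w'. w \<in> I \<Longrightarrow> w' \<in> I \<Longrightarrow> g (sm w w') = g w \<oplus>\<^bsub>N\<^esub> g w'"
    and g_act: "\<And>a w. a \<in> carrier A \<Longrightarrow> w \<in> I \<Longrightarrow> g (act a w) = a \<odot>\<^bsub>N\<^esub> g w"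
    and wd: "\<And>w w'. w \<in> I \<Longrightarrow> w' \<in> I \<Longrightarrow> \<kappa> w = \<kappa> w' \<Longrightarrow> g w = g w'"
  shows "\<exists>h\<in>mod_hom A L N. \<forall>w\<in>I. h (\<kappa> w) = g w"
proof -
  define h where "h = (\<lambda>X\<in>carrier L. g (SOME w. w \<in> I \<and> \<kappa> w = X))"
  have h: "h (\<kappa> w) = g w" if w: "w \<in> I" for w
  proof -
    have "(SOME v. v \<in> I \<and> \<kappa> v = \<kappa> w) \<in> I \<and> \<kappa> (SOME v. v \<in> I \<and> \<kappa> v = \<kappa> w) = \<kappa> w"
      by (rule someI[of "\<lambda>v. v \<in> I \<and> \<kappa> v = \<kappa> w" w]) (simp add: w)
    then have "g (SOME v. v \<in> I \<and> \<kappa> v = \<kappa> w) = g w" using wd w by blast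
    moreover have "\<kappa> w \<in> carrier L" unfolding L using w by (rule imageI)
    ultimately show ?thesis by (simp only: h_def restrict_apply' if_True)
  qed
  have "h \<in> mod_hom A L N"
    unfolding mod_hom_def
  proof (intro CollectI conjI ballI)
    show "h \<in> carrier L \<rightarrow>\<^sub>E carrier N"
    proof (rule PiE_I)
      show "h X \<in> carrier N" if "X \<in> carrier L" for X using that h g by (auto simp: L)
      show "h X = undefined" if "X \<notin> carrier L" for X using that by (simp add: h_def)
    qed
    show "h (X \<oplus>\<^bsub>L\<^esub> Y) = h X \<oplus>\<^bsub>N\<^esub> h Y" if XY: "X \<in> carrier L" "Y \<in> carrier L" for X Y
    proof -
      obtain w w' where w: "w \<in> I" "w' \<in> I" "X = \<kappa> w" "Y = \<kappa> w'" using XY by (auto simp: L)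
      then show ?thesis using h[of "sm w w'"] h[of w] h[of w'] add[of w w'] g_add[of w w'] by simp
    qed
    show "h (a \<odot>\<^bsub>L\<^esub> X) = a \<odot>\<^bsub>N\<^esub> h X" if "a \<in> carrier A" and X: "X \<in> carrier L" for a X
    proof -
      obtain w where w: "w \<in> I" "X = \<kappa> w" using X by (auto simp: L)
      then show ?thesis using h[of "act a w"] h[of w] act[of a w] g_act[of a w] that by simp
    qed
  qed
  then show ?thesis using h by blast
qed

lemma hom_space_simps [simp]:
  "carrier (hom_space A M N) = mod_hom A M N"
  "add (hom_space A M N) = (\<lambda>f g. \<lambda>x\<in>carrier M. f x \<oplus>\<^bsub>N\<^esub> g x)"
  "smult (hom_space A M N) = (\<lambda>c f. \<lambda>x\<in>carrier M. (c \<odot>\<^bsub>A\<^esub> \<one>\<^bsub>A\<^esub>) \<odot>\<^bsub>N\<^esub> f x)"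
  by (simp_all add: hom_space_def)

lemma (in field) mod_hom_regular_iff:
  "\<phi> \<in> mod_hom R V (regular R) \<longleftrightarrow> \<phi> \<in> extensional (carrier V) \<and> functional R V \<phi>"
proof -
  have "\<phi> x \<otimes> c = c \<otimes> \<phi> x" if "\<phi> \<in> carrier V \<rightarrow> carrier R" "c \<in> carrier R" "x \<in> carrier V" for c x
    using that by (intro m_comm) auto
  then show ?thesis by (auto simp: mod_hom_def functional_def PiE_def)
qed

context fin_dim_algebra
begin

lemma F_dual_iff:
  "\<theta> \<in> carrier (F_dual F A M) \<longleftrightarrow>
    \<theta> \<in> extensional (carrier M) \<and> functional F (restrict_scalars A M) \<theta>"
  unfolding F_dual_def hom_module_simps F.mod_hom_regular_iff by simp

lemma F_dual_simps:
  "add (F_dual F A M) = (\<lambda>\<phi> \<psi>. \<lambda>x\<in>carrier M. \<phi> x \<oplus>\<^bsub>F\<^esub> \<psi> x)"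
  "smult (F_dual F A M) = (\<lambda>a \<phi>. \<lambda>x\<in>carrier M. \<phi> (a \<odot>\<^bsub>M\<^esub> x))"
  "zero (F_dual F A M) = (\<lambda>x\<in>carrier M. \<zero>\<^bsub>F\<^esub>)"
  by (simp_all add: F_dual_def)

lemma functional_descend:
  assumes M: "right_module A M" and x: "x \<in> carrier M" "carrier M = {a \<odot>\<^bsub>M\<^esub> x |a. a \<in> carrier A}"
    and g: "functional F A g"
    and wd: "\<And>a b. a \<in> carrier A \<Longrightarrow> b \<in> carrier A \<Longrightarrow> a \<odot>\<^bsub>M\<^esub> x = b \<odot>\<^bsub>M\<^esub> x \<Longrightarrow> g a = g b"
  shows "\<exists>\<theta>\<in>carrier (F_dual F A M). \<forall>a\<in>carrier A. \<theta> (a \<odot>\<^bsub>M\<^esub> x) = g a"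
proof -
  interpret M: right_module A M by (rule M)
  note gD = functionalD[OF g]
  have "\<exists>\<theta>\<in>mod_hom F (restrict_scalars A M) (regular F). \<forall>a\<in>carrier A. \<theta> (a \<odot>\<^bsub>M\<^esub> x) = g a"
  proof (rule mod_hom_descend[where sm = "\<lambda>a b. a \<oplus> b" and act = "\<lambda>c a. c \<odot> a"])
    show "carrier (restrict_scalars A M) = (\<lambda>a. a \<odot>\<^bsub>M\<^esub> x) ` carrier A" using x(2) by auto
    show "w \<oplus> w' \<in> carrier A \<and>
        (w \<oplus> w') \<odot>\<^bsub>M\<^esub> x = w \<odot>\<^bsub>M\<^esub> x \<oplus>\<^bsub>restrict_scalars A M\<^esub> w' \<odot>\<^bsub>M\<^esub> x"
      if "w \<in> carrier A" "w' \<in> carrier A" for w w'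
      using that x(1) by (simp add: M.smult_l_distr)
    show "c \<odot> w \<in> carrier A \<and> (c \<odot> w) \<odot>\<^bsub>M\<^esub> x = c \<odot>\<^bsub>restrict_scalars A M\<^esub> (w \<odot>\<^bsub>M\<^esub> x)"
      if "c \<in> carrier F" "w \<in> carrier A" for c w
      using that x(1) scalar_one
      by (simp add: V.smult_closed M.smult_mult[symmetric] scalar_one_mult)
    show "g w \<in> carrier (regular F)" if "w \<in> carrier A" for w using that gD(1) by simp
    show "g (w \<oplus> w') = g w \<oplus>\<^bsub>regular F\<^esub> g w'" if "w \<in> carrier A" "w' \<in> carrier A" for w w'
      using that gD(2) by simp
    show "g (c \<odot> w) = c \<odot>\<^bsub>regular F\<^esub> g w" if "c \<in> carrier F" "w \<in> carrier A" for c w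
      using that gD(1,3) by (simp add: F.m_comm)
  qed (rule wd)
  then show ?thesis by (simp add: F_dual_def)
qed

end

section \<open>Projective covers of simple modules\<close>

text \<open>
  The correspondence \<open>x a \<leftrightarrow> e a\<close> identifies \<open>M\<close> with \<open>e A\<close>.
\<close>

definition idempotent_generator ::
    "('a, 'k) ring_scheme \<Rightarrow> ('a, 'm) module \<Rightarrow> 'a \<Rightarrow> 'm \<Rightarrow> bool" where
  "idempotent_generator A M e x \<longleftrightarrow> e \<in> carrier A \<and> e \<otimes>\<^bsub>A\<^esub> e = e \<and>
     x \<in> carrier M \<and> carrier M = {a \<odot>\<^bsub>M\<^esub> x |a. a \<in> carrier A} \<and>
     (\<forall>a\<in>carrier A. a \<odot>\<^bsub>M\<^esub> x = \<zero>\<^bsub>M\<^esub> \<longleftrightarrow> e \<otimes>\<^bsub>A\<^esub> a = \<zero>\<^bsub>A\<^esub>)"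

text \<open>
  The correspondence \<open>s a \<leftrightarrow> e a\<close> identifies \<open>M\<close> with the top \<open>e A / e J\<close> of \<open>e A\<close>.
\<close>

definition top_generator ::
    "('a, 'k) ring_scheme \<Rightarrow> ('a, 'm) module \<Rightarrow> 'a \<Rightarrow> 'm \<Rightarrow> bool" where
  "top_generator A M e s \<longleftrightarrow> e \<in> carrier A \<and> e \<otimes>\<^bsub>A\<^esub> e = e \<and>
     s \<in> carrier M \<and> carrier M = {a \<odot>\<^bsub>M\<^esub> s |a. a \<in> carrier A} \<and>
     (\<forall>a\<in>carrier A. a \<odot>\<^bsub>M\<^esub> s = \<zero>\<^bsub>M\<^esub> \<longleftrightarrow> e \<otimes>\<^bsub>A\<^esub> a \<in> jacobson A)"

lemma idempotent_generatorD:
  assumes "idempotent_generator A M e x"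
  shows "e \<in> carrier A" "e \<otimes>\<^bsub>A\<^esub> e = e" "x \<in> carrier M"
    "carrier M = {a \<odot>\<^bsub>M\<^esub> x |a. a \<in> carrier A}"
    "a \<in> carrier A \<Longrightarrow> a \<odot>\<^bsub>M\<^esub> x = \<zero>\<^bsub>M\<^esub> \<longleftrightarrow> e \<otimes>\<^bsub>A\<^esub> a = \<zero>\<^bsub>A\<^esub>"
  using assms unfolding idempotent_generator_def by blast+

lemma top_generatorD:
  assumes "top_generator A M e x"
  shows "e \<in> carrier A" "e \<otimes>\<^bsub>A\<^esub> e = e" "x \<in> carrier M"
    "carrier M = {a \<odot>\<^bsub>M\<^esub> x |a. a \<in> carrier A}"
    "a \<in> carrier A \<Longrightarrow> a \<odot>\<^bsub>M\<^esub> x = \<zero>\<^bsub>M\<^esub> \<longleftrightarrow> e \<otimes>\<^bsub>A\<^esub> a \<in> jacobson A"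
  using assms unfolding top_generator_def by blast+

lemma (in right_module) idempotent_generator_fix:
  assumes "idempotent_generator A M e x" shows "e \<odot> x = x"
proof -
  note x = idempotent_generatorD[OF assms]
  have "e \<otimes>\<^bsub>A\<^esub> (\<one>\<^bsub>A\<^esub> \<ominus>\<^bsub>A\<^esub> e) = \<zero>\<^bsub>A\<^esub>"
    using x(1,2) by (simp add: A.minus_eq A.r_distr A.r_minus A.r_neg)
  then have "(\<one>\<^bsub>A\<^esub> \<ominus>\<^bsub>A\<^esub> e) \<odot> x = \<zero>" using x by simp
  then show ?thesis
    using x(1,3) M.diff_eq_zero_iff smult_closed by (simp add: smult_diff_left smult_one)
qed

lemma (in right_module) top_generator_fix:
  assumes "top_generator A M e x" shows "e \<odot> x = x"
proof -
  note x = top_generatorD[OF assms]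
  interpret R: right_module A "regular A" by (rule A.right_module_regular)
  have "e \<otimes>\<^bsub>A\<^esub> (\<one>\<^bsub>A\<^esub> \<ominus>\<^bsub>A\<^esub> e) = \<zero>\<^bsub>A\<^esub>"
    using x(1,2) by (simp add: A.minus_eq A.r_distr A.r_minus A.r_neg)
  then have "(\<one>\<^bsub>A\<^esub> \<ominus>\<^bsub>A\<^esub> e) \<odot> x = \<zero>" using x R.submodule_zero[OF R.submodule_rad] by simp
  then show ?thesis
    using x(1,3) M.diff_eq_zero_iff smult_closed by (simp add: smult_diff_left smult_one)
qed

lemma (in ring) fg_regular: "fg_right_module R (regular R)"
proof -
  interpret R: right_module R "regular R" by (rule right_module_regular)
  have "submodule (module_span R (regular R) {\<one>}) R (regular R)" by (rule R.submodule_span) simp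
  moreover have "\<one> \<in> module_span R (regular R) {\<one>}" using module_span_superset by fast
  ultimately have "a \<in> module_span R (regular R) {\<one>}" if "a \<in> carrier R" for a
    using R.submodule_smult[of "module_span R (regular R) {\<one>}" a \<one>] that by simp
  then have "module_span R (regular R) {\<one>} = carrier R"
    using R.submodule_sub[OF \<open>submodule _ _ _\<close>] by auto
  then have "fin_gen R (regular R)" unfolding fin_gen_def by (intro exI[of _ "{\<one>}"]) simp
  then show ?thesis using right_module_regular by (simp add: fg_right_module_def)
qed

lemma simple_module_cyclic:
  assumes S: "simple_module A S" and s: "s \<in> carrier S" "s \<noteq> \<zero>\<^bsub>S\<^esub>"
  shows "carrier S = {a \<odot>\<^bsub>S\<^esub> s |a. a \<in> carrier A}"
proof -
  have "right_module A S" using S by (simp add: simple_module_def fg_right_module_def)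
  then interpret S: right_module A S .
  have "{a \<odot>\<^bsub>S\<^esub> s |a. a \<in> carrier A} = {\<zero>\<^bsub>S\<^esub>} \<or> {a \<odot>\<^bsub>S\<^esub> s |a. a \<in> carrier A} = carrier S"
    using S S.submodule_cyclic[OF s(1)] by (simp add: simple_module_def)
  moreover have "s \<in> {a \<odot>\<^bsub>S\<^esub> s |a. a \<in> carrier A}"
    using S.smult_one[OF s(1)] by (intro CollectI exI[of _ "\<one>\<^bsub>A\<^esub>"]) simp
  ultimately show ?thesis using s(2) by (elim disjE) (simp, simp only:)
qed

text \<open>
  A preimage \<open>x\<close> of a generator generates \<open>P\<close>, because the kernel is superfluous; the epimorphism
  \<open>a \<mapsto> x a\<close> from \<open>A\<close> splits by projectivity, and a splitting \<open>\<sigma>\<close> is at the same time a generator of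
  the \<open>A\<close>-dual of \<open>P\<close>, belonging to the same idempotent \<open>e = \<sigma> x\<close>. If \<open>s a = 0\<close> for the image \<open>s\<close> of
  \<open>x\<close>, then \<open>e a\<close> lies in every maximal right ideal \<open>K\<close>: otherwise the preimage of \<open>K\<close> under \<open>\<sigma>\<close>
  would be a proper submodule which together with the kernel spans \<open>P\<close>.
\<close>

lemma projective_cover_generators:
  fixes A :: "('f, 'a) module"
  assumes "ring A" and S: "simple_module A S" and P: "projective_cover A P S \<pi>"
  shows "\<exists>e x s \<sigma>. idempotent_generator A P e x \<and> top_generator A S e s \<and> s \<noteq> \<zero>\<^bsub>S\<^esub> \<and>
    idempotent_generator (opposite A) (A_dual A P) e \<sigma>"
proof -
  have "right_module A S" using S by (simp add: simple_module_def fg_right_module_def)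
  then interpret S: right_module A S .
  have proj: "projective_module A P" using P by (simp add: projective_cover_def)
  then have fgP: "fg_right_module A P" by (simp add: projective_module_def)
  then interpret P: right_module A P by (simp add: fg_right_module_def)
  interpret R: right_module A "regular A" by (rule S.A.right_module_regular)
  have \<pi>: "\<pi> \<in> mod_hom A P S" and surj: "\<pi> ` carrier P = carrier S"
    and sup: "superfluous A P {p \<in> carrier P. \<pi> p = \<zero>\<^bsub>S\<^esub>}"
    using P by (simp_all add: projective_cover_def)
  note \<pi>D = mod_homD[OF \<pi>]
  let ?K = "{p \<in> carrier P. \<pi> p = \<zero>\<^bsub>S\<^esub>}"
  have \<pi>0: "\<pi> \<zero>\<^bsub>P\<^esub> = \<zero>\<^bsub>S\<^esub>" using mod_hom_zero[OF \<pi>] P.right_module_axioms S.right_module_axioms .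
  \<comment> \<open>Superfluousness of the kernel: a submodule that maps onto \<open>S\<close> is all of \<open>P\<close>.\<close>
  have full: "N = carrier P"
    if N: "submodule N A P" and *: "\<And>p. p \<in> carrier P \<Longrightarrow> \<exists>q\<in>N. \<pi> (p \<ominus>\<^bsub>P\<^esub> q) = \<zero>\<^bsub>S\<^esub>" for N
  proof -
    have "p \<in> N <+>\<^bsub>P\<^esub> ?K" if p: "p \<in> carrier P" for p
    proof -
      obtain q where q: "q \<in> N" "\<pi> (p \<ominus>\<^bsub>P\<^esub> q) = \<zero>\<^bsub>S\<^esub>" using *[OF p] by blast
      have qP: "q \<in> carrier P" using P.submodule_mem[OF N q(1)] .
      then have "p = q \<oplus>\<^bsub>P\<^esub> (p \<ominus>\<^bsub>P\<^esub> q)" using p by (simp add: P.minus_eq P.a_ac P.r_neg P.r_neg1 P.r_neg2)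
      moreover have "p \<ominus>\<^bsub>P\<^esub> q \<in> ?K" using q p qP by simp
      ultimately show ?thesis using q(1) unfolding P.set_add_iff by blast
    qed
    moreover have "N <+>\<^bsub>P\<^esub> ?K \<subseteq> carrier P"
      using P.submodule_mem[OF N] by (auto simp: P.set_add_iff)
    ultimately have "N <+>\<^bsub>P\<^esub> ?K = carrier P" by blast
    then show ?thesis using sup N unfolding superfluous_def by blast
  qed
  have \<pi>_diff: "\<pi> (p \<ominus>\<^bsub>P\<^esub> q) = \<pi> p \<ominus>\<^bsub>S\<^esub> \<pi> q" if "p \<in> carrier P" "q \<in> carrier P" for p q
  proof -
    have "\<pi> (p \<ominus>\<^bsub>P\<^esub> q) \<oplus>\<^bsub>S\<^esub> \<pi> q = \<pi> ((p \<ominus>\<^bsub>P\<^esub> q) \<oplus>\<^bsub>P\<^esub> q)" using \<pi>D(2) that by simp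
    also have "(p \<ominus>\<^bsub>P\<^esub> q) \<oplus>\<^bsub>P\<^esub> q = p" using that by (simp add: P.minus_eq P.a_assoc P.l_neg)
    finally have "\<pi> p = \<pi> (p \<ominus>\<^bsub>P\<^esub> q) \<oplus>\<^bsub>S\<^esub> \<pi> q" ..
    then show ?thesis using \<pi>D(1) that by (simp add: S.minus_eq S.a_assoc S.r_neg)
  qed
  obtain s where s: "s \<in> carrier S" "s \<noteq> \<zero>\<^bsub>S\<^esub>"
    using S S.submodule_zero[OF S.submodule_carrier] by (auto simp: simple_module_def)
  note genS = simple_module_cyclic[OF S s]
  have "s \<in> \<pi> ` carrier P" unfolding surj by (rule s(1))
  then obtain x where x: "x \<in> carrier P" "\<pi> x = s" by auto
  have genP: "{a \<odot>\<^bsub>P\<^esub> x |a. a \<in> carrier A} = carrier P"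
  proof (rule full)
    show "submodule {a \<odot>\<^bsub>P\<^esub> x |a. a \<in> carrier A} A P" using x(1) by (rule P.submodule_cyclic)
    fix p assume p: "p \<in> carrier P"
    then obtain a where a: "\<pi> p = a \<odot>\<^bsub>S\<^esub> s" "a \<in> carrier A" using \<pi>D(1) genS by blast
    then have "\<pi> (p \<ominus>\<^bsub>P\<^esub> a \<odot>\<^bsub>P\<^esub> x) = \<zero>\<^bsub>S\<^esub>"
      using p x \<pi>D(3) P.smult_closed S.smult_closed s S.diff_eq_zero_iff by (simp add: \<pi>_diff)
    then show "\<exists>q\<in>{a \<odot>\<^bsub>P\<^esub> x |a. a \<in> carrier A}. \<pi> (p \<ominus>\<^bsub>P\<^esub> q) = \<zero>\<^bsub>S\<^esub>" using a by blast
  qed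
  have g: "(\<lambda>a\<in>carrier A. a \<odot>\<^bsub>P\<^esub> x) \<in> mod_hom A (regular A) P"
    using x P.smult_closed by (auto simp: mod_hom_def P.smult_l_distr P.smult_mult)
  moreover have "(\<lambda>a\<in>carrier A. a \<odot>\<^bsub>P\<^esub> x) ` carrier (regular A) = carrier P"
    using genP by auto
  moreover have "(\<lambda>p\<in>carrier P. p) \<in> mod_hom A P P"
    by (auto simp: mod_hom_def P.smult_closed)
  ultimately obtain \<sigma> where \<sigma>: "\<sigma> \<in> mod_hom A P (regular A)"
    and split: "\<forall>p\<in>carrier P. (\<lambda>a\<in>carrier A. a \<odot>\<^bsub>P\<^esub> x) (\<sigma> p) = (\<lambda>p\<in>carrier P. p) p"
    using projective_lift[OF proj S.A.fg_regular fgP] by blast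
  note \<sigma>D = mod_homD[OF \<sigma>, simplified]
  have split: "\<sigma> p \<odot>\<^bsub>P\<^esub> x = p" if "p \<in> carrier P" for p using split that \<sigma>D(1) by simp
  define e where "e = \<sigma> x"
  have e: "e \<in> carrier A" "e \<odot>\<^bsub>P\<^esub> x = x" using \<sigma>D(1) split x by (simp_all add: e_def)
  have \<sigma>x: "\<sigma> (a \<odot>\<^bsub>P\<^esub> x) = e \<otimes>\<^bsub>A\<^esub> a" if "a \<in> carrier A" for a using \<sigma>D(3) x that by (simp add: e_def)
  have ee: "e \<otimes>\<^bsub>A\<^esub> e = e" using \<sigma>x[OF e(1)] e(2) by (simp add: e_def)
  have "idempotent_generator A P e x"
    unfolding idempotent_generator_def
  proof (intro conjI ballI)
    fix a assume a: "a \<in> carrier A"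
    show "a \<odot>\<^bsub>P\<^esub> x = \<zero>\<^bsub>P\<^esub> \<longleftrightarrow> e \<otimes>\<^bsub>A\<^esub> a = \<zero>\<^bsub>A\<^esub>"
    proof
      assume "a \<odot>\<^bsub>P\<^esub> x = \<zero>\<^bsub>P\<^esub>"
      then show "e \<otimes>\<^bsub>A\<^esub> a = \<zero>\<^bsub>A\<^esub>"
        using \<sigma>x[OF a] mod_hom_zero[OF \<sigma> P.right_module_axioms R.right_module_axioms] by simp
    next
      assume "e \<otimes>\<^bsub>A\<^esub> a = \<zero>\<^bsub>A\<^esub>"
      moreover have "a \<odot>\<^bsub>P\<^esub> x = (e \<otimes>\<^bsub>A\<^esub> a) \<odot>\<^bsub>P\<^esub> x" using e a x by (simp add: P.smult_mult)
      ultimately show "a \<odot>\<^bsub>P\<^esub> x = \<zero>\<^bsub>P\<^esub>" using P.smult_zero_left x by simp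
    qed
  qed (use e ee x genP in simp_all)
  moreover have "top_generator A S e s"
    unfolding top_generator_def
  proof (intro conjI ballI)
    have es: "e \<odot>\<^bsub>S\<^esub> s = s" using \<pi>D(3)[OF e(1) x(1)] e(2) x(2) by simp
    fix a assume a: "a \<in> carrier A"
    show "a \<odot>\<^bsub>S\<^esub> s = \<zero>\<^bsub>S\<^esub> \<longleftrightarrow> e \<otimes>\<^bsub>A\<^esub> a \<in> jacobson A"
    proof
      assume as: "a \<odot>\<^bsub>S\<^esub> s = \<zero>\<^bsub>S\<^esub>"
      have "e \<otimes>\<^bsub>A\<^esub> a \<in> K" if K: "maximal_submodule A (regular A) K" for K
      proof (rule ccontr)
        assume ea: "e \<otimes>\<^bsub>A\<^esub> a \<notin> K"
        have sK: "submodule K A (regular A)" using K by (simp add: maximal_submodule_def)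
        note sKm = R.submodule_mem[OF sK, simplified]
        have c: "e \<otimes>\<^bsub>A\<^esub> a \<in> carrier (regular A)" using e a by simp
        note L = R.maximal_submodule_add_cyclic[OF K c ea, simplified]
        let ?N = "{p \<in> carrier P. \<sigma> p \<in> K}"
        have "?N = carrier P"
        proof (rule full)
          show "submodule ?N A P"
            using \<sigma>D(2,3) P.smult_closed R.submodule_zero[OF sK] R.submodule_add[OF sK]
              R.submodule_smult[OF sK] mod_hom_zero[OF \<sigma> P.right_module_axioms R.right_module_axioms]
            by (auto simp: P.submodule_iff)
          fix p assume p: "p \<in> carrier P"
          have "\<sigma> p \<in> {k \<oplus>\<^bsub>A\<^esub> (e \<otimes>\<^bsub>A\<^esub> a) \<otimes>\<^bsub>A\<^esub> b |k b. k \<in> K \<and> b \<in> carrier A}"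
            unfolding L by (rule \<sigma>D(1)[OF p])
          then obtain k b where kb: "\<sigma> p = k \<oplus>\<^bsub>A\<^esub> (e \<otimes>\<^bsub>A\<^esub> a) \<otimes>\<^bsub>A\<^esub> b" "k \<in> K" "b \<in> carrier A"
            by blast
          let ?q = "b \<odot>\<^bsub>P\<^esub> (a \<odot>\<^bsub>P\<^esub> x)"
          have q: "?q \<in> carrier P" using kb a x P.smult_closed by simp
          have "\<sigma> ?q = (e \<otimes>\<^bsub>A\<^esub> a) \<otimes>\<^bsub>A\<^esub> b"
            using kb a x P.smult_closed \<sigma>D(3) by (simp add: e_def)
          moreover have "\<sigma> ((p \<ominus>\<^bsub>P\<^esub> ?q) \<oplus>\<^bsub>P\<^esub> ?q) = \<sigma> (p \<ominus>\<^bsub>P\<^esub> ?q) \<oplus>\<^bsub>A\<^esub> \<sigma> ?q"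
            using \<sigma>D(2) p q by simp
          moreover have "(p \<ominus>\<^bsub>P\<^esub> ?q) \<oplus>\<^bsub>P\<^esub> ?q = p" using p q by (simp add: P.minus_eq P.a_assoc P.l_neg)
          ultimately have "\<sigma> (p \<ominus>\<^bsub>P\<^esub> ?q) \<oplus>\<^bsub>A\<^esub> (e \<otimes>\<^bsub>A\<^esub> a) \<otimes>\<^bsub>A\<^esub> b = k \<oplus>\<^bsub>A\<^esub> (e \<otimes>\<^bsub>A\<^esub> a) \<otimes>\<^bsub>A\<^esub> b"
            using kb by simp
          then have "\<sigma> (p \<ominus>\<^bsub>P\<^esub> ?q) \<in> K"
            using \<sigma>D(1) p q kb sKm e a by (simp add: S.A.add.right_cancel)
          moreover have "\<pi> (p \<ominus>\<^bsub>P\<^esub> (p \<ominus>\<^bsub>P\<^esub> ?q)) = \<zero>\<^bsub>S\<^esub>"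
          proof -
            have "p \<ominus>\<^bsub>P\<^esub> (p \<ominus>\<^bsub>P\<^esub> ?q) = ?q"
              using p q by (simp add: P.minus_eq P.minus_add P.a_ac P.r_neg P.r_neg1 P.r_neg2)
            then show ?thesis
              using \<pi>D(3) a kb x as P.smult_closed S.smult_zero_right by simp
          qed
          ultimately show "\<exists>q\<in>?N. \<pi> (p \<ominus>\<^bsub>P\<^esub> q) = \<zero>\<^bsub>S\<^esub>" using p q by blast
        qed
        then have "a \<odot>\<^bsub>P\<^esub> x \<in> ?N" using a x P.smult_closed by simp
        then show False using ea \<sigma>x[OF a] by simp
      qed
      then show "e \<otimes>\<^bsub>A\<^esub> a \<in> jacobson A" using e a by (auto simp: rad_def)
    next
      assume J: "e \<otimes>\<^bsub>A\<^esub> a \<in> jacobson A"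
      have "minimal_submodule A S (carrier S)"
        using S S.submodule_carrier by (simp add: minimal_submodule_def simple_module_def)
      from S.jacobson_smult_minimal[OF this s(1) J] have "(e \<otimes>\<^bsub>A\<^esub> a) \<odot>\<^bsub>S\<^esub> s = \<zero>\<^bsub>S\<^esub>" .
      then show "a \<odot>\<^bsub>S\<^esub> s = \<zero>\<^bsub>S\<^esub>" using es e a s by (simp add: S.smult_mult)
    qed
  qed (use e ee s genS in simp_all)
  moreover have "idempotent_generator (opposite A) (A_dual A P) e \<sigma>"
    unfolding idempotent_generator_def
  proof (intro conjI ballI)
    have \<sigma>e: "e \<otimes>\<^bsub>A\<^esub> \<sigma> p = \<sigma> p" if "p \<in> carrier P" for p
      using \<sigma>x[of "\<sigma> p"] split \<sigma>D(1) that by simp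
    show "carrier (A_dual A P) = {a \<odot>\<^bsub>A_dual A P\<^esub> \<sigma> |a. a \<in> carrier (opposite A)}"
    proof
      show "carrier (A_dual A P) \<subseteq> {a \<odot>\<^bsub>A_dual A P\<^esub> \<sigma> |a. a \<in> carrier (opposite A)}"
      proof
        fix h assume "h \<in> carrier (A_dual A P)"
        then have "h \<in> mod_hom A P (regular A)" by (simp add: A_dual_def)
        note hD = mod_homD[OF this, simplified]
        have "h p = h x \<otimes>\<^bsub>A\<^esub> \<sigma> p" if "p \<in> carrier P" for p
          using hD(3)[of "\<sigma> p" x] split[OF that] \<sigma>D(1)[OF that] x by simp
        then have "h = h x \<odot>\<^bsub>A_dual A P\<^esub> \<sigma>"
          using hD(4) by (auto simp: A_dual_def fun_eq_iff extensional_def)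
        then show "h \<in> {a \<odot>\<^bsub>A_dual A P\<^esub> \<sigma> |a. a \<in> carrier (opposite A)}"
          using hD(1)[OF x(1)] by auto
      qed
      show "{a \<odot>\<^bsub>A_dual A P\<^esub> \<sigma> |a. a \<in> carrier (opposite A)} \<subseteq> carrier (A_dual A P)"
        using \<sigma>D(1,2,3) P.smult_closed
        by (auto simp: A_dual_def mod_hom_def S.A.r_distr S.A.m_assoc)
    qed
    fix a assume a: "a \<in> carrier (opposite A)"
    show "a \<odot>\<^bsub>A_dual A P\<^esub> \<sigma> = \<zero>\<^bsub>A_dual A P\<^esub> \<longleftrightarrow> e \<otimes>\<^bsub>opposite A\<^esub> a = \<zero>\<^bsub>opposite A\<^esub>"
    proof
      assume "a \<odot>\<^bsub>A_dual A P\<^esub> \<sigma> = \<zero>\<^bsub>A_dual A P\<^esub>"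
      from fun_cong[OF this, of x] show "e \<otimes>\<^bsub>opposite A\<^esub> a = \<zero>\<^bsub>opposite A\<^esub>"
        using x by (simp add: A_dual_def e_def)
    next
      assume *: "e \<otimes>\<^bsub>opposite A\<^esub> a = \<zero>\<^bsub>opposite A\<^esub>"
      have "a \<otimes>\<^bsub>A\<^esub> \<sigma> p = \<zero>\<^bsub>A\<^esub>" if p: "p \<in> carrier P" for p
      proof -
        have "a \<otimes>\<^bsub>A\<^esub> \<sigma> p = (a \<otimes>\<^bsub>A\<^esub> e) \<otimes>\<^bsub>A\<^esub> \<sigma> p"
          using a e \<sigma>D(1)[OF p] \<sigma>e[OF p] by (simp add: S.A.m_assoc)
        then show ?thesis using * \<sigma>D(1)[OF p] by simp
      qed
      then show "a \<odot>\<^bsub>A_dual A P\<^esub> \<sigma> = \<zero>\<^bsub>A_dual A P\<^esub>" by (auto simp: A_dual_def fun_eq_iff)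
    qed
  qed (use e ee \<sigma> in \<open>simp_all add: A_dual_def\<close>)
  ultimately show ?thesis using s by blast
qed

text \<open>
  The radical series of \<open>x A\<close> is \<open>x J\<^sup>m\<close>, so \<open>\<kappa>\<close> maps \<open>J\<^sup>m\<close> onto the layer. As \<open>x A \<cong> e A\<close>, elements with
  the same image agree after multiplication by \<open>e\<close>, up to \<open>e J\<^sup>m\<^sup>+\<^sup>1\<close>.
\<close>

lemma rad_layer_cyclic:
  fixes A :: "('f, 'a) module" and M :: "('a, 'm) module" and m :: nat
  assumes "artinian_ring A" and "right_module A M" and gen: "idempotent_generator A M e x"
  defines "\<kappa> \<equiv> (\<lambda>w. rad_pow A M (Suc m) +>\<^bsub>M\<^esub> (w \<odot>\<^bsub>M\<^esub> x))"
  shows "right_module A (rad_layer A (Suc m) M)"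
    and "carrier (rad_layer A (Suc m) M) = \<kappa> ` jacobson_power A m"
    and "k \<in> jacobson_power A (Suc m) \<Longrightarrow> \<kappa> k = zero (rad_layer A (Suc m) M)"
    and "w \<in> jacobson_power A m \<Longrightarrow> w' \<in> jacobson_power A m \<Longrightarrow>
      \<kappa> (w \<oplus>\<^bsub>A\<^esub> w') = \<kappa> w \<oplus>\<^bsub>rad_layer A (Suc m) M\<^esub> \<kappa> w'"
    and "a \<in> carrier A \<Longrightarrow> w \<in> jacobson_power A m \<Longrightarrow>
      \<kappa> (w \<otimes>\<^bsub>A\<^esub> a) = a \<odot>\<^bsub>rad_layer A (Suc m) M\<^esub> \<kappa> w"
    and "w \<in> jacobson_power A m \<Longrightarrow> \<kappa> (e \<otimes>\<^bsub>A\<^esub> w) = \<kappa> w"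
    and "w \<in> jacobson_power A m \<Longrightarrow> w' \<in> jacobson_power A m \<Longrightarrow> \<kappa> w = \<kappa> w' \<Longrightarrow>
      \<exists>k\<in>jacobson_power A (Suc m). e \<otimes>\<^bsub>A\<^esub> w = e \<otimes>\<^bsub>A\<^esub> (k \<oplus>\<^bsub>A\<^esub> w')"
proof -
  interpret artinian_ring A by (rule assms(1))
  interpret M: right_module A M by (rule assms(2))
  note x = idempotent_generatorD[OF gen]
  note rp = M.rad_pow_cyclic[OF right_length x(3,4)]
  note V = M.submodule_rad_pow[of m] and N = M.submodule_rad_pow[of "Suc m"]
    and NV = rad_pow_Suc_subset[of A M m]
  have layer: "rad_layer A (Suc m) M = quot_module (M\<lparr>carrier := rad_pow A M m\<rparr>) (rad_pow A M (Suc m))"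
    by (simp add: rad_layer_def)
  have wV: "w \<odot>\<^bsub>M\<^esub> x \<in> rad_pow A M m" if "w \<in> jacobson_power A m" for w
    unfolding rp using that by blast
  have wA: "w \<in> carrier A" if "w \<in> jacobson_power A k" for w k
    using jacobson_power_sub that by auto
  show "right_module A (rad_layer A (Suc m) M)"
    unfolding layer using V N NV by (rule M.section_right_module)
  show "carrier (rad_layer A (Suc m) M) = \<kappa> ` jacobson_power A m"
  proof -
    have "carrier (rad_layer A (Suc m) M)
        = {rad_pow A M (Suc m) +>\<^bsub>M\<^esub> y |y. y \<in> rad_pow A M m}"
      unfolding layer by (rule M.section_carrier[OF V N NV])
    also have "\<dots> = \<kappa> ` jacobson_power A m" unfolding rp[of m] \<kappa>_def by blast
    finally show ?thesis .
  qed
  show "\<kappa> k = zero (rad_layer A (Suc m) M)" if "k \<in> jacobson_power A (Suc m)"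
  proof -
    have "k \<odot>\<^bsub>M\<^esub> x \<in> rad_pow A M (Suc m)" unfolding rp using that by blast
    then show ?thesis
      unfolding layer M.section_zero[OF V N NV] \<kappa>_def
      using M.coset_eq_self_iff[OF N] M.submodule_mem[OF N] by blast
  qed
  show "\<kappa> (w \<oplus>\<^bsub>A\<^esub> w') = \<kappa> w \<oplus>\<^bsub>rad_layer A (Suc m) M\<^esub> \<kappa> w'"
    if "w \<in> jacobson_power A m" "w' \<in> jacobson_power A m"
    unfolding layer \<kappa>_def using that wA x(3) wV
    by (simp only: M.section_add[OF V N NV] M.smult_l_distr)
  show "\<kappa> (w \<otimes>\<^bsub>A\<^esub> a) = a \<odot>\<^bsub>rad_layer A (Suc m) M\<^esub> \<kappa> w"
    if "a \<in> carrier A" "w \<in> jacobson_power A m"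
    unfolding layer \<kappa>_def using that wA x(3) wV
    by (simp only: M.section_smult[OF V N NV] M.smult_mult)
  show "\<kappa> (e \<otimes>\<^bsub>A\<^esub> w) = \<kappa> w" if "w \<in> jacobson_power A m"
    unfolding \<kappa>_def using M.idempotent_generator_fix[OF gen] x(1,3) wA[OF that]
    by (simp add: M.smult_mult)
  show "\<exists>k\<in>jacobson_power A (Suc m). e \<otimes>\<^bsub>A\<^esub> w = e \<otimes>\<^bsub>A\<^esub> (k \<oplus>\<^bsub>A\<^esub> w')"
    if w: "w \<in> jacobson_power A m" "w' \<in> jacobson_power A m" and eq: "\<kappa> w = \<kappa> w'"
  proof -
    have "\<exists>y\<in>rad_pow A M (Suc m). w \<odot>\<^bsub>M\<^esub> x = y \<oplus>\<^bsub>M\<^esub> w' \<odot>\<^bsub>M\<^esub> x"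
      using eq M.coset_eq_iff[OF N M.smult_closed[OF wA[OF w(1)] x(3)] M.smult_closed[OF wA[OF w(2)] x(3)]]
      unfolding \<kappa>_def by blast
    then obtain k where k: "k \<in> jacobson_power A (Suc m)"
      "w \<odot>\<^bsub>M\<^esub> x = k \<odot>\<^bsub>M\<^esub> x \<oplus>\<^bsub>M\<^esub> w' \<odot>\<^bsub>M\<^esub> x" unfolding rp by blast
    note mem = wA[OF w(1)] wA[OF w(2)] wA[OF k(1)]
    have "w \<odot>\<^bsub>M\<^esub> x = (k \<oplus>\<^bsub>A\<^esub> w') \<odot>\<^bsub>M\<^esub> x" using k(2) mem x(3) by (simp add: M.smult_l_distr)
    then have "(w \<ominus>\<^bsub>A\<^esub> (k \<oplus>\<^bsub>A\<^esub> w')) \<odot>\<^bsub>M\<^esub> x = \<zero>\<^bsub>M\<^esub>"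
      using mem x(3) M.smult_closed M.M.diff_eq_zero_iff by (simp add: M.smult_diff_left)
    then have "e \<otimes>\<^bsub>A\<^esub> (w \<ominus>\<^bsub>A\<^esub> (k \<oplus>\<^bsub>A\<^esub> w')) = \<zero>\<^bsub>A\<^esub>" using x(5) mem by simp
    then have "e \<otimes>\<^bsub>A\<^esub> w \<ominus>\<^bsub>A\<^esub> e \<otimes>\<^bsub>A\<^esub> (k \<oplus>\<^bsub>A\<^esub> w') = \<zero>\<^bsub>A\<^esub>"
      using mem x(1) by (simp add: minus_eq r_distr r_minus minus_add)
    then have "e \<otimes>\<^bsub>A\<^esub> w = e \<otimes>\<^bsub>A\<^esub> (k \<oplus>\<^bsub>A\<^esub> w')"
      using mem x(1) diff_eq_zero_iff by simp
    then show ?thesis using k(1) by blast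
  qed
qed

section \<open>Functionals on a corner of a power of the radical\<close>

text \<open>
  The dual space of \<open>e J\<^sup>m f / e J\<^sup>m\<^sup>+\<^sup>1 f\<close>. Its elements are recorded as functionals on all of \<open>J\<^sup>m\<close> that
  are invariant under \<open>w \<mapsto> e w f\<close>, so that no quotient has to be formed.
\<close>

definition corner_dual ::
    "('f, 'k) ring_scheme \<Rightarrow> ('f, 'a) module \<Rightarrow> 'a \<Rightarrow> 'a \<Rightarrow> nat \<Rightarrow> ('f, 'a \<Rightarrow> 'f) module" where
  "corner_dual F A e f m = \<lparr>carrier = {\<psi> \<in> extensional (jacobson_power A m).
       functional F (A\<lparr>carrier := jacobson_power A m\<rparr>) \<psi> \<and>
       (\<forall>k\<in>jacobson_power A (Suc m). \<psi> k = \<zero>\<^bsub>F\<^esub>) \<and>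
       (\<forall>w\<in>jacobson_power A m. \<psi> (e \<otimes>\<^bsub>A\<^esub> w \<otimes>\<^bsub>A\<^esub> f) = \<psi> w)},
     mult = undefined, one = undefined, zero = (\<lambda>w\<in>jacobson_power A m. \<zero>\<^bsub>F\<^esub>),
     add = (\<lambda>\<phi> \<psi>. \<lambda>w\<in>jacobson_power A m. \<phi> w \<oplus>\<^bsub>F\<^esub> \<psi> w),
     smult = (\<lambda>c \<phi>. \<lambda>w\<in>jacobson_power A m. c \<otimes>\<^bsub>F\<^esub> \<phi> w)\<rparr>"

text \<open>
  The functional \<open>\<Phi> h\<close> only matters on \<open>J\<^sup>m\<close>; restricting it to make it extensional is done here once for
  all three spaces.
\<close>

lemma (in fin_dim_algebra) mod_iso_corner_dualI:
  fixes H :: "('f, 'h) module"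
  assumes f: "f \<in> carrier A" "e \<in> carrier A"
    and H_add: "\<And>h h'. h \<in> carrier H \<Longrightarrow> h' \<in> carrier H \<Longrightarrow> h \<oplus>\<^bsub>H\<^esub> h' \<in> carrier H"
    and H_smult: "\<And>c h. c \<in> carrier F \<Longrightarrow> h \<in> carrier H \<Longrightarrow> c \<odot>\<^bsub>H\<^esub> h \<in> carrier H"
    and lin: "\<And>h. h \<in> carrier H \<Longrightarrow> functional F (A\<lparr>carrier := jacobson_power A m\<rparr>) (\<Phi> h)"
    and zero: "\<And>h k. h \<in> carrier H \<Longrightarrow> k \<in> jacobson_power A (Suc m) \<Longrightarrow> \<Phi> h k = \<zero>\<^bsub>F\<^esub>"
    and corner: "\<And>h w. h \<in> carrier H \<Longrightarrow> w \<in> jacobson_power A m \<Longrightarrow> \<Phi> h (e \<otimes> w \<otimes> f) = \<Phi> h w"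
    and add: "\<And>h h' w. h \<in> carrier H \<Longrightarrow> h' \<in> carrier H \<Longrightarrow> w \<in> jacobson_power A m \<Longrightarrow>
      \<Phi> (h \<oplus>\<^bsub>H\<^esub> h') w = \<Phi> h w \<oplus>\<^bsub>F\<^esub> \<Phi> h' w"
    and smult: "\<And>c h w. c \<in> carrier F \<Longrightarrow> h \<in> carrier H \<Longrightarrow> w \<in> jacobson_power A m \<Longrightarrow>
      \<Phi> (c \<odot>\<^bsub>H\<^esub> h) w = c \<otimes>\<^bsub>F\<^esub> \<Phi> h w"
    and inj: "\<And>h h'. h \<in> carrier H \<Longrightarrow> h' \<in> carrier H \<Longrightarrow>
      (\<And>w. w \<in> jacobson_power A m \<Longrightarrow> \<Phi> h w = \<Phi> h' w) \<Longrightarrow> h = h'"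
    and surj: "\<And>\<psi>. \<psi> \<in> carrier (corner_dual F A e f m) \<Longrightarrow>
      \<exists>h\<in>carrier H. \<forall>w\<in>jacobson_power A m. \<Phi> h w = \<psi> w"
  shows "mod_iso F H (corner_dual F A e f m)" and "mod_iso F (corner_dual F A e f m) H"
proof -
  let ?I = "jacobson_power A m" and ?W = "corner_dual F A e f m"
  let ?\<Phi> = "\<lambda>h\<in>carrier H. \<lambda>w\<in>?I. \<Phi> h w"
  have KI: "k \<in> ?I" if "k \<in> jacobson_power A (Suc m)" for k
    using that by (rule subsetD[OF rad_pow_Suc_subset])
  have corner_mem: "e \<otimes> w \<otimes> f \<in> ?I" if "w \<in> ?I" for w
    using that f J.jacobson_power_mult_left J.jacobson_power_mult_right by blast
  have sI: "submodule ?I F A" using J.R.submodule_rad_pow by (rule right_ideal_subspace)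
  have W: "restrict (\<Phi> h) ?I \<in> carrier ?W" if "h \<in> carrier H" for h
    using lin[OF that] zero[OF that] corner[OF that] KI corner_mem
      V.submodule_add[OF sI] V.submodule_smult[OF sI]
    by (simp add: corner_dual_def functional_def Pi_iff del: rad_pow.simps)
  have hom: "?\<Phi> \<in> mod_hom F H ?W"
    unfolding mod_hom_def
  proof (intro CollectI conjI ballI)
    show "?\<Phi> \<in> carrier H \<rightarrow>\<^sub>E carrier ?W" using W by auto
    show "?\<Phi> (h \<oplus>\<^bsub>H\<^esub> h') = ?\<Phi> h \<oplus>\<^bsub>?W\<^esub> ?\<Phi> h'" if "h \<in> carrier H" "h' \<in> carrier H" for h h'
      using that add H_add by (auto simp: corner_dual_def fun_eq_iff)
    show "?\<Phi> (c \<odot>\<^bsub>H\<^esub> h) = c \<odot>\<^bsub>?W\<^esub> ?\<Phi> h" if "c \<in> carrier F" "h \<in> carrier H" for c h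
      using that smult H_smult by (auto simp: corner_dual_def fun_eq_iff)
  qed
  have bij: "bij_betw ?\<Phi> (carrier H) (carrier ?W)"
    unfolding bij_betw_def
  proof
    show "inj_on ?\<Phi> (carrier H)"
    proof (rule inj_onI)
      fix h h' assume h: "h \<in> carrier H" "h' \<in> carrier H" and eq: "?\<Phi> h = ?\<Phi> h'"
      have "\<Phi> h w = \<Phi> h' w" if "w \<in> ?I" for w
        using fun_cong[OF eq, of w] h that by simp
      then show "h = h'" using inj h by blast
    qed
    have "\<psi> \<in> ?\<Phi> ` carrier H" if \<psi>: "\<psi> \<in> carrier ?W" for \<psi>
    proof -
      obtain h where h: "h \<in> carrier H" "\<forall>w\<in>?I. \<Phi> h w = \<psi> w" using surj[OF \<psi>] by blast
      have "\<psi> \<in> extensional ?I" using \<psi> by (simp add: corner_dual_def)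
      then have "?\<Phi> h = \<psi>" using h by (auto simp: fun_eq_iff extensional_def)
      then show ?thesis using h(1) by blast
    qed
    then show "?\<Phi> ` carrier H = carrier ?W" using W by auto
  qed
  show "mod_iso F H ?W" using hom bij unfolding mod_iso_def by blast
  show "mod_iso F ?W H" using hom bij H_add H_smult by (rule mod_iso_inverse)
qed

text \<open>
  By invariance, \<open>\<psi> w\<close> depends only on \<open>e w\<close>, or only on \<open>w f\<close>, modulo \<open>J\<^sup>m\<^sup>+\<^sup>1\<close>. In this form
  it applies to the cosets that make up the layers of \<open>e A\<close> and of \<open>A f\<close>.
\<close>

lemma (in fin_dim_algebra) corner_dualD:
  assumes "\<psi> \<in> carrier (corner_dual F A e f m)"
    and "e \<in> carrier A" "e \<otimes> e = e" "f \<in> carrier A" "f \<otimes> f = f"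
    and w: "w \<in> jacobson_power A m"
  shows "\<psi> w \<in> carrier F"
    and "w' \<in> jacobson_power A m \<Longrightarrow> \<psi> (w \<oplus> w') = \<psi> w \<oplus>\<^bsub>F\<^esub> \<psi> w'"
    and "c \<in> carrier F \<Longrightarrow> \<psi> (c \<odot> w) = c \<otimes>\<^bsub>F\<^esub> \<psi> w"
    and "k \<in> jacobson_power A (Suc m) \<Longrightarrow> \<psi> k = \<zero>\<^bsub>F\<^esub>"
    and "\<psi> (e \<otimes> w) = \<psi> w"
    and "\<psi> (w \<otimes> f) = \<psi> w"
    and "w' \<in> jacobson_power A m \<Longrightarrow> k \<in> jacobson_power A (Suc m) \<Longrightarrow>
      e \<otimes> w = e \<otimes> (k \<oplus> w') \<Longrightarrow> \<psi> w = \<psi> w'"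
    and "w' \<in> jacobson_power A m \<Longrightarrow> k \<in> jacobson_power A (Suc m) \<Longrightarrow>
      w \<otimes> f = (k \<oplus> w') \<otimes> f \<Longrightarrow> \<psi> w = \<psi> w'"
proof -
  note e = assms(2,3) and f = assms(4,5)
  let ?I = "jacobson_power A m"
  have \<psi>: "functional F (A\<lparr>carrier := ?I\<rparr>) \<psi>" "\<And>k. k \<in> jacobson_power A (Suc m) \<Longrightarrow> \<psi> k = \<zero>\<^bsub>F\<^esub>"
    "\<And>w. w \<in> ?I \<Longrightarrow> \<psi> (e \<otimes> w \<otimes> f) = \<psi> w"
    using assms(1) by (auto simp: corner_dual_def simp del: rad_pow.simps)
  note \<psi>D = functionalD[OF \<psi>(1), simplified]
  show "\<psi> w \<in> carrier F" "w' \<in> ?I \<Longrightarrow> \<psi> (w \<oplus> w') = \<psi> w \<oplus>\<^bsub>F\<^esub> \<psi> w'"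
    "c \<in> carrier F \<Longrightarrow> \<psi> (c \<odot> w) = c \<otimes>\<^bsub>F\<^esub> \<psi> w"
    using \<psi>D w by auto
  show "k \<in> jacobson_power A (Suc m) \<Longrightarrow> \<psi> k = \<zero>\<^bsub>F\<^esub>" by (rule \<psi>(2))
  have IA: "v \<in> carrier A" if "v \<in> ?I" for v using that J.jacobson_power_sub by auto
  have left: "\<psi> (e \<otimes> v) = \<psi> v" if v: "v \<in> ?I" for v
  proof -
    have "e \<otimes> v \<in> ?I" using v e J.jacobson_power_mult_left by blast
    then have "\<psi> (e \<otimes> v) = \<psi> (e \<otimes> (e \<otimes> v) \<otimes> f)" by (rule \<psi>(3)[symmetric])
    also have "e \<otimes> (e \<otimes> v) \<otimes> f = e \<otimes> v \<otimes> f"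
      using e f IA[OF v] by (simp add: A.m_assoc[symmetric])
    finally show ?thesis using \<psi>(3)[OF v] by simp
  qed
  have right: "\<psi> (v \<otimes> f) = \<psi> v" if v: "v \<in> ?I" for v
  proof -
    have "v \<otimes> f \<in> ?I" using v f J.jacobson_power_mult_right by blast
    then have "\<psi> (v \<otimes> f) = \<psi> (e \<otimes> (v \<otimes> f) \<otimes> f)" by (rule \<psi>(3)[symmetric])
    also have "e \<otimes> (v \<otimes> f) \<otimes> f = e \<otimes> v \<otimes> f"
      using e f IA[OF v] by (simp add: A.m_assoc)
    finally show ?thesis using \<psi>(3)[OF v] by simp
  qed
  show "\<psi> (e \<otimes> w) = \<psi> w" "\<psi> (w \<otimes> f) = \<psi> w" using left right w by auto
  have sum: "k \<oplus> v \<in> ?I" "\<psi> (k \<oplus> v) = \<psi> v"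
    if "v \<in> ?I" "k \<in> jacobson_power A (Suc m)" for v k
  proof -
    have k: "k \<in> ?I" using that(2) by (rule subsetD[OF rad_pow_Suc_subset])
    show "k \<oplus> v \<in> ?I" using J.R.submodule_add[OF J.R.submodule_rad_pow k that(1)] by simp
    show "\<psi> (k \<oplus> v) = \<psi> v" using \<psi>D(1,2) k that \<psi>(2)[OF that(2)] by simp
  qed
  show "\<psi> w = \<psi> w'" if "w' \<in> ?I" "k \<in> jacobson_power A (Suc m)" "e \<otimes> w = e \<otimes> (k \<oplus> w')"
    using left[OF w] left[OF sum(1)[OF that(1,2)]] sum(2)[OF that(1,2)] that(3) by simp
  show "\<psi> w = \<psi> w'" if "w' \<in> ?I" "k \<in> jacobson_power A (Suc m)" "w \<otimes> f = (k \<oplus> w') \<otimes> f"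
    using right[OF w] right[OF sum(1)[OF that(1,2)]] sum(2)[OF that(1,2)] that(3) by simp
qed

context fin_dim_algebra
begin

text \<open>
  Since \<open>t f = t\<close>, the invariance under \<open>f\<close> can be forced by replacing a functional \<open>l\<close> with
  \<open>b \<mapsto> l (b f)\<close>.
\<close>

lemma top_functional:
  assumes T: "right_module A T" and t: "top_generator A T f t" "t \<noteq> \<zero>\<^bsub>T\<^esub>"
  shows "\<exists>\<phi>. functional F (restrict_scalars A T) \<phi> \<and> \<phi> t = \<one>\<^bsub>F\<^esub> \<and>
    (\<forall>u\<in>carrier T. \<phi> (f \<odot>\<^bsub>T\<^esub> u) = \<phi> u)"
proof -
  interpret T: right_module A T by (rule T)
  note tD = top_generatorD[OF t(1)]
  have ft: "f \<odot>\<^bsub>T\<^esub> t = t" using t(1) by (rule T.top_generator_fix)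
  let ?K = "{b \<in> carrier A. b \<odot>\<^bsub>T\<^esub> t \<in> {\<zero>\<^bsub>T\<^esub>}}"
  have K: "submodule ?K F A"
    using T.submodule_triv tD(3) by (intro right_ideal_subspace T.submodule_colon)
  obtain l where l: "functional F A l" "\<forall>x\<in>?K. l x = \<zero>\<^bsub>F\<^esub>" "l \<one> = \<one>\<^bsub>F\<^esub>"
    using V.functional_separate[OF F.field_axioms finite_length_scalars K, of "\<one>"]
      T.smult_one[OF tD(3)] t(2) by auto
  note lD = functionalD[OF l(1)]
  have lK: "l b = l b'" if b: "b \<in> carrier A" "b' \<in> carrier A" "b \<odot>\<^bsub>T\<^esub> t = b' \<odot>\<^bsub>T\<^esub> t" for b b'
  proof -
    have "b \<ominus> b' \<in> ?K"
      using b tD(3) T.smult_closed T.M.diff_eq_zero_iff by (simp add: T.smult_diff_left)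
    then have "l b \<ominus>\<^bsub>F\<^esub> l b' = \<zero>\<^bsub>F\<^esub>" using l(2) V.functional_diff[OF l(1)] b by auto
    then show ?thesis using F.diff_eq_zero_iff lD(1) b by simp
  qed
  have "functional F A (\<lambda>b. l (b \<otimes> f))"
    using tD(1) lD by (auto simp: functional_def A.l_distr smult_mult_left)
  moreover have "l (b \<otimes> f) = l (b' \<otimes> f)"
    if "b \<in> carrier A" "b' \<in> carrier A" "b \<odot>\<^bsub>T\<^esub> t = b' \<odot>\<^bsub>T\<^esub> t" for b b'
    using that tD(1,3) by (intro lK) (simp_all add: T.smult_mult)
  ultimately have "\<exists>h\<in>carrier (F_dual F A T). \<forall>b\<in>carrier A. h (b \<odot>\<^bsub>T\<^esub> t) = l (b \<otimes> f)"
    by (rule functional_descend[OF T tD(3,4)])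
  then obtain h where h: "functional F (restrict_scalars A T) h"
    "\<And>b. b \<in> carrier A \<Longrightarrow> h (b \<odot>\<^bsub>T\<^esub> t) = l (b \<otimes> f)"
    by (auto simp: F_dual_iff)
  have "h t = l (\<one> \<otimes> f)" using h(2)[of "\<one>"] T.smult_one tD(3) by simp
  also have "\<dots> = \<one>\<^bsub>F\<^esub>" using lK[of f "\<one>"] ft T.smult_one tD(1,3) l(3) by simp
  finally have "h t = \<one>\<^bsub>F\<^esub>" .
  moreover have "h (f \<odot>\<^bsub>T\<^esub> u) = h u" if "u \<in> carrier T" for u
  proof -
    obtain b where b: "u = b \<odot>\<^bsub>T\<^esub> t" "b \<in> carrier A"
      using \<open>u \<in> carrier T\<close> unfolding tD(4) by blast
    have "f \<odot>\<^bsub>T\<^esub> u = (b \<otimes> f) \<odot>\<^bsub>T\<^esub> t" using b tD(1,3) by (simp add: T.smult_mult)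
    then show ?thesis using b h(2)[of b] h(2)[of "b \<otimes> f"] tD(1,2) by (simp add: A.m_assoc)
  qed
  ultimately show ?thesis using h(1) by blast
qed

text \<open>
  The pairing \<open>(u, a) \<mapsto> \<phi>(u a)\<close> of \<open>T\<close> with \<open>A\<close> has no more than the expected kernel \<open>{a. a f \<in> J}\<close>.
  Modulo the radical, \<open>f A f\<close> is a division ring, as \<open>T = t A\<close> is simple. If \<open>r = f b a f\<close> were not in \<open>J\<close>,
  a left inverse \<open>d\<close> of \<open>r\<close> would give \<open>t (d b) a f = t\<close>, where \<open>\<phi>\<close> does not vanish. So \<open>f A a f\<close> lies
  in \<open>J\<close>, and therefore \<open>a f\<close> does.
\<close>

lemma top_pairing_kernel:
  assumes T: "right_module A T" and t: "top_generator A T f t"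
    and simple: "\<And>u. u \<in> carrier T \<Longrightarrow> u \<noteq> \<zero>\<^bsub>T\<^esub> \<Longrightarrow> \<exists>c\<in>carrier A. c \<odot>\<^bsub>T\<^esub> u = t"
    and \<phi>: "\<phi> t \<noteq> \<zero>\<^bsub>F\<^esub>" and \<phi>f: "\<And>u. u \<in> carrier T \<Longrightarrow> \<phi> (f \<odot>\<^bsub>T\<^esub> u) = \<phi> u"
    and a: "a \<in> carrier A" and zero: "\<And>b. b \<in> carrier A \<Longrightarrow> \<phi> ((b \<otimes> a) \<odot>\<^bsub>T\<^esub> t) = \<zero>\<^bsub>F\<^esub>"
  shows "a \<otimes> f \<in> jacobson A"
proof -
  interpret T: right_module A T by (rule T)
  note tD = top_generatorD[OF t]
  note f = tD(1,2)
  have ft: "f \<odot>\<^bsub>T\<^esub> t = t" using t by (rule T.top_generator_fix)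
  have JT: "z \<odot>\<^bsub>T\<^esub> u = \<zero>\<^bsub>T\<^esub>" if z: "z \<in> jacobson A" and u: "u \<in> carrier T" for z u
  proof -
    obtain b where b: "b \<in> carrier A" "u = b \<odot>\<^bsub>T\<^esub> t" using u unfolding tD(4) by blast
    have zA: "z \<in> carrier A" using z A.jacobson_sub by auto
    have "f \<otimes> (b \<otimes> z) \<in> jacobson A" using z b f by (intro A.jacobson_mult_left)
    then have "(b \<otimes> z) \<odot>\<^bsub>T\<^esub> t = \<zero>\<^bsub>T\<^esub>" using tD(5)[of "b \<otimes> z"] b zA by simp
    then show ?thesis using b zA tD(3) by (simp add: T.smult_mult)
  qed
  \<comment> \<open>\<open>f A f\<close> modulo \<open>J\<close> has right inverses, because \<open>T\<close> is simple.\<close>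
  have inv: "\<exists>d\<in>carrier A. d \<otimes> f = d \<and> d \<notin> jacobson A \<and> f \<otimes> d = d \<and>
      (\<forall>u\<in>carrier T. d \<odot>\<^bsub>T\<^esub> (z \<odot>\<^bsub>T\<^esub> u) = f \<odot>\<^bsub>T\<^esub> u)"
    if z: "z \<in> carrier A" "f \<otimes> z = z" "z \<otimes> f = z" "z \<notin> jacobson A" for z
  proof -
    have "z \<odot>\<^bsub>T\<^esub> t \<noteq> \<zero>\<^bsub>T\<^esub>" using tD(5)[of z] z by auto
    then obtain c where c: "c \<in> carrier A" "c \<odot>\<^bsub>T\<^esub> (z \<odot>\<^bsub>T\<^esub> t) = t"
      using simple T.smult_closed z(1) tD(3) by blast
    let ?d = "f \<otimes> c \<otimes> f"
    have d: "?d \<in> carrier A" "f \<otimes> ?d = ?d" "?d \<otimes> f = ?d"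
      using f c by (simp_all add: A.m_assoc) (simp add: A.m_assoc[symmetric])
    have fz: "f \<odot>\<^bsub>T\<^esub> (z \<odot>\<^bsub>T\<^esub> t) = z \<odot>\<^bsub>T\<^esub> t"
      using z f tD(3) by (simp add: T.smult_mult[symmetric])
    have dzt: "?d \<odot>\<^bsub>T\<^esub> (z \<odot>\<^bsub>T\<^esub> t) = t"
      using f c z ft fz tD(3) T.smult_closed by (simp add: T.smult_mult)
    then have "(z \<otimes> ?d \<ominus> f) \<odot>\<^bsub>T\<^esub> t = \<zero>\<^bsub>T\<^esub>"
      using z d f ft tD(3) by (simp add: T.smult_diff_left T.smult_mult T.M.diff_eq_zero_iff)
    then have "f \<otimes> (z \<otimes> ?d \<ominus> f) \<in> jacobson A" using tD(5) z d f by simp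
    moreover have "f \<otimes> (z \<otimes> ?d \<ominus> f) = z \<otimes> ?d \<ominus> f"
      using z d f by (simp add: M.minus_eq A.r_distr A.r_minus A.m_assoc[symmetric])
    ultimately have J: "z \<otimes> ?d \<ominus> f \<in> jacobson A" by simp
    have "?d \<odot>\<^bsub>T\<^esub> (z \<odot>\<^bsub>T\<^esub> u) = f \<odot>\<^bsub>T\<^esub> u" if u: "u \<in> carrier T" for u
      using JT[OF J u] z d f u T.smult_closed
      by (simp add: T.smult_diff_left T.smult_mult T.M.diff_eq_zero_iff)
    moreover have "?d \<notin> jacobson A"
    proof
      assume "?d \<in> jacobson A"
      from JT[OF this T.smult_closed[OF z(1) tD(3)]] have "t = \<zero>\<^bsub>T\<^esub>" using dzt by simp
      then have "z \<odot>\<^bsub>T\<^esub> t = \<zero>\<^bsub>T\<^esub>" using T.smult_zero_right z(1) by simp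
      with \<open>z \<odot>\<^bsub>T\<^esub> t \<noteq> \<zero>\<^bsub>T\<^esub>\<close> show False by simp
    qed
    ultimately show ?thesis using d by (intro bexI[of _ ?d]) blast+
  qed
  have f0: "f \<otimes> (b \<otimes> a \<otimes> f) \<in> jacobson A" if b: "b \<in> carrier A" for b
  proof (rule ccontr)
    assume n: "f \<otimes> (b \<otimes> a \<otimes> f) \<notin> jacobson A"
    define r where "r = f \<otimes> (b \<otimes> a \<otimes> f)"
    have r: "r \<in> carrier A" "f \<otimes> r = r" "r \<otimes> f = r" "r \<notin> jacobson A"
      using f b a n by (simp_all add: r_def A.m_assoc) (simp add: A.m_assoc[symmetric])
    obtain d where d: "d \<in> carrier A" "d \<otimes> f = d" "d \<notin> jacobson A" "f \<otimes> d = d"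
      and rd: "\<And>u. u \<in> carrier T \<Longrightarrow> d \<odot>\<^bsub>T\<^esub> (r \<odot>\<^bsub>T\<^esub> u) = f \<odot>\<^bsub>T\<^esub> u" using inv[OF r] by blast
    obtain d' where d': "d' \<in> carrier A"
      and dd': "\<And>u. u \<in> carrier T \<Longrightarrow> d' \<odot>\<^bsub>T\<^esub> (d \<odot>\<^bsub>T\<^esub> u) = f \<odot>\<^bsub>T\<^esub> u"
      using inv[OF d(1,4,2,3)] by blast
    \<comment> \<open>\<open>t d r = t d r d d' = t d d' = t\<close>: the right inverse \<open>d\<close> of \<open>r\<close> is also a left inverse.\<close>
    let ?v = "d \<odot>\<^bsub>T\<^esub> t"
    have v: "?v \<in> carrier T" "r \<odot>\<^bsub>T\<^esub> ?v \<in> carrier T" using d r tD(3) T.smult_closed by auto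
    have "r \<odot>\<^bsub>T\<^esub> ?v = f \<odot>\<^bsub>T\<^esub> (r \<odot>\<^bsub>T\<^esub> ?v)" using T.smult_mult[OF r(1) f(1) v(1)] r(3) by simp
    also have "\<dots> = d' \<odot>\<^bsub>T\<^esub> (f \<odot>\<^bsub>T\<^esub> ?v)" using dd'[OF v(2)] rd[OF v(1)] by simp
    also have "f \<odot>\<^bsub>T\<^esub> ?v = ?v" using T.smult_mult[OF d(1) f(1) tD(3)] d(2) by simp
    finally have "r \<odot>\<^bsub>T\<^esub> ?v = t" using dd'[OF tD(3)] ft by simp
    moreover have "r \<odot>\<^bsub>T\<^esub> ?v = f \<odot>\<^bsub>T\<^esub> ((d \<otimes> b \<otimes> a) \<odot>\<^bsub>T\<^esub> t)"
    proof -
      have "d \<otimes> r = (d \<otimes> b \<otimes> a) \<otimes> f"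
        using d(1,2) f b a by (simp add: r_def A.m_assoc[symmetric])
      then show ?thesis using d f b a r tD(3) by (simp add: T.smult_mult[symmetric])
    qed
    ultimately have "\<phi> t = \<phi> ((d \<otimes> b \<otimes> a) \<odot>\<^bsub>T\<^esub> t)"
      using \<phi>f[of "(d \<otimes> b \<otimes> a) \<odot>\<^bsub>T\<^esub> t"] d b a tD(3) T.smult_closed by simp
    then show False using zero[of "d \<otimes> b"] d b \<phi> by simp
  qed
  \<comment> \<open>The right ideal \<open>a f A\<close> has its square in \<open>J\<close>, hence lies in \<open>J\<close>.\<close>
  have "a \<otimes> f \<in> K" if K: "maximal_submodule A (regular A) K" for K
  proof (rule ccontr)
    assume n: "a \<otimes> f \<notin> K"
    have sK: "submodule K A (regular A)" using K by (simp add: maximal_submodule_def)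
    have af: "a \<otimes> f \<in> carrier (regular A)" using a f by simp
    have "\<one> \<in> {k \<oplus> (a \<otimes> f) \<otimes> c |k c. k \<in> K \<and> c \<in> carrier A}"
      unfolding J.R.maximal_submodule_add_cyclic[OF K af n, simplified] by simp
    then obtain k c where kc: "\<one> = k \<oplus> a \<otimes> f \<otimes> c" "k \<in> K" "c \<in> carrier A"
      by blast
    have kA: "k \<in> carrier A" using J.R.submodule_mem[OF sK kc(2)] by simp
    have "a \<otimes> f = \<one> \<otimes> (a \<otimes> f)" using a f by simp
    also have "\<dots> = k \<otimes> (a \<otimes> f) \<oplus> a \<otimes> (f \<otimes> (c \<otimes> a \<otimes> f))"
      unfolding kc(1) using kA kc(3) a f by (simp add: A.l_distr A.m_assoc)
    finally have eq: "a \<otimes> f = k \<otimes> (a \<otimes> f) \<oplus> a \<otimes> (f \<otimes> (c \<otimes> a \<otimes> f))" .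
    have "k \<otimes> (a \<otimes> f) \<in> K"
      using J.R.submodule_smult[OF sK, of "a \<otimes> f" k] kc a f by simp
    moreover have "a \<otimes> (f \<otimes> (c \<otimes> a \<otimes> f)) \<in> K"
      using A.jacobson_mult_left[OF f0[OF kc(3)] a] K by (auto simp: rad_def)
    ultimately have "k \<otimes> (a \<otimes> f) \<oplus> a \<otimes> (f \<otimes> (c \<otimes> a \<otimes> f)) \<in> K"
      using J.R.submodule_add[OF sK] by simp
    then show False using n unfolding eq[symmetric] by simp
  qed
  then show ?thesis using a f by (auto simp: rad_def)
qed

end

section \<open>The three isomorphisms\<close>

context fin_dim_algebra
begin

text \<open>
  The isomorphism is \<open>h \<mapsto> (w \<mapsto> \<phi>(h(x w)))\<close>. It is injective because an element \<open>u\<close> of \<open>T\<close> is determined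
  by the values \<open>\<phi>(u a)\<close>, and surjective because, conversely, the values \<open>\<psi>(w a)\<close> are of this form.
\<close>

lemma hom_rad_layer_iso_corner_dual:
  assumes P: "right_module A P" and x: "idempotent_generator A P e x"
    and T: "right_module A T" and t: "top_generator A T f t" and t0: "t \<noteq> \<zero>\<^bsub>T\<^esub>"
    and simple: "\<And>u. u \<in> carrier T \<Longrightarrow> u \<noteq> \<zero>\<^bsub>T\<^esub> \<Longrightarrow> \<exists>c\<in>carrier A. c \<odot>\<^bsub>T\<^esub> u = t"
  shows "mod_iso F (hom_space A (rad_layer A (Suc m) P) T) (corner_dual F A e f m)"
proof -
  interpret P: right_module A P by (rule P)
  interpret T: right_module A T by (rule T)
  interpret RT: right_module F "restrict_scalars A T" using T by (rule right_module_restrict_scalars)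
  note e = idempotent_generatorD(1,2)[OF x] and f = top_generatorD(1,2)[OF t]
    and tD = top_generatorD[OF t]
  let ?I = "jacobson_power A m" and ?L = "rad_layer A (Suc m) P"
  define \<kappa> where "\<kappa> = (\<lambda>w. rad_pow A P (Suc m) +>\<^bsub>P\<^esub> (w \<odot>\<^bsub>P\<^esub> x))"
  note layer = rad_layer_cyclic[OF J.artinian_ring_axioms P x, where m = m, folded fun_cong[OF \<kappa>_def] \<kappa>_def]
  interpret L: right_module A ?L by (rule layer(1))
  note IA = J.jacobson_power_mem and I_right = J.jacobson_power_mult_right
    and I_left = J.jacobson_power_mult_left[rotated]
  note I_add = J.jacobson_power_add
  have \<kappa>L: "\<kappa> w \<in> carrier ?L" if "w \<in> ?I" for w unfolding layer(2) using that by (rule imageI)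
  obtain \<phi> where \<phi>: "functional F (restrict_scalars A T) \<phi>" "\<phi> t = \<one>\<^bsub>F\<^esub>"
    and \<phi>f: "\<And>u. u \<in> carrier T \<Longrightarrow> \<phi> (f \<odot>\<^bsub>T\<^esub> u) = \<phi> u"
    using top_functional[OF T t t0] by blast
  note \<phi>D = functionalD[OF \<phi>(1), simplified]
  have nondeg: "u = u'" if u: "u \<in> carrier T" "u' \<in> carrier T"
    and eq: "\<And>a. a \<in> carrier A \<Longrightarrow> \<phi> (a \<odot>\<^bsub>T\<^esub> u) = \<phi> (a \<odot>\<^bsub>T\<^esub> u')" for u u'
  proof (rule ccontr)
    assume "u \<noteq> u'"
    then have "u \<ominus>\<^bsub>T\<^esub> u' \<noteq> \<zero>\<^bsub>T\<^esub>" using u T.M.diff_eq_zero_iff by simp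
    then obtain c where c: "c \<in> carrier A" "c \<odot>\<^bsub>T\<^esub> (u \<ominus>\<^bsub>T\<^esub> u') = t" using simple u by blast
    have "t \<oplus>\<^bsub>T\<^esub> c \<odot>\<^bsub>T\<^esub> u' = c \<odot>\<^bsub>T\<^esub> u"
      unfolding c(2)[symmetric] using c(1) u T.smult_closed
      by (subst T.smult_diff_right) (simp_all add: T.M.minus_eq T.M.a_assoc T.M.l_neg)
    then have "\<one>\<^bsub>F\<^esub> \<oplus>\<^bsub>F\<^esub> \<phi> (c \<odot>\<^bsub>T\<^esub> u') = \<phi> (c \<odot>\<^bsub>T\<^esub> u')"
      using \<phi>D(2)[of t "c \<odot>\<^bsub>T\<^esub> u'"] \<phi>(2) tD(3) c(1) u T.smult_closed eq[OF c(1)] by simp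
    then have "\<one>\<^bsub>F\<^esub> = \<zero>\<^bsub>F\<^esub>"
      using \<phi>D(1) c(1) u T.smult_closed by (metis F.add.r_cancel_one' F.one_closed)
    then show False using F.one_not_zero by simp
  qed
  show ?thesis
  proof (rule mod_iso_corner_dualI(1)[where \<Phi> = "\<lambda>h w. \<phi> (h (\<kappa> w))"])
    fix h assume "h \<in> carrier (hom_space A ?L T)"
    then have h: "h \<in> mod_hom A ?L T" by simp
    note hD = mod_homD[OF h]
    have h\<kappa>: "h (\<kappa> w) \<in> carrier T" if "w \<in> ?I" for w using hD(1) \<kappa>L that by blast
    show "functional F (A\<lparr>carrier := ?I\<rparr>) (\<lambda>w. \<phi> (h (\<kappa> w)))"
      unfolding functional_def
    proof (intro conjI ballI)
      show "(\<lambda>w. \<phi> (h (\<kappa> w))) \<in> carrier (A\<lparr>carrier := ?I\<rparr>) \<rightarrow> carrier F" using \<phi>D(1) h\<kappa> by simp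
      fix w assume "w \<in> carrier (A\<lparr>carrier := ?I\<rparr>)"
      then have w: "w \<in> ?I" by simp
      { fix w' assume "w' \<in> carrier (A\<lparr>carrier := ?I\<rparr>)"
        then have w': "w' \<in> ?I" by simp
        show "\<phi> (h (\<kappa> (w \<oplus>\<^bsub>A\<lparr>carrier := ?I\<rparr>\<^esub> w'))) = \<phi> (h (\<kappa> w)) \<oplus>\<^bsub>F\<^esub> \<phi> (h (\<kappa> w'))"
          using layer(4)[OF w w'] hD(2)[OF \<kappa>L[OF w] \<kappa>L[OF w']] \<phi>D(2)[OF h\<kappa>[OF w] h\<kappa>[OF w']]
          by simp }
      fix c assume c: "c \<in> carrier F"
      have "c \<odot> w = w \<otimes> (c \<odot> \<one>)" using c IA[OF w] by (simp add: scalar_one_mult)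
      then show "\<phi> (h (\<kappa> (c \<odot>\<^bsub>A\<lparr>carrier := ?I\<rparr>\<^esub> w))) = c \<otimes>\<^bsub>F\<^esub> \<phi> (h (\<kappa> w))"
        using layer(5)[OF scalar_one[OF c] w] hD(3)[OF scalar_one[OF c] \<kappa>L[OF w]] \<phi>D(3)[OF c h\<kappa>[OF w]]
        by simp
    qed
    show "\<phi> (h (\<kappa> k)) = \<zero>\<^bsub>F\<^esub>" if "k \<in> jacobson_power A (Suc m)" for k
      unfolding layer(3)[OF that] mod_hom_zero[OF h layer(1) T]
      using RT.functional_zero[OF \<phi>(1)] by simp
    show "\<phi> (h (\<kappa> (e \<otimes> w \<otimes> f))) = \<phi> (h (\<kappa> w))" if w: "w \<in> ?I" for w
      using layer(5)[OF f(1) I_left[OF w e(1)]] layer(6)[OF w] hD(3)[OF f(1) \<kappa>L[OF w]] \<phi>f[OF h\<kappa>[OF w]]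
      by simp
    show "\<phi> ((c \<odot>\<^bsub>hom_space A ?L T\<^esub> h) (\<kappa> w)) = c \<otimes>\<^bsub>F\<^esub> \<phi> (h (\<kappa> w))"
      if "c \<in> carrier F" "w \<in> ?I" for c w
      using \<phi>D(3)[OF that(1) h\<kappa>[OF that(2)]] \<kappa>L[OF that(2)] by simp
    { fix h' assume "h' \<in> carrier (hom_space A ?L T)"
      then have h': "h' \<in> mod_hom A ?L T" by simp
      note h'D = mod_homD[OF h']
      have h'\<kappa>: "h' (\<kappa> w) \<in> carrier T" if "w \<in> ?I" for w using h'D(1) \<kappa>L that by blast
      show "\<phi> ((h \<oplus>\<^bsub>hom_space A ?L T\<^esub> h') (\<kappa> w)) = \<phi> (h (\<kappa> w)) \<oplus>\<^bsub>F\<^esub> \<phi> (h' (\<kappa> w))" if "w \<in> ?I" for w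
        using \<phi>D(2)[OF h\<kappa>[OF that] h'\<kappa>[OF that]] \<kappa>L[OF that] by simp
      assume eq: "\<And>w. w \<in> ?I \<Longrightarrow> \<phi> (h (\<kappa> w)) = \<phi> (h' (\<kappa> w))"
      show "h = h'"
      proof (rule mod_hom_eqI[OF h h'])
        fix X assume "X \<in> carrier ?L"
        then obtain w where w: "w \<in> ?I" "X = \<kappa> w" unfolding layer(2) by (auto simp del: rad_pow.simps)
        show "h X = h' X"
        proof (rule nondeg)
          show "h X \<in> carrier T" "h' X \<in> carrier T" using w h\<kappa> h'\<kappa> by auto
          fix a assume a: "a \<in> carrier A"
          show "\<phi> (a \<odot>\<^bsub>T\<^esub> h X) = \<phi> (a \<odot>\<^bsub>T\<^esub> h' X)"
            using eq[OF I_right[OF w(1) a]] layer(5)[OF a w(1)] hD(3)[OF a \<kappa>L[OF w(1)]]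
              h'D(3)[OF a \<kappa>L[OF w(1)]] w(2) by simp
        qed
      qed }
  next
    fix \<psi> assume \<psi>: "\<psi> \<in> carrier (corner_dual F A e f m)"
    note \<psi>D = corner_dualD[OF \<psi> e f]
    have "functional F A (\<lambda>z. \<phi> (z \<odot>\<^bsub>T\<^esub> t))"
      unfolding functional_def
    proof (intro conjI ballI)
      show "(\<lambda>z. \<phi> (z \<odot>\<^bsub>T\<^esub> t)) \<in> carrier A \<rightarrow> carrier F" using \<phi>D(1) T.smult_closed tD(3) by simp
      show "\<phi> ((z \<oplus> z') \<odot>\<^bsub>T\<^esub> t) = \<phi> (z \<odot>\<^bsub>T\<^esub> t) \<oplus>\<^bsub>F\<^esub> \<phi> (z' \<odot>\<^bsub>T\<^esub> t)"
        if "z \<in> carrier A" "z' \<in> carrier A" for z z'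
        using that \<phi>D(2) T.smult_closed tD(3) by (simp add: T.smult_l_distr)
      show "\<phi> ((c \<odot> z) \<odot>\<^bsub>T\<^esub> t) = c \<otimes>\<^bsub>F\<^esub> \<phi> (z \<odot>\<^bsub>T\<^esub> t)" if c: "c \<in> carrier F" and z: "z \<in> carrier A" for c z
      proof -
        have "(c \<odot> z) \<odot>\<^bsub>T\<^esub> t = (c \<odot> \<one>) \<odot>\<^bsub>T\<^esub> (z \<odot>\<^bsub>T\<^esub> t)"
          using T.smult_mult[OF z scalar_one[OF c] tD(3)] scalar_one_mult(2)[OF c z] by simp
        then show ?thesis using \<phi>D(3)[OF c T.smult_closed[OF z tD(3)]] by simp
      qed
    qed
    note \<phi>t = functionalD[OF this]
    \<comment> \<open>For fixed \<open>w\<close>, the functional \<open>a \<mapsto> \<psi> (w a)\<close> is \<open>a \<mapsto> \<phi> (u a)\<close> for a unique \<open>u \<in> T\<close>.\<close>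
    have "\<exists>u\<in>carrier T. \<forall>a\<in>carrier A. \<psi> (w \<otimes> a) = \<phi> (a \<odot>\<^bsub>T\<^esub> u)" if w: "w \<in> ?I" for w
    proof -
      have "\<exists>b\<in>carrier A. \<forall>a\<in>carrier A. \<psi> (w \<otimes> a) = \<phi> ((b \<otimes> a) \<odot>\<^bsub>T\<^esub> t)"
      proof (rule functional_representation[OF F.field_axioms right_module_scalars fin_dim right_module_scalars])
        show "functional F A (\<lambda>a. \<phi> ((b \<otimes> a) \<odot>\<^bsub>T\<^esub> t))" if b: "b \<in> carrier A" for b
          using b \<phi>t by (auto simp: functional_def A.r_distr smult_mult_right)
        show "functional F A (\<lambda>b. \<phi> ((b \<otimes> a) \<odot>\<^bsub>T\<^esub> t))" if a: "a \<in> carrier A" for a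
          using a \<phi>t by (auto simp: functional_def A.l_distr smult_mult_left)
        show "functional F A (\<lambda>a. \<psi> (w \<otimes> a))"
          using w \<psi>D(1,2,3) I_right IA
          by (auto simp: functional_def A.r_distr smult_mult_right)
        show "\<psi> (w \<otimes> a) = \<zero>\<^bsub>F\<^esub>"
          if a: "a \<in> carrier A" and zero: "\<And>b. b \<in> carrier A \<Longrightarrow> \<phi> ((b \<otimes> a) \<odot>\<^bsub>T\<^esub> t) = \<zero>\<^bsub>F\<^esub>" for a
        proof -
          have "\<phi> t \<noteq> \<zero>\<^bsub>F\<^esub>" using \<phi>(2) F.one_not_zero by simp
          then have "a \<otimes> f \<in> jacobson A"
            using top_pairing_kernel[OF T t simple _ \<phi>f a zero] by blast
          then have "w \<otimes> (a \<otimes> f) \<in> jacobson_power A (Suc m)"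
            using J.jacobson_power_mult_jacobson w by blast
          then have "\<psi> (w \<otimes> a \<otimes> f) = \<zero>\<^bsub>F\<^esub>"
            using \<psi>D(4)[OF w] IA[OF w] a f by (simp add: A.m_assoc del: rad_pow.simps)
          then show ?thesis using \<psi>D(6)[OF I_right[OF w a]] by simp
        qed
      qed
      then obtain b where b: "b \<in> carrier A" "\<forall>a\<in>carrier A. \<psi> (w \<otimes> a) = \<phi> ((b \<otimes> a) \<odot>\<^bsub>T\<^esub> t)"
        by blast
      then show ?thesis
        using tD(3) T.smult_closed by (intro bexI[of _ "b \<odot>\<^bsub>T\<^esub> t"]) (simp_all add: T.smult_mult)
    qed
    then obtain g where g: "\<And>w. w \<in> ?I \<Longrightarrow> g w \<in> carrier T"
      "\<And>w a. w \<in> ?I \<Longrightarrow> a \<in> carrier A \<Longrightarrow> \<psi> (w \<otimes> a) = \<phi> (a \<odot>\<^bsub>T\<^esub> g w)" by metis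
    have "\<exists>h\<in>mod_hom A ?L T. \<forall>w\<in>?I. h (\<kappa> w) = g w"
    proof (rule mod_hom_descend[where sm = "\<lambda>w w'. w \<oplus> w'" and act = "\<lambda>a w. w \<otimes> a"])
      show "carrier ?L = \<kappa> ` ?I" by (rule layer(2))
      show "w \<oplus> w' \<in> ?I \<and> \<kappa> (w \<oplus> w') = \<kappa> w \<oplus>\<^bsub>?L\<^esub> \<kappa> w'" if "w \<in> ?I" "w' \<in> ?I" for w w'
        using I_add[OF that] layer(4)[OF that] ..
      show "w \<otimes> a \<in> ?I \<and> \<kappa> (w \<otimes> a) = a \<odot>\<^bsub>?L\<^esub> \<kappa> w" if "a \<in> carrier A" "w \<in> ?I" for a w
        using I_right[OF that(2,1)] layer(5)[OF that] ..
      show "g w \<in> carrier T" if "w \<in> ?I" for w using that by (rule g(1))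
      show "g (w \<oplus> w') = g w \<oplus>\<^bsub>T\<^esub> g w'" if w: "w \<in> ?I" "w' \<in> ?I" for w w'
      proof (rule nondeg)
        show "\<phi> (a \<odot>\<^bsub>T\<^esub> g (w \<oplus> w')) = \<phi> (a \<odot>\<^bsub>T\<^esub> (g w \<oplus>\<^bsub>T\<^esub> g w'))" if a: "a \<in> carrier A" for a
          using g(2)[OF I_add[OF w] a] g(2)[OF w(1) a] g(2)[OF w(2) a] a g(1) w I_right IA
            \<psi>D(2)[OF I_right[OF w(1) a] I_right[OF w(2) a]]
            \<phi>D(2)[OF T.smult_closed[OF a g(1)[OF w(1)]] T.smult_closed[OF a g(1)[OF w(2)]]]
          by (simp add: A.l_distr T.smult_r_distr)
      qed (use g(1) w I_add in auto)
      show "g (w \<otimes> b) = b \<odot>\<^bsub>T\<^esub> g w" if b: "b \<in> carrier A" and w: "w \<in> ?I" for b w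
      proof (rule nondeg)
        show "\<phi> (a \<odot>\<^bsub>T\<^esub> g (w \<otimes> b)) = \<phi> (a \<odot>\<^bsub>T\<^esub> (b \<odot>\<^bsub>T\<^esub> g w))" if a: "a \<in> carrier A" for a
          using g(2)[OF I_right[OF w b] a] g(2)[OF w, of "b \<otimes> a"] a b g(1)[OF w] IA[OF w]
          by (simp add: A.m_assoc T.smult_mult)
      qed (use g(1) w b I_right T.smult_closed in auto)
      show "g w = g w'" if w: "w \<in> ?I" "w' \<in> ?I" and eq: "\<kappa> w = \<kappa> w'" for w w'
      proof (rule nondeg)
        show "\<phi> (a \<odot>\<^bsub>T\<^esub> g w) = \<phi> (a \<odot>\<^bsub>T\<^esub> g w')" if a: "a \<in> carrier A" for a
        proof -
          have "\<kappa> (w \<otimes> a) = \<kappa> (w' \<otimes> a)" using layer(5)[OF a] w eq by simp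
          then have "\<psi> (w \<otimes> a) = \<psi> (w' \<otimes> a)"
            using layer(7)[OF I_right[OF w(1) a] I_right[OF w(2) a]] \<psi>D(7)[OF I_right[OF w(1) a] I_right[OF w(2) a]]
            by blast
          then show ?thesis using g(2)[OF _ a] w by simp
        qed
      qed (use g(1) w in auto)
    qed
    then obtain h where h: "h \<in> mod_hom A ?L T" "\<forall>w\<in>?I. h (\<kappa> w) = g w" by blast
    have "\<phi> (h (\<kappa> w)) = \<psi> w" if w: "w \<in> ?I" for w
      using h(2) g(2)[OF w A.one_closed] w IA[OF w] g(1)[OF w] T.smult_one by simp
    then show "\<exists>h\<in>carrier (hom_space A ?L T). \<forall>w\<in>?I. \<phi> (h (\<kappa> w)) = \<psi> w" using h(1) by auto
  qed (use e f hom_space_closed[OF layer(1) T] in \<open>simp_all del: hom_space_simps\<close>)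
qed

lemma idempotent_generator_opposite_eq:
  assumes D: "right_module (opposite A) D" and \<tau>: "idempotent_generator (opposite A) D f \<tau>"
    and a: "a \<in> carrier A" "b \<in> carrier A" and eq: "a \<odot>\<^bsub>D\<^esub> \<tau> = b \<odot>\<^bsub>D\<^esub> \<tau>"
  shows "a \<otimes> f = b \<otimes> f"
proof -
  interpret D: right_module "opposite A" D by (rule D)
  note \<tau>D = idempotent_generatorD[OF \<tau>, unfolded opposite_simps]
  have "(a \<ominus> b) \<odot>\<^bsub>D\<^esub> \<tau> = \<zero>\<^bsub>D\<^esub>"
    using D.smult_diff_left[of a b \<tau>] eq a \<tau>D(3) D.smult_closed by (simp add: D.M.diff_eq_zero_iff)
  then have "(a \<ominus> b) \<otimes> f = \<zero>" using \<tau>D(5) a by simp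
  then have "a \<otimes> f \<ominus> b \<otimes> f = \<zero>"
    using a \<tau>D(1) by (simp add: M.minus_eq A.l_distr A.l_minus)
  then show ?thesis using M.diff_eq_zero_iff a \<tau>D(1) by simp
qed

lemma top_generator_eq:
  assumes S: "right_module A S" and s: "top_generator A S e s"
    and a: "a \<in> carrier A" "b \<in> carrier A" and eq: "a \<odot>\<^bsub>S\<^esub> s = b \<odot>\<^bsub>S\<^esub> s"
  shows "e \<otimes> (a \<ominus> b) \<in> jacobson A"
proof -
  interpret S: right_module A S by (rule S)
  note sD = top_generatorD[OF s]
  have "(a \<ominus> b) \<odot>\<^bsub>S\<^esub> s = \<zero>\<^bsub>S\<^esub>"
    using S.smult_diff_left[of a b s] eq a sD(3) S.smult_closed by (simp add: S.M.diff_eq_zero_iff)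
  then show ?thesis using sD(5) a by simp
qed

text \<open>
  By invariance only \<open>e a w\<close> and \<open>e b w\<close> matter, and their difference lies in \<open>J J\<^sup>m\<close>, where \<open>\<psi>\<close> vanishes.
\<close>

lemma corner_dual_left_eq:
  assumes \<psi>: "\<psi> \<in> carrier (corner_dual F A e f m)"
    and e: "e \<in> carrier A" "e \<otimes> e = e" and f: "f \<in> carrier A" "f \<otimes> f = f"
    and a: "a \<in> carrier A" "b \<in> carrier A" and eab: "e \<otimes> (a \<ominus> b) \<in> jacobson A"
    and w: "w \<in> jacobson_power A m"
  shows "\<psi> (a \<otimes> w) = \<psi> (b \<otimes> w)"
proof (rule corner_dualD(7)[OF \<psi> e f])
  have wA: "w \<in> carrier A" using w J.jacobson_power_sub by auto
  show "a \<otimes> w \<in> jacobson_power A m" "b \<otimes> w \<in> jacobson_power A m"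
    using a w by (simp_all add: J.jacobson_power_mult_left)
  show "e \<otimes> (a \<ominus> b) \<otimes> w \<in> jacobson_power A (Suc m)"
    using eab w by (rule J.jacobson_mult_jacobson_power)
  have "e \<otimes> (e \<otimes> (a \<ominus> b) \<otimes> w \<oplus> b \<otimes> w)
      = e \<otimes> (a \<ominus> b) \<otimes> w \<oplus> e \<otimes> (b \<otimes> w)"
    using e a wA by (simp add: A.r_distr A.m_assoc[symmetric])
  also have "\<dots> = e \<otimes> (a \<otimes> w)"
    using e a wA
    by (simp add: M.minus_eq A.r_distr A.l_distr A.r_minus A.l_minus A.m_assoc M.a_assoc M.l_neg)
  finally show "e \<otimes> (a \<otimes> w) = e \<otimes> (e \<otimes> (a \<ominus> b) \<otimes> w \<oplus> b \<otimes> w)" ..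
qed

text \<open>
  The homomorphism \<open>h\<close> corresponds to the functional \<open>w \<mapsto> h(w \<tau>)(s)\<close>. As \<open>s\<close> generates \<open>S\<close>, it determines
  \<open>h(w \<tau>)(s a) = h(a w \<tau>)(s)\<close>.
\<close>

lemma corner_dual_iso_hom_rad_layer_F_dual:
  assumes D: "right_module (opposite A) D" and \<tau>: "idempotent_generator (opposite A) D f \<tau>"
    and S: "right_module A S" and s: "top_generator A S e s"
  shows "mod_iso F (corner_dual F A e f m)
    (hom_space (opposite A) (rad_layer (opposite A) (Suc m) D) (F_dual F A S))"
proof -
  interpret O: fin_dim_algebra F "opposite A" by (rule fin_dim_algebra_opposite)
  interpret S: right_module A S by (rule S)
  interpret RS: right_module F "restrict_scalars A S" using S by (rule right_module_restrict_scalars)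
  note FS = right_module_F_dual[OF S]
  interpret FS: right_module "opposite A" "F_dual F A S" by (rule FS)
  note f = idempotent_generatorD(1,2)[OF \<tau>, unfolded opposite_simps]
    and e = top_generatorD(1,2)[OF s] and sD = top_generatorD[OF s]
  have es: "e \<odot>\<^bsub>S\<^esub> s = s" using s by (rule S.top_generator_fix)
  let ?I = "jacobson_power A m" and ?L = "rad_layer (opposite A) (Suc m) D"
  let ?H = "hom_space (opposite A) ?L (F_dual F A S)"
  define \<kappa> where "\<kappa> = (\<lambda>w. rad_pow (opposite A) D (Suc m) +>\<^bsub>D\<^esub> (w \<odot>\<^bsub>D\<^esub> \<tau>))"
  note layer = rad_layer_cyclic[OF O.J.artinian_ring_axioms D \<tau>, where m = m,
    folded fun_cong[OF \<kappa>_def] \<kappa>_def, unfolded J.jacobson_power_opposite opposite_simps]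
  note IA = J.jacobson_power_mem and I_right = J.jacobson_power_mult_right
    and I_left = J.jacobson_power_mult_left[rotated]
  note I_add = J.jacobson_power_add
  have \<kappa>L: "\<kappa> w \<in> carrier ?L" if "w \<in> ?I" for w unfolding layer(2) using that by (rule imageI)
  have sc: "\<theta> ((c \<odot> \<one>) \<odot>\<^bsub>S\<^esub> u) = c \<otimes>\<^bsub>F\<^esub> \<theta> u"
    if "\<theta> \<in> carrier (F_dual F A S)" "c \<in> carrier F" "u \<in> carrier S" for \<theta> c u
    using that functionalD(3)[of F "restrict_scalars A S" \<theta> c u] by (simp add: F_dual_iff)
  show ?thesis
  proof (rule mod_iso_corner_dualI(2)[where \<Phi> = "\<lambda>h w. h (\<kappa> w) s"])
    fix h assume "h \<in> carrier ?H"
    then have h: "h \<in> mod_hom (opposite A) ?L (F_dual F A S)" by simp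
    note hD = mod_homD[OF h, unfolded opposite_simps]
    have h\<kappa>: "h (\<kappa> w) \<in> carrier (F_dual F A S)" if "w \<in> ?I" for w using hD(1)[OF \<kappa>L[OF that]] .
    have h\<kappa>s: "h (\<kappa> w) u \<in> carrier F" if "w \<in> ?I" "u \<in> carrier S" for w u
      using h\<kappa>[OF that(1)] that(2) functionalD(1)[of F "restrict_scalars A S" "h (\<kappa> w)" u]
      by (simp add: F_dual_iff)
    show "functional F (A\<lparr>carrier := ?I\<rparr>) (\<lambda>w. h (\<kappa> w) s)"
      unfolding functional_def
    proof (intro conjI ballI)
      show "(\<lambda>w. h (\<kappa> w) s) \<in> carrier (A\<lparr>carrier := ?I\<rparr>) \<rightarrow> carrier F" using h\<kappa>s sD(3) by simp
      fix w assume "w \<in> carrier (A\<lparr>carrier := ?I\<rparr>)"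
      then have w: "w \<in> ?I" by simp
      { fix w' assume "w' \<in> carrier (A\<lparr>carrier := ?I\<rparr>)"
        then have w': "w' \<in> ?I" by simp
        show "h (\<kappa> (w \<oplus>\<^bsub>A\<lparr>carrier := ?I\<rparr>\<^esub> w')) s = h (\<kappa> w) s \<oplus>\<^bsub>F\<^esub> h (\<kappa> w') s"
          using layer(4)[OF w w'] hD(2)[OF \<kappa>L[OF w] \<kappa>L[OF w']] sD(3) by (simp add: F_dual_simps) }
      fix c assume c: "c \<in> carrier F"
      have "c \<odot> w = (c \<odot> \<one>) \<otimes> w" using c IA[OF w] by (simp add: scalar_one_mult)
      then show "h (\<kappa> (c \<odot>\<^bsub>A\<lparr>carrier := ?I\<rparr>\<^esub> w)) s = c \<otimes>\<^bsub>F\<^esub> h (\<kappa> w) s"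
        using layer(5)[OF scalar_one[OF c] w] hD(3)[OF scalar_one[OF c] \<kappa>L[OF w]]
          sc[OF h\<kappa>[OF w] c sD(3)] sD(3)
        by (simp add: F_dual_simps)
    qed
    show "h (\<kappa> k) s = \<zero>\<^bsub>F\<^esub>" if "k \<in> jacobson_power A (Suc m)" for k
      unfolding layer(3)[OF that] mod_hom_zero[OF h layer(1) FS] using sD(3) by (simp add: F_dual_simps)
    show "h (\<kappa> (e \<otimes> w \<otimes> f)) s = h (\<kappa> w) s" if w: "w \<in> ?I" for w
      using layer(6)[OF I_left[OF w e(1)]] layer(5)[OF e(1) w] hD(3)[OF e(1) \<kappa>L[OF w]] es sD(3)
      by (simp add: F_dual_simps)
    show "(c \<odot>\<^bsub>?H\<^esub> h) (\<kappa> w) s = c \<otimes>\<^bsub>F\<^esub> h (\<kappa> w) s" if "c \<in> carrier F" "w \<in> ?I" for c w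
      using sc[OF h\<kappa>[OF that(2)] that(1) sD(3)] \<kappa>L[OF that(2)] sD(3) by (simp add: F_dual_simps)
    { fix h' assume "h' \<in> carrier ?H"
      then have h': "h' \<in> mod_hom (opposite A) ?L (F_dual F A S)" by simp
      note h'D = mod_homD[OF h', unfolded opposite_simps]
      show "(h \<oplus>\<^bsub>?H\<^esub> h') (\<kappa> w) s = h (\<kappa> w) s \<oplus>\<^bsub>F\<^esub> h' (\<kappa> w) s" if "w \<in> ?I" for w
        using \<kappa>L[OF that] sD(3) by (simp add: F_dual_simps)
      assume eq: "\<And>w. w \<in> ?I \<Longrightarrow> h (\<kappa> w) s = h' (\<kappa> w) s"
      show "h = h'"
      proof (rule mod_hom_eqI[OF h h'])
        fix X assume X: "X \<in> carrier ?L"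
        then obtain w where w: "w \<in> ?I" "X = \<kappa> w"
          unfolding layer(2) by (auto simp del: rad_pow.simps)
        have "h X \<in> extensional (carrier S)" "h' X \<in> extensional (carrier S)"
          using hD(1)[OF X] h'D(1)[OF X] by (simp_all add: F_dual_iff)
        then show "h X = h' X"
        proof (rule extensionalityI)
          fix u assume "u \<in> carrier S"
          then obtain a where a: "a \<in> carrier A" "u = a \<odot>\<^bsub>S\<^esub> s" unfolding sD(4) by blast
          show "h X u = h' X u"
            using eq[OF I_left[OF w(1) a(1)]] layer(5)[OF a(1) w(1)] hD(3)[OF a(1) X]
              h'D(3)[OF a(1) X] w(2) a(2) sD(3) by (simp add: F_dual_simps)
        qed
      qed }
  next
    fix \<psi> assume \<psi>: "\<psi> \<in> carrier (corner_dual F A e f m)"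
    note \<psi>D = corner_dualD[OF \<psi> e f]
    have "\<exists>\<theta>\<in>carrier (F_dual F A S). \<forall>a\<in>carrier A. \<theta> (a \<odot>\<^bsub>S\<^esub> s) = \<psi> (a \<otimes> w)" if w: "w \<in> ?I" for w
    proof (rule functional_descend[OF S sD(3,4)])
      show "functional F A (\<lambda>a. \<psi> (a \<otimes> w))"
        using w \<psi>D(1,2,3) I_left IA by (auto simp: functional_def A.l_distr smult_mult_left)
      show "\<psi> (a \<otimes> w) = \<psi> (b \<otimes> w)"
        if "a \<in> carrier A" "b \<in> carrier A" "a \<odot>\<^bsub>S\<^esub> s = b \<odot>\<^bsub>S\<^esub> s" for a b
        using corner_dual_left_eq[OF \<psi> e f that(1,2) top_generator_eq[OF S s that] w] .
    qed
    then obtain g where g: "\<And>w. w \<in> ?I \<Longrightarrow> g w \<in> carrier (F_dual F A S)"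
      "\<And>w a. w \<in> ?I \<Longrightarrow> a \<in> carrier A \<Longrightarrow> g w (a \<odot>\<^bsub>S\<^esub> s) = \<psi> (a \<otimes> w)" by metis
    have ext: "\<theta> = \<theta>'" if "\<theta> \<in> carrier (F_dual F A S)" "\<theta>' \<in> carrier (F_dual F A S)"
      and eq: "\<And>a. a \<in> carrier A \<Longrightarrow> \<theta> (a \<odot>\<^bsub>S\<^esub> s) = \<theta>' (a \<odot>\<^bsub>S\<^esub> s)" for \<theta> \<theta>'
    proof (rule extensionalityI[of _ "carrier S"])
      show "\<theta> \<in> extensional (carrier S)" "\<theta>' \<in> extensional (carrier S)"
        using that(1,2) by (simp_all add: F_dual_iff)
      fix u assume "u \<in> carrier S"
      then obtain a where "a \<in> carrier A" "u = a \<odot>\<^bsub>S\<^esub> s" unfolding sD(4) by blast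
      then show "\<theta> u = \<theta>' u" using eq by simp
    qed
    have "\<exists>h\<in>mod_hom (opposite A) ?L (F_dual F A S). \<forall>w\<in>?I. h (\<kappa> w) = g w"
    proof (rule mod_hom_descend[where sm = "\<lambda>w w'. w \<oplus> w'" and act = "\<lambda>a w. a \<otimes> w"])
      show "carrier ?L = \<kappa> ` ?I" by (rule layer(2))
      show "w \<oplus> w' \<in> ?I \<and> \<kappa> (w \<oplus> w') = \<kappa> w \<oplus>\<^bsub>?L\<^esub> \<kappa> w'" if "w \<in> ?I" "w' \<in> ?I" for w w'
        using I_add[OF that] layer(4)[OF that] ..
      show "a \<otimes> w \<in> ?I \<and> \<kappa> (a \<otimes> w) = a \<odot>\<^bsub>?L\<^esub> \<kappa> w"
        if "a \<in> carrier (opposite A)" "w \<in> ?I" for a w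
        using that I_left[OF that(2)] layer(5)[OF _ that(2)] by simp
      show "g w \<in> carrier (F_dual F A S)" if "w \<in> ?I" for w using that by (rule g(1))
      show "g (w \<oplus> w') = g w \<oplus>\<^bsub>F_dual F A S\<^esub> g w'" if w: "w \<in> ?I" "w' \<in> ?I" for w w'
      proof (rule ext)
        show "g (w \<oplus> w') (a \<odot>\<^bsub>S\<^esub> s) = (g w \<oplus>\<^bsub>F_dual F A S\<^esub> g w') (a \<odot>\<^bsub>S\<^esub> s)"
          if a: "a \<in> carrier A" for a
          using g(2)[OF I_add[OF w] a] g(2)[OF w(1) a] g(2)[OF w(2) a] IA w
            \<psi>D(2)[OF I_left[OF w(1) a] I_left[OF w(2) a]] a S.smult_closed[OF a sD(3)]
          by (simp add: F_dual_simps A.r_distr)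
      qed (use g(1) w I_add FS.M.a_closed in auto)
      show "g (b \<otimes> w) = b \<odot>\<^bsub>F_dual F A S\<^esub> g w" if b': "b \<in> carrier (opposite A)" and w: "w \<in> ?I" for b w
      proof (rule ext)
        have b: "b \<in> carrier A" using b' by simp
        show "g (b \<otimes> w) \<in> carrier (F_dual F A S)" by (rule g(1)[OF I_left[OF w b]])
        show "b \<odot>\<^bsub>F_dual F A S\<^esub> g w \<in> carrier (F_dual F A S)" by (rule FS.smult_closed[OF b' g(1)[OF w]])
        show "g (b \<otimes> w) (a \<odot>\<^bsub>S\<^esub> s) = (b \<odot>\<^bsub>F_dual F A S\<^esub> g w) (a \<odot>\<^bsub>S\<^esub> s)"
          if a: "a \<in> carrier A" for a
          using g(2)[OF I_left[OF w b] a] g(2)[OF w, of "a \<otimes> b"] a b IA[OF w] sD(3) S.smult_closed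
          by (simp add: F_dual_simps A.m_assoc S.smult_mult)
      qed
      show "g w = g w'" if w: "w \<in> ?I" "w' \<in> ?I" and eq: "\<kappa> w = \<kappa> w'" for w w'
      proof (rule ext)
        show "g w (a \<odot>\<^bsub>S\<^esub> s) = g w' (a \<odot>\<^bsub>S\<^esub> s)" if a: "a \<in> carrier A" for a
        proof -
          have "\<kappa> (a \<otimes> w) = \<kappa> (a \<otimes> w')" using layer(5)[OF a] w eq by simp
          then have "\<psi> (a \<otimes> w) = \<psi> (a \<otimes> w')"
            using layer(7)[OF I_left[OF w(1) a] I_left[OF w(2) a]]
              \<psi>D(8)[OF I_left[OF w(1) a] I_left[OF w(2) a]]
            by blast
          then show ?thesis using g(2)[OF _ a] w by simp
        qed
      qed (use g(1) w in auto)
    qed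
    then obtain h where h: "h \<in> mod_hom (opposite A) ?L (F_dual F A S)" "\<forall>w\<in>?I. h (\<kappa> w) = g w" by blast
    have "h (\<kappa> w) s = \<psi> w" if w: "w \<in> ?I" for w
      using h(2) g(2)[OF w A.one_closed] w IA[OF w] S.smult_one[OF sD(3)] by simp
    then show "\<exists>h\<in>carrier ?H. \<forall>w\<in>?I. h (\<kappa> w) s = \<psi> w" using h(1) by auto
  qed (use e f O.hom_space_closed[OF layer(1) FS] in \<open>simp_all del: hom_space_simps\<close>)
qed

lemma soc_pow_F_dual_iff:
  assumes D: "right_module (opposite A) D"
    and \<tau>: "\<tau> \<in> carrier D" "carrier D = {a \<odot>\<^bsub>D\<^esub> \<tau> |a. a \<in> carrier A}"
    and \<theta>: "\<theta> \<in> carrier (F_dual F (opposite A) D)"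
  shows "\<theta> \<in> soc_pow A (F_dual F (opposite A) D) n \<longleftrightarrow>
    (\<forall>w\<in>jacobson_power A n. \<theta> (w \<odot>\<^bsub>D\<^esub> \<tau>) = \<zero>\<^bsub>F\<^esub>)"
proof -
  interpret D: right_module "opposite A" D by (rule D)
  have V: "right_module A (F_dual F (opposite A) D)"
    using fin_dim_algebra.right_module_F_dual[OF fin_dim_algebra_opposite D] by simp
  have "a \<odot>\<^bsub>F_dual F (opposite A) D\<^esub> \<theta> = \<zero>\<^bsub>F_dual F (opposite A) D\<^esub> \<longleftrightarrow>
      (\<forall>b\<in>carrier A. \<theta> ((a \<otimes> b) \<odot>\<^bsub>D\<^esub> \<tau>) = \<zero>\<^bsub>F\<^esub>)" if a: "a \<in> carrier A" for a
  proof -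
    have "a \<odot>\<^bsub>D\<^esub> (b \<odot>\<^bsub>D\<^esub> \<tau>) = (a \<otimes> b) \<odot>\<^bsub>D\<^esub> \<tau>" if "b \<in> carrier A" for b
      using D.smult_mult[of b a \<tau>] a that \<tau>(1) by simp
    moreover have "a \<odot>\<^bsub>F_dual F (opposite A) D\<^esub> \<theta> = \<zero>\<^bsub>F_dual F (opposite A) D\<^esub> \<longleftrightarrow>
        (\<forall>d\<in>carrier D. \<theta> (a \<odot>\<^bsub>D\<^esub> d) = \<zero>\<^bsub>F\<^esub>)"
      by (auto simp: F_dual_def fun_eq_iff)
    ultimately show ?thesis unfolding \<tau>(2) by auto
  qed
  moreover have "jacobson_power A n \<subseteq> carrier A" by (rule J.jacobson_power_sub)
  ultimately have "\<theta> \<in> soc_pow A (F_dual F (opposite A) D) n \<longleftrightarrow>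
      (\<forall>w\<in>jacobson_power A n. \<forall>b\<in>carrier A. \<theta> ((w \<otimes> b) \<odot>\<^bsub>D\<^esub> \<tau>) = \<zero>\<^bsub>F\<^esub>)"
    using \<theta> unfolding soc_pow_eq(1)[OF J.artinian_ring_axioms V] by (auto simp: subset_iff)
  also have "\<dots> \<longleftrightarrow> (\<forall>w\<in>jacobson_power A n. \<theta> (w \<odot>\<^bsub>D\<^esub> \<tau>) = \<zero>\<^bsub>F\<^esub>)"
  proof
    assume L: "\<forall>w\<in>jacobson_power A n. \<forall>b\<in>carrier A. \<theta> ((w \<otimes> b) \<odot>\<^bsub>D\<^esub> \<tau>) = \<zero>\<^bsub>F\<^esub>"
    show "\<forall>w\<in>jacobson_power A n. \<theta> (w \<odot>\<^bsub>D\<^esub> \<tau>) = \<zero>\<^bsub>F\<^esub>"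
    proof
      fix w assume w: "w \<in> jacobson_power A n"
      then have "w \<in> carrier A" using J.jacobson_power_sub by auto
      then show "\<theta> (w \<odot>\<^bsub>D\<^esub> \<tau>) = \<zero>\<^bsub>F\<^esub>" using L[rule_format, OF w A.one_closed] by simp
    qed
  qed (use J.jacobson_power_mult_right in blast)
  finally show ?thesis .
qed

text \<open>
  The homomorphism \<open>h\<close> is determined by \<open>h(s)\<close>, a class of functionals on \<open>D = A \<tau>\<close> with common
  restriction to \<open>J\<^sup>m \<tau>\<close>; this restriction is the corresponding element of the dual of the corner.
  Conversely, a functional on \<open>J\<^sup>m\<close> extends to \<open>A\<close>, and composing it with \<open>a \<mapsto> a f\<close> gives a functional on
  \<open>A \<tau> \<cong> A f\<close>.
\<close>

lemma corner_dual_iso_hom_soc_layer_F_dual: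
  assumes D: "right_module (opposite A) D" and \<tau>: "idempotent_generator (opposite A) D f \<tau>"
    and S: "right_module A S" and s: "top_generator A S e s"
  shows "mod_iso F (corner_dual F A e f m)
    (hom_space A S (soc_layer A (Suc m) (F_dual F (opposite A) D)))"
proof -
  interpret O: fin_dim_algebra F "opposite A" by (rule fin_dim_algebra_opposite)
  interpret S: right_module A S by (rule S)
  interpret D: right_module "opposite A" D by (rule D)
  let ?V = "F_dual F (opposite A) D"
  have V: "right_module A ?V" using O.right_module_F_dual[OF D] by simp
  interpret FV: right_module A ?V by (rule V)
  note f = idempotent_generatorD(1,2)[OF \<tau>, unfolded opposite_simps]
    and \<tau>D = idempotent_generatorD(3,4)[OF \<tau>, unfolded opposite_simps]
    and e = top_generatorD(1,2)[OF s] and sD = top_generatorD[OF s]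
  have es: "e \<odot>\<^bsub>S\<^esub> s = s" using s by (rule S.top_generator_fix)
  have f\<tau>: "f \<odot>\<^bsub>D\<^esub> \<tau> = \<tau>" using \<tau> by (rule D.idempotent_generator_fix)
  let ?I = "jacobson_power A m"
  let ?U = "soc_pow A ?V (Suc m)" and ?N = "soc_pow A ?V m" and ?L = "soc_layer A (Suc m) ?V"
  let ?H = "hom_space A S ?L"
  note IA = J.jacobson_power_mem and I_right = J.jacobson_power_mult_right
    and I_left = J.jacobson_power_mult_left[rotated]
  have KI: "k \<in> ?I" if "k \<in> jacobson_power A (Suc m)" for k
    using that by (rule subsetD[OF rad_pow_Suc_subset])
  note U = soc_pow_eq(2)[OF J.artinian_ring_axioms V, of "Suc m"]
    and N = soc_pow_eq(2)[OF J.artinian_ring_axioms V, of m]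
  note soc_iff = soc_pow_F_dual_iff[OF D \<tau>D]
  have UV: "\<theta> \<in> carrier ?V" if "\<theta> \<in> ?U" for \<theta> using FV.submodule_mem[OF U that] .
  have NV: "\<theta> \<in> carrier ?V" if "\<theta> \<in> ?N" for \<theta> using FV.submodule_mem[OF N that] .
  have NU: "?N \<subseteq> ?U"
  proof
    fix \<theta> assume \<theta>: "\<theta> \<in> ?N"
    then show "\<theta> \<in> ?U" using soc_iff[OF NV[OF \<theta>]] KI by blast
  qed
  have layer: "?L = quot_module (?V\<lparr>carrier := ?U\<rparr>) ?N" by (simp add: soc_layer_def del: soc_pow.simps)
  have L: "right_module A ?L" unfolding layer using U N NU by (rule FV.section_right_module)
  note L_add = FV.section_add[OF U N NU, folded layer]
    and L_smult = FV.section_smult[OF U N NU, folded layer]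
    and L_carrier = FV.section_carrier[OF U N NU, folded layer]
  have w\<tau>: "w \<odot>\<^bsub>D\<^esub> \<tau> \<in> carrier D" if "w \<in> carrier A" for w
    using D.smult_closed[of w \<tau>] that \<tau>D(1) by simp
  have mult_\<tau>: "a \<odot>\<^bsub>D\<^esub> (b \<odot>\<^bsub>D\<^esub> \<tau>) = (a \<otimes> b) \<odot>\<^bsub>D\<^esub> \<tau>" if "a \<in> carrier A" "b \<in> carrier A" for a b
    using D.smult_mult[of b a \<tau>] that \<tau>D(1) by simp
  have V_add: "(\<theta> \<oplus>\<^bsub>?V\<^esub> \<theta>') (w \<odot>\<^bsub>D\<^esub> \<tau>) = \<theta> (w \<odot>\<^bsub>D\<^esub> \<tau>) \<oplus>\<^bsub>F\<^esub> \<theta>' (w \<odot>\<^bsub>D\<^esub> \<tau>)"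
    if "w \<in> carrier A" for \<theta> \<theta>' w
    using w\<tau>[OF that] by (simp add: O.F_dual_simps)
  have V_smult: "(a \<odot>\<^bsub>?V\<^esub> \<theta>) (w \<odot>\<^bsub>D\<^esub> \<tau>) = \<theta> ((a \<otimes> w) \<odot>\<^bsub>D\<^esub> \<tau>)"
    if "a \<in> carrier A" "w \<in> carrier A" for a w \<theta>
    using w\<tau>[OF that(2)] mult_\<tau>[OF that] by (simp add: O.F_dual_simps)
  have V_fun: "functional F A (\<lambda>w. \<theta> (w \<odot>\<^bsub>D\<^esub> \<tau>))" if "\<theta> \<in> carrier ?V" for \<theta>
  proof -
    have "functional F (restrict_scalars (opposite A) D) \<theta>" using that by (simp add: O.F_dual_iff)
    note \<theta>D = functionalD[OF this, simplified]
    show ?thesis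
      unfolding functional_def
    proof (intro conjI ballI)
      show "(\<lambda>w. \<theta> (w \<odot>\<^bsub>D\<^esub> \<tau>)) \<in> carrier A \<rightarrow> carrier F" using \<theta>D(1) w\<tau> by simp
      show "\<theta> ((w \<oplus> w') \<odot>\<^bsub>D\<^esub> \<tau>) = \<theta> (w \<odot>\<^bsub>D\<^esub> \<tau>) \<oplus>\<^bsub>F\<^esub> \<theta> (w' \<odot>\<^bsub>D\<^esub> \<tau>)"
        if "w \<in> carrier A" "w' \<in> carrier A" for w w'
        using that \<theta>D(2)[OF w\<tau> w\<tau>] D.smult_l_distr[of w w' \<tau>] \<tau>D(1) by simp
      show "\<theta> ((c \<odot> w) \<odot>\<^bsub>D\<^esub> \<tau>) = c \<otimes>\<^bsub>F\<^esub> \<theta> (w \<odot>\<^bsub>D\<^esub> \<tau>)" if c: "c \<in> carrier F" and w: "w \<in> carrier A" for c w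
        using \<theta>D(3)[OF c w\<tau>[OF w]] mult_\<tau>[OF scalar_one[OF c] w] c w by (simp add: scalar_one_mult)
    qed
  qed
  have V_F: "\<theta> (w \<odot>\<^bsub>D\<^esub> \<tau>) \<in> carrier F" if "\<theta> \<in> carrier ?V" "w \<in> carrier A" for \<theta> w
    using functionalD(1)[OF V_fun[OF that(1)] that(2)] .
  \<comment> \<open>Two elements of \<open>soc\<^sup>m\<^sup>+\<^sup>1\<close> are congruent modulo \<open>soc\<^sup>m\<close> iff they agree on \<open>J\<^sup>m \<tau>\<close>.\<close>
  have coset_iff: "?N +>\<^bsub>?V\<^esub> \<theta> = ?N +>\<^bsub>?V\<^esub> \<theta>' \<longleftrightarrow> (\<forall>w\<in>?I. \<theta> (w \<odot>\<^bsub>D\<^esub> \<tau>) = \<theta>' (w \<odot>\<^bsub>D\<^esub> \<tau>))"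
    if \<theta>: "\<theta> \<in> carrier ?V" "\<theta>' \<in> carrier ?V" for \<theta> \<theta>'
  proof -
    have "?N +>\<^bsub>?V\<^esub> \<theta> = ?N +>\<^bsub>?V\<^esub> \<theta>' \<longleftrightarrow> (\<exists>k\<in>?N. \<theta> = k \<oplus>\<^bsub>?V\<^esub> \<theta>')" by (rule FV.coset_eq_iff[OF N \<theta>])
    also have "\<dots> \<longleftrightarrow> (\<forall>w\<in>?I. \<theta> (w \<odot>\<^bsub>D\<^esub> \<tau>) = \<theta>' (w \<odot>\<^bsub>D\<^esub> \<tau>))"
    proof
      assume "\<exists>k\<in>?N. \<theta> = k \<oplus>\<^bsub>?V\<^esub> \<theta>'"
      then obtain k where k: "k \<in> ?N" "\<theta> = k \<oplus>\<^bsub>?V\<^esub> \<theta>'" by blast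
      show "\<forall>w\<in>?I. \<theta> (w \<odot>\<^bsub>D\<^esub> \<tau>) = \<theta>' (w \<odot>\<^bsub>D\<^esub> \<tau>)"
      proof
        fix w assume w: "w \<in> ?I"
        then have "k (w \<odot>\<^bsub>D\<^esub> \<tau>) = \<zero>\<^bsub>F\<^esub>" using soc_iff[OF NV[OF k(1)]] k(1) by blast
        then show "\<theta> (w \<odot>\<^bsub>D\<^esub> \<tau>) = \<theta>' (w \<odot>\<^bsub>D\<^esub> \<tau>)"
          using V_add[OF IA[OF w], of k \<theta>'] k(2) V_F[OF \<theta>(2) IA[OF w]] by simp
      qed
    next
      assume eq: "\<forall>w\<in>?I. \<theta> (w \<odot>\<^bsub>D\<^esub> \<tau>) = \<theta>' (w \<odot>\<^bsub>D\<^esub> \<tau>)"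
      let ?k = "\<theta> \<ominus>\<^bsub>?V\<^esub> \<theta>'"
      have k: "?k \<in> carrier ?V" and \<theta>k: "\<theta> = ?k \<oplus>\<^bsub>?V\<^esub> \<theta>'"
        using \<theta> by (simp_all add: FV.M.minus_eq FV.M.a_assoc FV.M.l_neg)
      have "?k (w \<odot>\<^bsub>D\<^esub> \<tau>) = \<zero>\<^bsub>F\<^esub>" if w: "w \<in> ?I" for w
      proof -
        have "\<theta> (w \<odot>\<^bsub>D\<^esub> \<tau>) = ?k (w \<odot>\<^bsub>D\<^esub> \<tau>) \<oplus>\<^bsub>F\<^esub> \<theta>' (w \<odot>\<^bsub>D\<^esub> \<tau>)"
          using V_add[OF IA[OF w], of ?k \<theta>'] \<theta>k by metis
        then have "?k (w \<odot>\<^bsub>D\<^esub> \<tau>) \<oplus>\<^bsub>F\<^esub> \<theta> (w \<odot>\<^bsub>D\<^esub> \<tau>) = \<theta> (w \<odot>\<^bsub>D\<^esub> \<tau>)" using eq w by simp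
        then show ?thesis
          using V_F[OF k IA[OF w]] V_F[OF \<theta>(1) IA[OF w]] by (metis F.add.r_cancel_one)
      qed
      then have "?k \<in> ?N" using soc_iff[OF k] by blast
      then show "\<exists>k\<in>?N. \<theta> = k \<oplus>\<^bsub>?V\<^esub> \<theta>'" using \<theta>k by blast
    qed
    finally show ?thesis .
  qed
  define rep where "rep X = (SOME \<theta>. \<theta> \<in> ?U \<and> X = ?N +>\<^bsub>?V\<^esub> \<theta>)" for X
  have rep: "rep X \<in> ?U \<and> X = ?N +>\<^bsub>?V\<^esub> rep X" if "X \<in> carrier ?L" for X
  proof -
    have "\<exists>\<theta>. \<theta> \<in> ?U \<and> X = ?N +>\<^bsub>?V\<^esub> \<theta>" using that unfolding L_carrier by blast
    then show ?thesis unfolding rep_def by (rule someI_ex)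
  qed
  have rep_eq: "rep X (w \<odot>\<^bsub>D\<^esub> \<tau>) = \<theta> (w \<odot>\<^bsub>D\<^esub> \<tau>)"
    if X: "X \<in> carrier ?L" "X = ?N +>\<^bsub>?V\<^esub> \<theta>" and \<theta>: "\<theta> \<in> ?U" and w: "w \<in> ?I" for X \<theta> w
  proof -
    have "?N +>\<^bsub>?V\<^esub> rep X = ?N +>\<^bsub>?V\<^esub> \<theta>" using rep[OF X(1)] X(2) by simp
    then show ?thesis using coset_iff[OF UV UV] rep[OF X(1)] \<theta> w by blast
  qed
  show ?thesis
  proof (rule mod_iso_corner_dualI(2)[where \<Phi> = "\<lambda>h w. rep (h s) (w \<odot>\<^bsub>D\<^esub> \<tau>)"])
    fix h assume "h \<in> carrier ?H"
    then have h: "h \<in> mod_hom A S ?L" by simp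
    note hD = mod_homD[OF h]
    have hs: "h s \<in> carrier ?L" using hD(1) sD(3) by blast
    have rU: "rep (h s) \<in> ?U" and hs_eq: "h s = ?N +>\<^bsub>?V\<^esub> rep (h s)" using rep[OF hs] by auto
    note rV = UV[OF rU]
    note \<theta>D = functionalD[OF V_fun[OF rV]]
    show "functional F (A\<lparr>carrier := ?I\<rparr>) (\<lambda>w. rep (h s) (w \<odot>\<^bsub>D\<^esub> \<tau>))"
      using \<theta>D IA by (simp add: functional_def)
    show "rep (h s) (k \<odot>\<^bsub>D\<^esub> \<tau>) = \<zero>\<^bsub>F\<^esub>" if "k \<in> jacobson_power A (Suc m)" for k
      using soc_iff[OF rV] rU that by blast
    show "rep (h s) ((e \<otimes> w \<otimes> f) \<odot>\<^bsub>D\<^esub> \<tau>) = rep (h s) (w \<odot>\<^bsub>D\<^esub> \<tau>)" if w: "w \<in> ?I" for w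
    proof -
      have "(e \<otimes> w \<otimes> f) \<odot>\<^bsub>D\<^esub> \<tau> = (e \<otimes> w) \<odot>\<^bsub>D\<^esub> \<tau>"
        using mult_\<tau>[of "e \<otimes> w" f] f\<tau> e(1) f(1) IA[OF w] by simp
      moreover have "rep (h s) (w \<odot>\<^bsub>D\<^esub> \<tau>) = (e \<odot>\<^bsub>?V\<^esub> rep (h s)) (w \<odot>\<^bsub>D\<^esub> \<tau>)"
      proof (rule rep_eq[OF hs _ FV.submodule_smult[OF U e(1) rU] w])
        have "h s = e \<odot>\<^bsub>?L\<^esub> h s" using hD(3)[OF e(1) sD(3)] es by simp
        then show "h s = ?N +>\<^bsub>?V\<^esub> (e \<odot>\<^bsub>?V\<^esub> rep (h s))" using L_smult[OF e(1) rU] hs_eq by metis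
      qed
      ultimately show ?thesis using V_smult[OF e(1) IA[OF w]] by simp
    qed
    show "rep ((c \<odot>\<^bsub>?H\<^esub> h) s) (w \<odot>\<^bsub>D\<^esub> \<tau>) = c \<otimes>\<^bsub>F\<^esub> rep (h s) (w \<odot>\<^bsub>D\<^esub> \<tau>)"
      if c: "c \<in> carrier F" and w: "w \<in> ?I" for c w
    proof -
      note c1 = scalar_one[OF c]
      have eq: "(c \<odot>\<^bsub>?H\<^esub> h) s = (c \<odot> \<one>) \<odot>\<^bsub>?L\<^esub> h s" using sD(3) by simp
      have mem: "(c \<odot>\<^bsub>?H\<^esub> h) s \<in> carrier ?L" unfolding eq using L c1 hs by (rule right_module.smult_closed)
      have "(c \<odot>\<^bsub>?H\<^esub> h) s = ?N +>\<^bsub>?V\<^esub> ((c \<odot> \<one>) \<odot>\<^bsub>?V\<^esub> rep (h s))"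
        unfolding eq using L_smult[OF c1 rU] hs_eq by metis
      from rep_eq[OF mem this FV.submodule_smult[OF U c1 rU] w]
      show ?thesis
        using V_smult[OF c1 IA[OF w]] \<theta>D(3)[OF c IA[OF w]] c IA[OF w] by (simp add: scalar_one_mult)
    qed
    { fix h' assume "h' \<in> carrier ?H"
      then have h': "h' \<in> mod_hom A S ?L" by simp
      note h'D = mod_homD[OF h']
      have h's: "h' s \<in> carrier ?L" using h'D(1) sD(3) by blast
      have rU': "rep (h' s) \<in> ?U" and h's_eq: "h' s = ?N +>\<^bsub>?V\<^esub> rep (h' s)" using rep[OF h's] by auto
      show "rep ((h \<oplus>\<^bsub>?H\<^esub> h') s) (w \<odot>\<^bsub>D\<^esub> \<tau>) = rep (h s) (w \<odot>\<^bsub>D\<^esub> \<tau>) \<oplus>\<^bsub>F\<^esub> rep (h' s) (w \<odot>\<^bsub>D\<^esub> \<tau>)"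
        if w: "w \<in> ?I" for w
      proof -
        have eq: "(h \<oplus>\<^bsub>?H\<^esub> h') s = h s \<oplus>\<^bsub>?L\<^esub> h' s" using sD(3) by simp
        interpret L: right_module A ?L by (rule L)
        have mem: "(h \<oplus>\<^bsub>?H\<^esub> h') s \<in> carrier ?L" unfolding eq using hs h's by (rule L.M.a_closed)
        have "(h \<oplus>\<^bsub>?H\<^esub> h') s = ?N +>\<^bsub>?V\<^esub> (rep (h s) \<oplus>\<^bsub>?V\<^esub> rep (h' s))"
          unfolding eq using L_add[OF rU rU'] hs_eq h's_eq by metis
        from rep_eq[OF mem this FV.submodule_add[OF U rU rU'] w]
        show ?thesis using V_add[OF IA[OF w]] by simp
      qed
      assume eq: "\<And>w. w \<in> ?I \<Longrightarrow> rep (h s) (w \<odot>\<^bsub>D\<^esub> \<tau>) = rep (h' s) (w \<odot>\<^bsub>D\<^esub> \<tau>)"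
      have hh's: "h s = h' s"
        using coset_iff[OF rV UV[OF rU']] eq hs_eq h's_eq by metis
      show "h = h'"
      proof (rule mod_hom_eqI[OF h h'])
        fix u assume "u \<in> carrier S"
        then obtain a where "a \<in> carrier A" "u = a \<odot>\<^bsub>S\<^esub> s" unfolding sD(4) by blast
        then show "h u = h' u" using hD(3) h'D(3) sD(3) hh's by simp
      qed }
  next
    fix \<psi> assume \<psi>: "\<psi> \<in> carrier (corner_dual F A e f m)"
    note \<psi>D = corner_dualD[OF \<psi> e f]
    have "functional F (A\<lparr>carrier := ?I\<rparr>) \<psi>" using \<psi> by (simp add: corner_dual_def)
    then obtain \<phi> where \<phi>: "functional F A \<phi>" "\<forall>w\<in>?I. \<phi> w = \<psi> w"
      using V.functional_extend[OF F.field_axioms finite_length_scalars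
          right_ideal_subspace[OF J.R.submodule_rad_pow]] by blast
    note \<phi>D = functionalD[OF \<phi>(1)]
    have "functional F A (\<lambda>a. \<phi> (a \<otimes> f))"
      using \<phi>D f(1) by (auto simp: functional_def A.l_distr smult_mult_left)
    then have "functional F (opposite A) (\<lambda>a. \<phi> (a \<otimes> f))" by (simp add: functional_def)
    moreover have "\<phi> (a \<otimes> f) = \<phi> (b \<otimes> f)"
      if "a \<in> carrier (opposite A)" "b \<in> carrier (opposite A)" "a \<odot>\<^bsub>D\<^esub> \<tau> = b \<odot>\<^bsub>D\<^esub> \<tau>" for a b
      using idempotent_generator_opposite_eq[OF D \<tau> _ _ that(3)] that(1,2) by simp
    ultimately have "\<exists>\<theta>\<in>carrier ?V. \<forall>a\<in>carrier (opposite A). \<theta> (a \<odot>\<^bsub>D\<^esub> \<tau>) = \<phi> (a \<otimes> f)"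
      by (rule O.functional_descend[OF D idempotent_generatorD(3,4)[OF \<tau>]])
    then obtain \<theta> where \<theta>: "\<theta> \<in> carrier ?V" "\<forall>a\<in>carrier A. \<theta> (a \<odot>\<^bsub>D\<^esub> \<tau>) = \<phi> (a \<otimes> f)"
      by auto
    have \<theta>I: "\<theta> (w \<odot>\<^bsub>D\<^esub> \<tau>) = \<psi> w" if w: "w \<in> ?I" for w
      using \<theta>(2) IA[OF w] \<phi>(2) I_right[OF w f(1)] \<psi>D(6)[OF w] by simp
    have \<theta>U: "\<theta> \<in> ?U"
      unfolding soc_iff[OF \<theta>(1)]
    proof
      fix k assume k: "k \<in> jacobson_power A (Suc m)"
      show "\<theta> (k \<odot>\<^bsub>D\<^esub> \<tau>) = \<zero>\<^bsub>F\<^esub>" using \<theta>I[OF KI[OF k]] \<psi>D(4)[OF KI[OF k] k] by simp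
    qed
    have a\<theta>: "a \<odot>\<^bsub>?V\<^esub> \<theta> \<in> ?U" if "a \<in> carrier A" for a using FV.submodule_smult[OF U that \<theta>U] .
    have "\<exists>h\<in>mod_hom A S ?L. \<forall>a\<in>carrier A. h (a \<odot>\<^bsub>S\<^esub> s) = ?N +>\<^bsub>?V\<^esub> (a \<odot>\<^bsub>?V\<^esub> \<theta>)"
    proof (rule mod_hom_descend[where sm = "\<lambda>a b. a \<oplus> b" and act = "\<lambda>a b. b \<otimes> a"])
      show "carrier S = (\<lambda>a. a \<odot>\<^bsub>S\<^esub> s) ` carrier A" using sD(4) by auto
      show "a \<oplus> b \<in> carrier A \<and> (a \<oplus> b) \<odot>\<^bsub>S\<^esub> s = a \<odot>\<^bsub>S\<^esub> s \<oplus>\<^bsub>S\<^esub> b \<odot>\<^bsub>S\<^esub> s"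
        if "a \<in> carrier A" "b \<in> carrier A" for a b
        using that sD(3) by (simp add: S.smult_l_distr)
      show "b \<otimes> a \<in> carrier A \<and> (b \<otimes> a) \<odot>\<^bsub>S\<^esub> s = a \<odot>\<^bsub>S\<^esub> (b \<odot>\<^bsub>S\<^esub> s)"
        if "a \<in> carrier A" "b \<in> carrier A" for a b
        using that sD(3) by (simp add: S.smult_mult)
      show "?N +>\<^bsub>?V\<^esub> (a \<odot>\<^bsub>?V\<^esub> \<theta>) \<in> carrier ?L" if "a \<in> carrier A" for a
        unfolding L_carrier using a\<theta>[OF that] by blast
      show "?N +>\<^bsub>?V\<^esub> ((a \<oplus> b) \<odot>\<^bsub>?V\<^esub> \<theta>) = (?N +>\<^bsub>?V\<^esub> (a \<odot>\<^bsub>?V\<^esub> \<theta>)) \<oplus>\<^bsub>?L\<^esub> (?N +>\<^bsub>?V\<^esub> (b \<odot>\<^bsub>?V\<^esub> \<theta>))"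
        if "a \<in> carrier A" "b \<in> carrier A" for a b
        using L_add[OF a\<theta> a\<theta>] FV.smult_l_distr[OF _ _ \<theta>(1)] that by simp
      show "?N +>\<^bsub>?V\<^esub> ((b \<otimes> a) \<odot>\<^bsub>?V\<^esub> \<theta>) = a \<odot>\<^bsub>?L\<^esub> (?N +>\<^bsub>?V\<^esub> (b \<odot>\<^bsub>?V\<^esub> \<theta>))"
        if "a \<in> carrier A" "b \<in> carrier A" for a b
        using L_smult[OF _ a\<theta>] FV.smult_mult[OF _ _ \<theta>(1)] that by simp
      show "?N +>\<^bsub>?V\<^esub> (a \<odot>\<^bsub>?V\<^esub> \<theta>) = ?N +>\<^bsub>?V\<^esub> (b \<odot>\<^bsub>?V\<^esub> \<theta>)"
        if ab: "a \<in> carrier A" "b \<in> carrier A" "a \<odot>\<^bsub>S\<^esub> s = b \<odot>\<^bsub>S\<^esub> s" for a b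
        unfolding coset_iff[OF UV[OF a\<theta>[OF ab(1)]] UV[OF a\<theta>[OF ab(2)]]]
      proof
        fix w assume w: "w \<in> ?I"
        show "(a \<odot>\<^bsub>?V\<^esub> \<theta>) (w \<odot>\<^bsub>D\<^esub> \<tau>) = (b \<odot>\<^bsub>?V\<^esub> \<theta>) (w \<odot>\<^bsub>D\<^esub> \<tau>)"
          using V_smult[OF ab(1) IA[OF w], of \<theta>] V_smult[OF ab(2) IA[OF w], of \<theta>]
            \<theta>I[OF I_left[OF w ab(1)]] \<theta>I[OF I_left[OF w ab(2)]]
            corner_dual_left_eq[OF \<psi> e f ab(1,2) top_generator_eq[OF S s ab] w] by simp
      qed
    qed
    then obtain h where h: "h \<in> mod_hom A S ?L"
      "\<forall>a\<in>carrier A. h (a \<odot>\<^bsub>S\<^esub> s) = ?N +>\<^bsub>?V\<^esub> (a \<odot>\<^bsub>?V\<^esub> \<theta>)" by blast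
    have hs: "h s = ?N +>\<^bsub>?V\<^esub> \<theta>"
      using bspec[OF h(2) A.one_closed] S.smult_one[OF sD(3)] FV.smult_one[OF \<theta>(1)] by simp
    have "rep (h s) (w \<odot>\<^bsub>D\<^esub> \<tau>) = \<psi> w" if w: "w \<in> ?I" for w
      using rep_eq[OF mod_homD(1)[OF h(1) sD(3)] hs \<theta>U w] \<theta>I[OF w] by simp
    then show "\<exists>h\<in>carrier ?H. \<forall>w\<in>?I. rep (h s) (w \<odot>\<^bsub>D\<^esub> \<tau>) = \<psi> w" using h(1) by auto
  qed (use e f hom_space_closed[OF S L] in \<open>simp_all del: hom_space_simps\<close>)
qed

end

theorem theorem1p3:
  fixes F :: "('f, 'k) ring_scheme" and A :: "('f, 'a) module"
    and S\<^sub>i :: "('a, 's) module" and S\<^sub>j :: "('a, 't) module"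
    and P\<^sub>i :: "('a, 'p) module" and P\<^sub>j :: "('a, 'q) module"
    and \<pi>\<^sub>i :: "'p \<Rightarrow> 's" and \<pi>\<^sub>j :: "'q \<Rightarrow> 't" and n :: nat
  assumes "fd_algebra F A"
    and "simple_module A S\<^sub>i" and "projective_cover A P\<^sub>i S\<^sub>i \<pi>\<^sub>i"
    and "simple_module A S\<^sub>j" and "projective_cover A P\<^sub>j S\<^sub>j \<pi>\<^sub>j"
    and "n \<ge> 1"
  shows "mod_iso F (hom_space A (rad_layer A n P\<^sub>i) S\<^sub>j)
           (hom_space (opposite A) (rad_layer (opposite A) n (A_dual A P\<^sub>j)) (F_dual F A S\<^sub>i))
       \<and> mod_iso F (hom_space A (rad_layer A n P\<^sub>i) S\<^sub>j)
           (hom_space A S\<^sub>i (soc_layer A n (nakayama F A P\<^sub>j)))"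
proof -
  interpret fin_dim_algebra F A by (rule fin_dim_algebra.intro) (rule assms(1))
  interpret O: fin_dim_algebra F "opposite A" by (rule fin_dim_algebra_opposite)
  obtain m where n: "n = Suc m" using assms(6) by (cases n) auto
  obtain e x s \<sigma> where i: "idempotent_generator A P\<^sub>i e x" "top_generator A S\<^sub>i e s"
    using projective_cover_generators[OF A.ring_axioms assms(2,3)] by blast
  obtain f y t \<tau> where j: "top_generator A S\<^sub>j f t" "t \<noteq> \<zero>\<^bsub>S\<^sub>j\<^esub>"
    "idempotent_generator (opposite A) (A_dual A P\<^sub>j) f \<tau>"
    using projective_cover_generators[OF A.ring_axioms assms(4,5)] by blast
  have mods: "right_module A P\<^sub>i" "right_module A P\<^sub>j" "right_module A S\<^sub>i" "right_module A S\<^sub>j"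
    using assms(2-5)
    unfolding projective_cover_def projective_module_def simple_module_def fg_right_module_def
    by blast+
  have simple: "\<exists>c\<in>carrier A. c \<odot>\<^bsub>S\<^sub>j\<^esub> u = t" if u: "u \<in> carrier S\<^sub>j" "u \<noteq> \<zero>\<^bsub>S\<^sub>j\<^esub>" for u
    using top_generatorD(3)[OF j(1)] unfolding simple_module_cyclic[OF assms(4) u] by blast
  note D = right_module_A_dual[OF mods(2)]
  let ?H1 = "hom_space A (rad_layer A n P\<^sub>i) S\<^sub>j"
  let ?H2 = "hom_space (opposite A) (rad_layer (opposite A) n (A_dual A P\<^sub>j)) (F_dual F A S\<^sub>i)"
  let ?H3 = "hom_space A S\<^sub>i (soc_layer A n (nakayama F A P\<^sub>j))"
  let ?W = "corner_dual F A e f m"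
  have 1: "mod_iso F ?H1 ?W"
    unfolding n using hom_rad_layer_iso_corner_dual[OF mods(1) i(1) mods(4) j(1,2) simple] by blast
  have 2: "mod_iso F ?W ?H2"
    unfolding n by (rule corner_dual_iso_hom_rad_layer_F_dual[OF D j(3) mods(3) i(2)])
  have 3: "mod_iso F ?W ?H3"
    unfolding n nakayama_def by (rule corner_dual_iso_hom_soc_layer_F_dual[OF D j(3) mods(3) i(2)])
  have "right_module A (rad_layer A n P\<^sub>i)"
    unfolding n by (rule rad_layer_cyclic(1)[OF J.artinian_ring_axioms mods(1) i(1)])
  note closed = hom_space_closed[OF this mods(4)]
  show ?thesis using mod_iso_trans[OF 1 2 closed] mod_iso_trans[OF 1 3 closed] by blast
qed

end
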